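(* Let $G$ be a connected reductive complex algebraic group with Lie algebra $\mathfrak g$ and let $\Phi=\Phi_\pi:G\to\mathfrak g$ be the generalized Cayley mapping of an infinitesimally faithful rational representation $\pi$. Let $a\in G$ with Jordan decomposition $a=a_sa_u$. Put $\mathfrak c=\mathrm{Cent}(\mathfrak g^{a_s})$, $\mathfrak s=[\mathfrak g^{a_s},\mathfrak g^{a_s}]$ and $\mathfrak s^{a_u}=\{X\in\mathfrak s:\mathrm{Ad}_{a_u}X=X\}$, so that $\mathfrak g^a=\mathfrak c\oplus\mathfrak s^{a_u}$. Then $$\Phi(a_s)=\Phi(a)_s,$$ and the Jordan decomposition of $\Phi(a)$ is its decomposition into components with respect to this direct sum: $$\Phi(a)=\Phi(a_s)+\Phi(a)_n\in\mathfrak g^a=\mathfrak c\oplus\mathfrak s^{a_u},\qquad \Phi(a_s)\in\mathfrak c,\quad \Phi(a)_n\in\mathfrak s^{a_u}.$$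
   Context: For an infinitesimally faithful (i.e. $\pi'=d\pi(e):\mathfrak g\to\mathrm{End}(V)$ injective) finite-dimensional rational representation $\pi:G\to\mathrm{Aut}(V)$, the form $\mathrm{tr}(\pi'(X)\pi'(Y))$ on $\mathfrak g$ is nondegenerate, and the generalized Cayley mapping $\Phi=\Phi_\pi:G\to\mathfrak g$ is the morphism of varieties defined by $\mathrm{tr}(\pi'(\Phi(g))\pi'(X))=\mathrm{tr}(\pi(g)\pi'(X))$ for all $g\in G$, $X\in\mathfrak g$. For $a\in G$, $a=a_sa_u=a_ua_s$ is the multiplicative Jordan decomposition ($a_s$ semisimple, $a_u$ unipotent); for $X\in\mathfrak g$, $X=X_s+X_n$ with $[X_s,X_n]=0$ is the additive Jordan decomposition ($X_s$ semisimple, $X_n$ nilpotent). For $b\in G$, $\mathfrak g^b=\{X\in\mathfrak g:\mathrm{Ad}_bX=X\}$; $\mathrm{Cent}$ denotes the center of a Lie algebra. *)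

theory Defs
  imports "HOL-Analysis.Analysis" "HOL-Algebra.Coset"
begin

text \<open>
  Linear algebraic groups are taken in their concrete form, as Zariski closed subgroups
  of some \<open>GL\<^sub>n(\<complex>)\<close>; every affine algebraic group over \<open>\<complex>\<close> is of this form. Matrices are
  \<open>complex^'n^'n\<close>, with product \<open>**\<close> and identity \<open>mat 1\<close> (the type class operations
  \<open>*\<close> and \<open>1\<close> on this type are entrywise and are not used).
\<close>

definition GL :: "(complex^'n^'n) monoid" where
  "GL = \<lparr>carrier = {A. invertible A}, mult = (**), one = mat 1\<rparr>"

definition cscale :: "complex \<Rightarrow> complex^'n^'m \<Rightarrow> complex^'n^'m" where
  "cscale c A = (\<chi> i j. c * A $ i $ j)"

global_interpretation cmat: vector_space "cscale :: complex \<Rightarrow> complex^'n^'m \<Rightarrow> complex^'n^'m"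
  by unfold_locales (simp_all add: cscale_def vec_eq_iff algebra_simps)


section \<open>Zariski topology and regular functions\<close>

text \<open>The coordinate ring \<open>\<complex>[x\<^sub>i\<^sub>j, 1/det]\<close> of \<open>GL\<^sub>n(\<complex>)\<close>. Its members are total functions on
  matrices; only their values on invertible matrices matter.\<close>

inductive_set GL_regular :: "(complex^'n^'n \<Rightarrow> complex) set" where
  const: "(\<lambda>A. c) \<in> GL_regular"
| entry: "(\<lambda>A. A $ i $ j) \<in> GL_regular"
| inv_det: "(\<lambda>A. inverse (det A)) \<in> GL_regular"
| add: "f \<in> GL_regular \<Longrightarrow> g \<in> GL_regular \<Longrightarrow> (\<lambda>A. f A + g A) \<in> GL_regular"
| mult: "f \<in> GL_regular \<Longrightarrow> g \<in> GL_regular \<Longrightarrow> (\<lambda>A. f A * g A) \<in> GL_regular"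

definition zariski :: "(complex^'n^'n) topology" where
  "zariski = topology (\<lambda>U. \<exists>S \<subseteq> GL_regular. U = {A. invertible A \<and> (\<exists>f\<in>S. f A \<noteq> 0)})"

lemma openin_zariski:
  fixes U :: "(complex^'n^'n) set"
  shows "openin zariski U \<longleftrightarrow> (\<exists>S \<subseteq> GL_regular. U = {A. invertible A \<and> (\<exists>f\<in>S. f A \<noteq> 0)})"
proof -
  let ?P = "\<lambda>U :: (complex^'n^'n) set.
    \<exists>S \<subseteq> GL_regular. U = {A. invertible A \<and> (\<exists>f\<in>S. f A \<noteq> 0)}"
  have "istopology ?P"
    unfolding istopology_def
  proof (intro conjI allI impI)
    fix U V :: "(complex^'n^'n) set"
    assume "?P U" and "?P V"
    then obtain S T where S: "S \<subseteq> GL_regular" "U = {A. invertible A \<and> (\<exists>f\<in>S. f A \<noteq> 0)}"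
      and T: "T \<subseteq> GL_regular" "V = {A. invertible A \<and> (\<exists>f\<in>T. f A \<noteq> 0)}"
      by blast
    let ?R = "{\<lambda>A. f A * g A | f g. f \<in> S \<and> g \<in> T}"
    have "?R \<subseteq> GL_regular"
      using S(1) T(1) by (auto intro: GL_regular.mult)
    moreover have "U \<inter> V = {A. invertible A \<and> (\<exists>f\<in>?R. f A \<noteq> 0)}"
    proof
      show "U \<inter> V \<subseteq> {A. invertible A \<and> (\<exists>f\<in>?R. f A \<noteq> 0)}"
      proof
        fix A assume "A \<in> U \<inter> V"
        then obtain f g where "invertible A" "f \<in> S" "g \<in> T" "f A * g A \<noteq> 0"
          unfolding S(2) T(2) by auto
        moreover from this have "(\<lambda>A. f A * g A) \<in> ?R" by blast
        ultimately have "invertible A \<and> (\<exists>h\<in>?R. h A \<noteq> 0)"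
          by (intro conjI bexI[of _ "\<lambda>A. f A * g A"])
        then show "A \<in> {A. invertible A \<and> (\<exists>f\<in>?R. f A \<noteq> 0)}"
          by (rule CollectI)
      qed
      show "{A. invertible A \<and> (\<exists>f\<in>?R. f A \<noteq> 0)} \<subseteq> U \<inter> V"
        unfolding S(2) T(2) by auto
    qed
    ultimately show "?P (U \<inter> V)"
      by (intro exI[of _ ?R] conjI)
  next
    fix K :: "(complex^'n^'n) set set"
    assume K: "\<forall>U\<in>K. ?P U"
    let ?R = "{f \<in> GL_regular. {A. invertible A \<and> f A \<noteq> 0} \<subseteq> \<Union>K}"
    have "\<Union>K = {A. invertible A \<and> (\<exists>f\<in>?R. f A \<noteq> 0)}"
    proof
      show "\<Union>K \<subseteq> {A. invertible A \<and> (\<exists>f\<in>?R. f A \<noteq> 0)}"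
      proof
        fix A assume "A \<in> \<Union>K"
        then obtain U where U: "U \<in> K" "A \<in> U" by blast
        with K obtain S where S: "S \<subseteq> GL_regular" "U = {A. invertible A \<and> (\<exists>f\<in>S. f A \<noteq> 0)}"
          by blast
        then obtain f where f: "f \<in> S" "f A \<noteq> 0" and "invertible A"
          using U(2) by blast
        moreover have "f \<in> ?R"
          using f(1) S U(1) by blast
        ultimately show "A \<in> {A. invertible A \<and> (\<exists>f\<in>?R. f A \<noteq> 0)}" by blast
      qed
    qed blast
    then show "?P (\<Union>K)"
      by (intro exI[of _ ?R] conjI) (simp_all only: Collect_subset)
  qed
  then show ?thesis
    unfolding zariski_def by (simp only: topology_inverse')
qed

lemma topspace_zariski: "topspace zariski = {A. invertible A}"
proof
  show "topspace zariski \<subseteq> {A. invertible A}"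
    unfolding topspace_def openin_zariski by blast
  have "openin zariski {A. invertible A}"
    unfolding openin_zariski
    by (rule exI[of _ "{\<lambda>A. 1}"]) (auto intro: GL_regular.const)
  then show "{A. invertible A} \<subseteq> topspace zariski"
    by (rule openin_subset)
qed

lemma closedin_zariski:
  "closedin zariski Z \<longleftrightarrow> (\<exists>S \<subseteq> GL_regular. Z = {A. invertible A \<and> (\<forall>f\<in>S. f A = 0)})"
proof
  assume Z: "closedin zariski Z"
  then obtain S where "S \<subseteq> GL_regular"
    and S: "{A. invertible A} - Z = {A. invertible A \<and> (\<exists>f\<in>S. f A \<noteq> 0)}"
    unfolding closedin_def topspace_zariski openin_zariski by auto
  moreover have "Z \<subseteq> {A. invertible A}"
    using Z unfolding closedin_def topspace_zariski by simp
  then have "Z = {A. invertible A} - ({A. invertible A} - Z)"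
    by (simp add: double_diff)
  then have "Z = {A. invertible A \<and> (\<forall>f\<in>S. f A = 0)}"
    unfolding S by auto
  ultimately show "\<exists>S \<subseteq> GL_regular. Z = {A. invertible A \<and> (\<forall>f\<in>S. f A = 0)}"
    by auto
next
  assume "\<exists>S \<subseteq> GL_regular. Z = {A. invertible A \<and> (\<forall>f\<in>S. f A = 0)}"
  then obtain S where "S \<subseteq> GL_regular"
    and S: "Z = {A. invertible A \<and> (\<forall>f\<in>S. f A = 0)}"
    by auto
  moreover have "{A. invertible A} - Z = {A. invertible A \<and> (\<exists>f\<in>S. f A \<noteq> 0)}"
    unfolding S by auto
  ultimately show "closedin zariski Z"
    unfolding closedin_def topspace_zariski openin_zariski by auto
qed


section \<open>Reductive groups\<close>

definition algebraic_group :: "(complex^'n^'n) set \<Rightarrow> bool" where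
  "algebraic_group G \<longleftrightarrow> subgroup G GL \<and> closedin zariski G"

definition nilpotent_mat :: "complex^'n^'n \<Rightarrow> bool" where
  "nilpotent_mat A \<longleftrightarrow> (\<exists>k. (((**) A) ^^ k) (mat 1) = 0)"

definition unipotent_mat :: "complex^'n^'n \<Rightarrow> bool" where
  "unipotent_mat A \<longleftrightarrow> nilpotent_mat (A - mat 1)"

definition semisimple_mat :: "complex^'n^'n \<Rightarrow> bool" where
  "semisimple_mat A \<longleftrightarrow> (\<exists>(P :: complex^'n^'n) D. invertible P \<and> (\<forall>i j. i \<noteq> j \<longrightarrow> D $ i $ j = 0)
     \<and> A = P ** D ** matrix_inv P)"

text \<open>The closed connected normal unipotent subgroups of an algebraic group have a largest
  member, which is therefore their union.\<close>

definition unipotent_radical :: "(complex^'n^'n) set \<Rightarrow> (complex^'n^'n) set" where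
  "unipotent_radical G = \<Union>{U. closedin zariski U \<and> connectedin zariski U
     \<and> U \<lhd> GL\<lparr>carrier := G\<rparr> \<and> (\<forall>u\<in>U. unipotent_mat u)}"

definition connected_reductive_group :: "(complex^'n^'n) set \<Rightarrow> bool" where
  "connected_reductive_group G \<longleftrightarrow>
     algebraic_group G \<and> connectedin zariski G \<and> unipotent_radical G = {mat 1}"


section \<open>Lie algebra, representations and their differentials\<close>

definition deriv_at_one :: "(complex^'n^'n \<Rightarrow> complex) \<Rightarrow> complex^'n^'n \<Rightarrow> complex" where
  "deriv_at_one f X = deriv (\<lambda>t. f (mat 1 + cscale t X)) 0"

text \<open>The Zariski tangent space at the identity.\<close>

definition lie_algebra :: "(complex^'n^'n) set \<Rightarrow> (complex^'n^'n) set" where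
  "lie_algebra G =
     {X. \<forall>f\<in>GL_regular. (\<forall>A\<in>G. f A = 0) \<longrightarrow> deriv_at_one f X = 0}"

text \<open>\<open>f\<close> is a regular extension of \<open>\<phi>\<close> from the closed subvariety \<open>G\<close> to \<open>GL\<^sub>n\<close>.\<close>

definition regular_extension ::
  "(complex^'n^'n) set \<Rightarrow> (complex^'n^'n \<Rightarrow> complex) \<Rightarrow> (complex^'n^'n \<Rightarrow> complex) \<Rightarrow> bool" where
  "regular_extension G \<phi> f \<longleftrightarrow> f \<in> GL_regular \<and> (\<forall>A\<in>G. f A = \<phi> A)"

definition rational_rep ::
  "(complex^'n^'n) set \<Rightarrow> (complex^'n^'n \<Rightarrow> complex^'m^'m) \<Rightarrow> bool" where
  "rational_rep G \<pi> \<longleftrightarrow> \<pi> \<in> hom (GL\<lparr>carrier := G\<rparr>) GL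
     \<and> (\<forall>i j. \<exists>f. regular_extension G (\<lambda>g. \<pi> g $ i $ j) f)"

text \<open>The differential \<open>d\<pi>(e)\<close>, entry by entry. For \<open>X\<close> in the Lie algebra of \<open>G\<close> the
  derivative does not depend on the chosen regular extension; other \<open>X\<close> are irrelevant.\<close>

definition differential ::
  "(complex^'n^'n) set \<Rightarrow> (complex^'n^'n \<Rightarrow> complex^'m^'m) \<Rightarrow> complex^'n^'n \<Rightarrow> complex^'m^'m" where
  "differential G \<pi> X = (\<chi> i j. THE d. \<exists>f. regular_extension G (\<lambda>g. \<pi> g $ i $ j) f
     \<and> d = deriv_at_one f X)"

definition infinitesimally_faithful ::
  "(complex^'n^'n) set \<Rightarrow> (complex^'n^'n \<Rightarrow> complex^'m^'m) \<Rightarrow> bool" where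
  "infinitesimally_faithful G \<pi> \<longleftrightarrow> inj_on (differential G \<pi>) (lie_algebra G)"

definition cayley_map ::
  "(complex^'n^'n) set \<Rightarrow> (complex^'n^'n \<Rightarrow> complex^'m^'m) \<Rightarrow> complex^'n^'n \<Rightarrow> complex^'n^'n" where
  "cayley_map G \<pi> g = (THE Y. Y \<in> lie_algebra G \<and>
     (\<forall>X\<in>lie_algebra G. trace (differential G \<pi> Y ** differential G \<pi> X)
        = trace (\<pi> g ** differential G \<pi> X)))"


section \<open>Jordan decompositions\<close>

text \<open>For elements of an algebraic group \<open>G \<subseteq> GL\<^sub>n\<close>, respectively of its Lie algebra, the
  Jordan decompositions are those of the underlying matrices; the parts then lie in \<open>G\<close>,
  respectively in the Lie algebra, which is not imposed here.\<close>

definition mult_jordan_decomposition ::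
  "complex^'n^'n \<Rightarrow> complex^'n^'n \<Rightarrow> complex^'n^'n \<Rightarrow> bool" where
  "mult_jordan_decomposition a s u \<longleftrightarrow>
     semisimple_mat s \<and> unipotent_mat u \<and> a = s ** u \<and> s ** u = u ** s"

definition add_jordan_decomposition ::
  "complex^'n^'n \<Rightarrow> complex^'n^'n \<Rightarrow> complex^'n^'n \<Rightarrow> bool" where
  "add_jordan_decomposition X S N \<longleftrightarrow>
     semisimple_mat S \<and> nilpotent_mat N \<and> X = S + N \<and> S ** N = N ** S"

definition semisimple_part :: "complex^'n^'n \<Rightarrow> complex^'n^'n" where
  "semisimple_part X = (THE S. \<exists>N. add_jordan_decomposition X S N)"

definition nilpotent_part :: "complex^'n^'n \<Rightarrow> complex^'n^'n" where
  "nilpotent_part X = (THE N. \<exists>S. add_jordan_decomposition X S N)"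


section \<open>Subalgebras\<close>

definition bracket :: "complex^'n^'n \<Rightarrow> complex^'n^'n \<Rightarrow> complex^'n^'n" where
  "bracket X Y = X ** Y - Y ** X"

definition Ad :: "complex^'n^'n \<Rightarrow> complex^'n^'n \<Rightarrow> complex^'n^'n" where
  "Ad b X = b ** X ** matrix_inv b"

definition fixed_by :: "(complex^'n^'n) set \<Rightarrow> complex^'n^'n \<Rightarrow> (complex^'n^'n) set" where
  "fixed_by L b = {X \<in> L. Ad b X = X}"

definition lie_center :: "(complex^'n^'n) set \<Rightarrow> (complex^'n^'n) set" where
  "lie_center L = {X \<in> L. \<forall>Y\<in>L. bracket X Y = 0}"

definition derived_algebra :: "(complex^'n^'n) set \<Rightarrow> (complex^'n^'n) set" where
  "derived_algebra L = cmat.span {bracket X Y | X Y. X \<in> L \<and> Y \<in> L}"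

definition is_direct_sum ::
  "(complex^'n^'n) set \<Rightarrow> (complex^'n^'n) set \<Rightarrow> (complex^'n^'n) set \<Rightarrow> bool" where
  "is_direct_sum W U V \<longleftrightarrow> cmat.subspace U \<and> cmat.subspace V
     \<and> W = {X + Y | X Y. X \<in> U \<and> Y \<in> V} \<and> U \<inter> V = {0}"

end

theory Submission
  imports Defs "HOL-Complex_Analysis.Cauchy_Integral_Formula"
    "HOL-Computational_Algebra.Fundamental_Theorem_Algebra"
begin

text \<open>
  Let \<open>B(X, Y) = tr(\<pi>'(X) \<pi>'(Y))\<close>. The argument rests on replicas: if \<open>X \<in> \<gg>\<close> has semisimple part
  \<open>P diag(d) P\<^sup>-\<^sup>1\<close>, then \<open>P diag(\<psi>(d)) P\<^sup>-\<^sup>1 \<in> \<gg>\<close> for every additive \<open>\<psi> : \<complex> \<rightarrow> \<complex>\<close>, because a regular function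
  on \<open>exp(t X)\<close> is an exponential polynomial in \<open>t\<close>. Taking for \<open>\<psi>\<close> the complex conjugation, \<open>B\<close> of \<open>X\<close> and
  its replica is a sum of squares, so an \<open>X\<close> that is \<open>B\<close>-orthogonal to its bicommutant in \<open>\<gg>\<close> is nilpotent.

  Hence the radical of \<open>B\<close> consists of nilpotent matrices. By Engel's theorem its exponentials lie
  in the normal unipotent subgroup \<open>{u. \<forall>h\<in>G. tr(u h) = tr(h)}\<close>, which is trivial; so \<open>B\<close> is
  nondegenerate. Since \<open>Ad a\<^sub>s\<close> is semisimple, \<open>B\<close> is also nondegenerate on the fixed algebra of
  \<open>a\<^sub>s\<close>, where the center and the derived algebra are orthogonal complements of each other, and the
  center consists of semisimple elements. Finally \<open>\<Phi>(a\<^sub>s)\<close> is central there by equivariance, and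
  \<open>\<Phi>(a) - \<Phi>(a\<^sub>s)\<close> is orthogonal to everything commuting with \<open>a\<^sub>s\<close> and \<open>a\<^sub>u\<close>, because \<open>\<pi>(a\<^sub>u) - 1\<close> is
  nilpotent; so it lies in the derived algebra and is nilpotent.
\<close>

section \<open>Matrix algebra\<close>

text \<open>Reductivity is available only as triviality of the unipotent radical, so complete
  reducibility, compact real forms and the reductivity of the centralizer of \<open>a_s\<close> are
  all replaced by properties of the trace form. The obstacle is positivity: the form is complex
  bilinear, and conjugating eigenvalues is not a complex linear operation, so nothing linear keeps
  the result in \<open>\<gg>\<close>. What keeps it there is that regular functions only meet
  integer combinations of the eigenvalues, and conjugation respects those; hence replicas are needed
  for all additive maps. Jordan parts in the group are obtained from the same principle: on elements
  \<open>fc P d y ** U s\<close> a regular function is a finite sum of polynomials in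
  \<open>s\<close> times values of \<open>y\<close>, with one list of terms for all characters
  \<open>y\<close>, so vanishing on a rich enough family of characters spreads to the others. The
  nilpotency criterion is phrased with the bicommutant because it is also applied inside the center
  of the centralizer and to \<open>\<Phi>(a) - \<Phi>(a_s)\<close>, where orthogonality is known
  only against elements that commute with enough.\<close>

lemma cscale_nth [simp]: "cscale c A $ i $ j = c * A $ i $ j"
  by (simp add: cscale_def)

lemma matrix_mul_nth: "(A ** B) $ i $ j = (\<Sum>k\<in>UNIV. A $ i $ k * B $ k $ j)"
  by (simp add: matrix_matrix_mult_def)

lemma matrix_mul_cscale_left [simp]:
  fixes A :: "complex^'n^'m" and B :: "complex^'p^'n"
  shows "cscale c A ** B = cscale c (A ** B)"
  by (simp add: vec_eq_iff matrix_mul_nth sum_distrib_left mult.assoc)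

lemma matrix_mul_cscale_right [simp]:
  fixes A :: "complex^'n^'m" and B :: "complex^'p^'n"
  shows "A ** cscale c B = cscale c (A ** B)"
  by (simp add: vec_eq_iff matrix_mul_nth sum_distrib_left mult.left_commute)

lemma matrix_mul_zero_left [simp]: "0 ** (B :: complex^'p^'n) = (0 :: complex^'p^'m)"
  by (simp add: vec_eq_iff matrix_mul_nth)

lemma matrix_mul_zero_right [simp]: "(A :: complex^'n^'m) ** (0 :: complex^'p^'n) = 0"
  by (simp add: vec_eq_iff matrix_mul_nth)

lemma matrix_mul_minus_right [simp]: "A ** (- B :: complex^'p^'n) = - ((A :: complex^'n^'m) ** B)"
  by (simp add: vec_eq_iff matrix_mul_nth sum_negf)

lemma matrix_diff_ldistrib: "(A :: complex^'n^'m) ** (B - C :: complex^'p^'n) = A ** B - A ** C"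
  by (simp add: vec_eq_iff matrix_mul_nth sum_subtractf algebra_simps)

lemma matrix_diff_rdistrib: "(B - C) ** (A :: complex^'p^'n) = (B :: complex^'n^'m) ** A - C ** A"
  by (simp add: vec_eq_iff matrix_mul_nth sum_subtractf algebra_simps)

lemma matrix_mul_rdistrib: "(B + C) ** (A :: complex^'p^'n) = (B :: complex^'n^'m) ** A + C ** A"
  by (simp add: vec_eq_iff matrix_mul_nth sum.distrib algebra_simps)

lemma matrix_sum_left: "(\<Sum>i\<in>I. f i) ** (B :: complex^'p^'n) = (\<Sum>i\<in>I. (f i :: complex^'n^'m) ** B)"
  by (induction I rule: infinite_finite_induct) (simp_all add: matrix_mul_rdistrib)

lemma matrix_sum_right: "(A :: complex^'n^'m) ** (\<Sum>i\<in>I. f i) = (\<Sum>i\<in>I. A ** (f i :: complex^'p^'n))"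
  by (induction I rule: infinite_finite_induct) (simp_all add: matrix_add_ldistrib)

lemmas mat_distribs = matrix_add_ldistrib matrix_mul_rdistrib matrix_diff_ldistrib matrix_diff_rdistrib

lemma trace_cscale [simp]: "trace (cscale c A) = c * trace (A :: complex^'n^'n)"
  by (simp add: trace_def sum_distrib_left)

lemma trace_zero [simp]: "trace (0 :: complex^'n^'n) = 0"
  by (simp add: trace_def)

lemma trace_sum: "trace (\<Sum>i\<in>I. f i) = (\<Sum>i\<in>I. trace (f i :: complex^'n^'n))"
  by (induction I rule: infinite_finite_induct) (simp_all add: trace_add)

lemma matrix_inv_left [simp]: "invertible P \<Longrightarrow> matrix_inv P ** P = mat 1"
  and matrix_inv_right [simp]: "invertible P \<Longrightarrow> P ** matrix_inv P = mat 1"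
  for P :: "complex^'n^'n"
  unfolding invertible_def matrix_inv_def by (metis (mono_tags, lifting) someI_ex)+

lemma matrix_inv_cancel [simp]:
  fixes P :: "complex^'n^'n"
  assumes "invertible P"
  shows "A ** matrix_inv P ** P = A" "A ** P ** matrix_inv P = A"
    "matrix_inv P ** (P ** A') = A'" "P ** (matrix_inv P ** A') = A'"
  using assms by (simp_all flip: matrix_mul_assoc) (simp_all add: matrix_mul_assoc)

lemma matrix_inv_unique_left: "A ** B = mat 1 \<Longrightarrow> matrix_inv A = B"
  for A B :: "complex^'n^'n"
  by (metis invertible_right_inverse matrix_inv_left matrix_mul_assoc matrix_mul_lid matrix_mul_rid)

lemma invertibleI: "A ** B = mat 1 \<Longrightarrow> invertible A"
  for A B :: "complex^'n^'n"
  using invertible_right_inverse by blast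

lemma invertible_matrix_inv: "invertible A \<Longrightarrow> invertible (matrix_inv A)"
  for A :: "complex^'n^'n"
  by (rule invertibleI[of _ A]) simp

lemma matrix_inv_matrix_inv: "invertible A \<Longrightarrow> matrix_inv (matrix_inv A) = A"
  for A :: "complex^'n^'n"
  by (rule matrix_inv_unique_left) simp

lemma matrix_inv_commute:
  fixes A M :: "complex^'n^'n"
  assumes "invertible A" "A ** M = M ** A"
  shows "matrix_inv A ** M = M ** matrix_inv A"
proof -
  have "matrix_inv A ** (A ** M) ** matrix_inv A = matrix_inv A ** (M ** A) ** matrix_inv A"
    using assms by simp
  then show ?thesis using assms(1) by (simp add: matrix_mul_assoc)
qed

abbreviation mpow :: "complex^'n^'n \<Rightarrow> nat \<Rightarrow> complex^'n^'n" where
  "mpow A k \<equiv> ((**) A ^^ k) (mat 1)"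

lemma mpow_commute: "A ** M = M ** A \<Longrightarrow> mpow A k ** M = M ** mpow A k"
  by (induction k) (simp_all, metis matrix_mul_assoc)

lemma mpow_add: "mpow A (j + k) = mpow A j ** mpow A k"
  by (induction j) (simp_all add: matrix_mul_assoc)

lemma mpow_mult: "A ** B = B ** A \<Longrightarrow> mpow (A ** B) k = mpow A k ** mpow B k"
proof (induction k)
  case (Suc k)
  then have "B ** mpow A k = mpow A k ** B"
    using mpow_commute[of A B k] by simp
  moreover have "mpow (A ** B) (Suc k) = A ** (B ** mpow A k) ** mpow B k"
    using Suc by (simp add: matrix_mul_assoc)
  moreover have "mpow A (Suc k) ** mpow B (Suc k) = A ** (mpow A k ** B) ** mpow B k"
    by (simp add: matrix_mul_assoc)
  ultimately show ?case by simp
qed simp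

lemma nilpotent_mult_commute:
  assumes "nilpotent_mat A" "A ** B = B ** A"
  shows "nilpotent_mat (A ** B)" "nilpotent_mat (B ** A)"
  using assms mpow_mult[OF assms(2)] unfolding nilpotent_mat_def
  by (metis matrix_mul_zero_left)+

section \<open>Polynomials in a matrix\<close>

text \<open>Horner's scheme with the matrix product, as the type class product behind
  \<open>poly\<close> is entrywise on this type.\<close>

definition matpoly :: "complex poly \<Rightarrow> complex^'n^'n \<Rightarrow> complex^'n^'n" where
  "matpoly p A = fold_coeffs (\<lambda>a B. cscale a (mat 1) + A ** B) p 0"

lemma cscale_zero [simp]: "cscale 0 A = 0" "cscale c 0 = 0"
  by (simp_all add: vec_eq_iff)

lemma cscale_one [simp]: "cscale 1 A = A"
  by (simp add: vec_eq_iff)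

lemma matpoly_0 [simp]: "matpoly 0 A = 0"
  by (simp add: matpoly_def)

lemma matpoly_pCons [simp]: "matpoly (pCons a p) A = cscale a (mat 1) + A ** matpoly p A"
  by (cases "p = 0 \<and> a = 0") (auto simp: matpoly_def)

lemma matpoly_1 [simp]: "matpoly 1 A = mat 1"
  by (simp add: one_pCons)

lemma cscale_distribs: "cscale (a + b) A = cscale a A + cscale b A"
    "cscale (a - b) A = cscale a A - cscale b A"
    "cscale a (A + B) = cscale a A + cscale a B"
    "cscale a (A - B) = cscale a A - cscale a B"
    "cscale a (cscale b A) = cscale (a * b) A"
    "cscale (- a) A = - cscale a A"
  by (simp_all add: vec_eq_iff algebra_simps)

lemma cscale_sum: "cscale c (\<Sum>i\<in>I. f i) = (\<Sum>i\<in>I. cscale c (f i))"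
  by (rule cmat.scale_sum_right)

lemma matpoly_add: "matpoly (p + q) A = matpoly p A + matpoly q A"
  by (induction p q rule: poly_induct2)
     (simp_all add: mat_distribs cscale_distribs algebra_simps)

lemma matpoly_smult [simp]: "matpoly (smult c p) A = cscale c (matpoly p A)"
  by (induction p) (simp_all add: cscale_distribs)

lemma matpoly_minus: "matpoly (- p) A = - matpoly p A"
  using matpoly_smult[of "-1" p A] by (simp add: cscale_distribs del: matpoly_smult)

lemma matpoly_diff: "matpoly (p - q) A = matpoly p A - matpoly q A"
  using matpoly_add[of p "- q" A] by (simp add: matpoly_minus)

lemma matpoly_sum: "matpoly (\<Sum>i\<in>I. f i) A = (\<Sum>i\<in>I. matpoly (f i) A)"
  by (induction I rule: infinite_finite_induct) (simp_all add: matpoly_add)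

lemma matpoly_mult: "matpoly (p * q) A = matpoly p A ** matpoly q A"
  by (induction p)
     (simp_all add: matpoly_add mat_distribs matrix_mul_assoc)

lemma matpoly_commute: "A ** M = M ** A \<Longrightarrow> matpoly p A ** M = M ** matpoly p A"
  by (induction p) (simp_all add: mat_distribs, metis matrix_mul_assoc)

lemma matpoly_commute_self: "matpoly p A ** matpoly q A = matpoly q A ** matpoly p A"
  by (metis matpoly_mult mult.commute)

lemma matpoly_power: "matpoly (p ^ k) A = mpow (matpoly p A) k"
  by (induction k) (simp_all add: matpoly_mult)

lemma matpoly_monom: "matpoly (monom c k) A = cscale c (mpow A k)"
  by (induction k) (simp_all add: monom_0 monom_Suc)

lemma matpoly_pcompose: "matpoly (pcompose p q) A = matpoly p (matpoly q A)"
  by (induction p) (simp_all add: pcompose_pCons matpoly_add matpoly_mult)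

lemma matpoly_dvd_zero: "p dvd q \<Longrightarrow> matpoly p A = 0 \<Longrightarrow> matpoly q A = 0"
  by (metis dvdE matpoly_mult matrix_mul_zero_left)

section \<open>Interpolation and functional calculus\<close>

lemma dvd_one_minus_power: "u dvd 1 - (1 - u) ^ n" for u :: "complex poly"
proof (induction n)
  case (Suc n)
  have "1 - (1 - u) ^ Suc n = (1 - (1 - u) ^ n) + u * (1 - u) ^ n"
    by (simp add: algebra_simps)
  then show ?case using Suc by (metis dvd_add dvd_triv_left)
qed simp

text \<open>With \<open>u\<close> vanishing to order \<open>n\<close> at the other points and
  \<open>u(l) = 1\<close>, the polynomial \<open>1 - (1 - u)^n\<close> keeps the first property,
  being divisible by \<open>u\<close>, and equals 1 to order \<open>n\<close> at
  \<open>l\<close>.\<close>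

lemma hermite_idempotent:
  fixes \<Lambda> :: "complex set"
  assumes "finite \<Lambda>" "l \<in> \<Lambda>"
  obtains e where "[:-l, 1:] ^ n dvd e - 1" "\<And>\<mu>. \<mu> \<in> \<Lambda> - {l} \<Longrightarrow> [:-\<mu>, 1:] ^ n dvd e"
proof -
  define w where "w = (\<Prod>\<mu>\<in>\<Lambda> - {l}. [:-\<mu>, 1:] ^ n)"
  have nz: "poly w l \<noteq> 0"
    using assms unfolding w_def by (auto simp: poly_prod)
  define u where "u = smult (inverse (poly w l)) w"
  have "poly (1 - u) l = 0" using nz by (simp add: u_def)
  then have "[:-l, 1:] dvd 1 - u" by (simp only: poly_eq_0_iff_dvd)
  then have "[:-l, 1:] ^ n dvd (1 - u) ^ n" by (rule dvd_power_same)
  then have 1: "[:-l, 1:] ^ n dvd (1 - (1 - u) ^ n) - 1" by simp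
  have "[:-\<mu>, 1:] ^ n dvd 1 - (1 - u) ^ n" if "\<mu> \<in> \<Lambda> - {l}" for \<mu>
  proof -
    have "[:-\<mu>, 1:] ^ n dvd w" unfolding w_def
      using that assms(1) by (intro dvd_prodI) auto
    also have "w dvd u" by (simp add: u_def dvd_smult)
    also have "u dvd 1 - (1 - u) ^ n" by (rule dvd_one_minus_power)
    finally show ?thesis .
  qed
  with 1 show thesis by (rule that)
qed

text \<open>Besides taking the value \<open>g l\<close>, \<open>q\<close> has vanishing derivatives
  of orders 1 to \<open>n - 1\<close> at \<open>l\<close>; this makes a nilpotent part disappear
  when \<open>q\<close> is evaluated at \<open>S + N\<close>.\<close>

lemma hermite_interpolation:
  fixes \<Lambda> :: "complex set" and g :: "complex \<Rightarrow> complex"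
  assumes "finite \<Lambda>"
  obtains q where "\<And>l. l \<in> \<Lambda> \<Longrightarrow> [:-l, 1:] ^ n dvd q - [:g l:]"
proof -
  have "\<forall>l\<in>\<Lambda>. \<exists>e. [:-l, 1:] ^ n dvd e - 1 \<and> (\<forall>\<mu>\<in>\<Lambda> - {l}. [:-\<mu>, 1:] ^ n dvd e)"
    using hermite_idempotent[OF assms] by metis
  then obtain e where e: "\<And>l. l \<in> \<Lambda> \<Longrightarrow> [:-l, 1:] ^ n dvd e l - 1"
    "\<And>l \<mu>. l \<in> \<Lambda> \<Longrightarrow> \<mu> \<in> \<Lambda> \<Longrightarrow> \<mu> \<noteq> l \<Longrightarrow> [:-\<mu>, 1:] ^ n dvd e l"
    by (metis Diff_iff singletonD)
  define q where "q = (\<Sum>l\<in>\<Lambda>. smult (g l) (e l))"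
  have "[:-l, 1:] ^ n dvd q - [:g l:]" if "l \<in> \<Lambda>" for l
  proof -
    have "q - [:g l:] = smult (g l) (e l - 1) + (\<Sum>\<mu>\<in>\<Lambda> - {l}. smult (g \<mu>) (e \<mu>))"
      using that assms by (simp add: q_def sum.remove[of \<Lambda> l] smult_diff_right)
    moreover have "[:-l, 1:] ^ n dvd (\<Sum>\<mu>\<in>\<Lambda> - {l}. smult (g \<mu>) (e \<mu>))"
      using e(2) that by (intro dvd_sum dvd_smult) auto
    ultimately show ?thesis
      using e(1)[OF that] by (metis dvd_add dvd_smult)
  qed
  then show thesis by (rule that)
qed

section \<open>Functional calculus of diagonalizable matrices\<close>

definition diagmat :: "('n \<Rightarrow> complex) \<Rightarrow> complex^'n^'n" where
  "diagmat d = (\<chi> i j. if i = j then d i else 0)"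

lemma diagmat_nth [simp]: "diagmat d $ i $ j = (if i = j then d i else 0)"
  by (simp add: diagmat_def)

lemma diagmat_mul_nth [simp]:
  "(diagmat d ** M) $ i $ j = d i * M $ i $ j" "(M ** diagmat d) $ i $ j = M $ i $ j * d j"
  by (simp_all add: matrix_mul_nth mult_delta_left mult_delta_right)

text \<open>The value at \<open>g\<close> of the functional calculus of the diagonalizable matrix
  \<open>P diag(d) P\<^sup>-\<^sup>1\<close>.\<close>

definition fc :: "complex^'n^'n \<Rightarrow> ('n \<Rightarrow> complex) \<Rightarrow> (complex \<Rightarrow> complex) \<Rightarrow> complex^'n^'n" where
  "fc P d g = P ** diagmat (\<lambda>i. g (d i)) ** matrix_inv P"

lemma semisimple_mat_iff:
  fixes A :: "complex^'n^'n"
  shows "semisimple_mat A \<longleftrightarrow> (\<exists>P d. invertible P \<and> A = fc P d (\<lambda>z. z))"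
proof
  assume "semisimple_mat A"
  then obtain P D :: "complex^'n^'n" where PD: "invertible P" "\<forall>i j. i \<noteq> j \<longrightarrow> D $ i $ j = 0" "A = P ** D ** matrix_inv P"
    unfolding semisimple_mat_def by blast
  have "D = diagmat (\<lambda>i. D $ i $ i)"
    using PD(2) by (simp add: vec_eq_iff)
  with PD(3) have "A = fc P (\<lambda>i. D $ i $ i) (\<lambda>z. z)"
    unfolding fc_def by (rule subst[where P = "\<lambda>D. A = P ** D ** matrix_inv P", rotated])
  with PD(1) show "\<exists>P d. invertible P \<and> A = fc P d (\<lambda>z. z)" by blast
next
  assume "\<exists>P d. invertible P \<and> A = fc P d (\<lambda>z. z)"
  then obtain P :: "complex^'n^'n" and d where "invertible P" "A = P ** diagmat d ** matrix_inv P"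
    unfolding fc_def by blast
  then show "semisimple_mat A"
    unfolding semisimple_mat_def by (intro exI[of _ P] exI[of _ "diagmat d"]) simp
qed

lemma diagmat_mult: "diagmat d ** diagmat d' = diagmat (\<lambda>i. d i * d' i)"
  by (simp add: vec_eq_iff)

lemma fc_mult: "invertible P \<Longrightarrow> fc P d g ** fc P d h = fc P d (\<lambda>z. g z * h z)"
  by (simp add: fc_def matrix_mul_assoc) (simp add: diagmat_mult flip: matrix_mul_assoc)

lemma diagmat_one: "diagmat (\<lambda>i. 1) = mat 1"
  by (simp add: vec_eq_iff mat_def)

lemma fc_one: "invertible P \<Longrightarrow> fc P d (\<lambda>z. 1) = mat 1"
  by (simp add: fc_def diagmat_one)

lemma fc_add: "fc P d (\<lambda>z. g z + h z) = fc P d g + fc P d h"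
proof -
  have "diagmat (\<lambda>i. g (d i) + h (d i)) = diagmat (\<lambda>i. g (d i)) + diagmat (\<lambda>i. h (d i))"
    by (simp add: vec_eq_iff)
  then show ?thesis by (simp add: fc_def mat_distribs)
qed

lemma fc_cscale: "fc P d (\<lambda>z. c * g z) = cscale c (fc P d g)"
proof -
  have "diagmat (\<lambda>i. c * g (d i)) = cscale c (diagmat (\<lambda>i. g (d i)))"
    by (simp add: vec_eq_iff)
  then show ?thesis by (simp add: fc_def)
qed

lemma fc_zero: "fc P d (\<lambda>z. 0) = 0"
  using fc_cscale[of P d 0 "\<lambda>z. 0"] by simp

lemma fc_sum: "fc P d (\<lambda>z. \<Sum>i\<in>I. g i z) = (\<Sum>i\<in>I. fc P d (g i))"
  by (induction I rule: infinite_finite_induct) (simp_all add: fc_zero fc_add)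

lemma fc_cong: "(\<And>i. g (d i) = h (d i)) \<Longrightarrow> fc P d g = fc P d h"
  by (simp add: fc_def)

lemma fc_invertible:
  assumes "invertible P" "\<And>i. g (d i) \<noteq> 0"
  shows "invertible (fc P d g)"
proof (rule invertibleI)
  have "fc P d g ** fc P d (\<lambda>z. inverse (g z)) = fc P d (\<lambda>z. 1)"
    unfolding fc_mult[OF assms(1)] by (rule fc_cong) (simp add: assms(2))
  then show "fc P d g ** fc P d (\<lambda>z. inverse (g z)) = mat 1"
    by (simp only: fc_one[OF assms(1)])
qed

text \<open>In an eigenbasis, commuting with the diagonal matrix means that the entry at
  \<open>i\<close>, \<open>j\<close> vanishes unless \<open>d i = d j\<close>, and then
  \<open>g (d i) = g (d j)\<close> as well.\<close>

lemma commute_fc: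
  assumes P: "invertible P" and M: "M ** fc P d (\<lambda>z. z) = fc P d (\<lambda>z. z) ** M"
  shows "M ** fc P d g = fc P d g ** M"
proof -
  define M' where "M' = matrix_inv P ** M ** P"
  have M_eq: "M = P ** M' ** matrix_inv P"
    using P by (simp add: M'_def matrix_mul_assoc)
  have conv: "M ** fc P d h = P ** (M' ** diagmat (\<lambda>i. h (d i))) ** matrix_inv P"
      "fc P d h ** M = P ** (diagmat (\<lambda>i. h (d i)) ** M') ** matrix_inv P" for h
    using P by (simp_all add: M_eq fc_def matrix_mul_assoc)
  have "P ** (M' ** diagmat d) ** matrix_inv P = P ** (diagmat d ** M') ** matrix_inv P"
    using M by (simp only: conv)
  then have "matrix_inv P ** (P ** (M' ** diagmat d) ** matrix_inv P) ** P
      = matrix_inv P ** (P ** (diagmat d ** M') ** matrix_inv P) ** P"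
    by simp
  then have "M' ** diagmat d = diagmat d ** M'"
    using P by (simp add: matrix_mul_assoc)
  then have "M' $ i $ j * d j = d i * M' $ i $ j" for i j
    by (metis diagmat_mul_nth)
  then have "M' $ i $ j = 0 \<or> d i = d j" for i j
    by (metis mult.commute mult_left_cancel)
  then have "M' ** diagmat (\<lambda>i. g (d i)) = diagmat (\<lambda>i. g (d i)) ** M'"
    by (simp add: vec_eq_iff) (metis mult.commute mult_zero_left)
  then show ?thesis by (simp only: conv)
qed

lemma trace_fc:
  assumes "invertible P"
  shows "trace (fc P d g) = (\<Sum>i\<in>UNIV. g (d i))"
proof -
  have "trace (fc P d g) = trace (matrix_inv P ** (P ** diagmat (\<lambda>i. g (d i))))"
    unfolding fc_def by (rule trace_mul_sym)
  also have "\<dots> = trace (diagmat (\<lambda>i. g (d i)))"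
    using assms by (simp add: matrix_mul_assoc)
  finally show ?thesis by (simp add: trace_def)
qed

lemma det_fc:
  assumes "invertible P"
  shows "det (fc P d g) = (\<Prod>i\<in>UNIV. g (d i))"
proof -
  have "det P * det (matrix_inv P) = 1"
    using assms by (metis det_I det_mul matrix_inv_right)
  moreover have "det (diagmat (\<lambda>i. g (d i))) = (\<Prod>i\<in>UNIV. g (d i))"
    by (subst det_diagonal) simp_all
  ultimately show ?thesis
    by (simp add: fc_def det_mul)
qed

text \<open>Both \<open>S\<close> and every \<open>g(S)\<close> are polynomials in \<open>S + N\<close>: interpolate \<open>g\<close> to high order at the
  eigenvalues.\<close>

lemma matpoly_eq_fc:
  assumes P: "invertible P" and N: "mpow N n = 0"
    and comm: "fc P d (\<lambda>z. z) ** N = N ** fc P d (\<lambda>z. z)"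
    and q: "\<And>i. [:-d i, 1:] ^ n dvd q - [:g (d i):]"
  shows "matpoly q (fc P d (\<lambda>z. z) + N) = fc P d g"
proof -
  define S where "S = fc P d (\<lambda>z. z)"
  \<comment> \<open>Spectral projection for \<open>l\<close>; on its range \<open>S + N\<close>
    minus \<open>l\<close> acts as \<open>N\<close>, so the \<open>n\<close>-th power is zero
    there.\<close>
  define E where "E l = fc P d (\<lambda>z. if z = l then 1 else 0)" for l
  have SE: "S ** E l = cscale l (E l)" for l
  proof -
    have "S ** E l = fc P d (\<lambda>z. l * (if z = l then 1 else 0))"
      unfolding S_def E_def fc_mult[OF P] by (rule fc_cong) simp
    then show ?thesis by (simp add: fc_cscale E_def)
  qed
  have NE: "N ** E l = E l ** N" for l
    unfolding E_def by (rule commute_fc[OF P]) (simp add: comm)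
  have EN: "E l ** mpow N k = mpow N k ** E l" for l k
    using mpow_commute[OF NE] by simp
  have pow: "matpoly ([:-l, 1:] ^ k) (S + N) ** E l = mpow N k ** E l" for l k
  proof (induction k)
    case (Suc k)
    have "matpoly ([:-l, 1:] ^ Suc k) (S + N) ** E l
        = matpoly [:-l, 1:] (S + N) ** (matpoly ([:-l, 1:] ^ k) (S + N) ** E l)"
      by (simp only: power_Suc matpoly_mult matrix_mul_assoc)
    also have "\<dots> = matpoly [:-l, 1:] (S + N) ** E l ** mpow N k"
      by (simp only: Suc EN[symmetric] matrix_mul_assoc)
    also have "matpoly [:-l, 1:] (S + N) ** E l = N ** E l"
      by (simp add: mat_distribs SE cscale_distribs)
    also have "N ** E l ** mpow N k = mpow N (Suc k) ** E l"
      by (simp add: EN flip: matrix_mul_assoc)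
    finally show ?case .
  qed simp
  have qE: "matpoly q (S + N) ** E (d i) = cscale (g (d i)) (E (d i))" for i
  proof -
    obtain r where "q - [:g (d i):] = [:-d i, 1:] ^ n * r" using q[of i] by (auto elim: dvdE)
    then have "q = r * [:-d i, 1:] ^ n + [:g (d i):]" by (simp add: algebra_simps)
    then have "matpoly q (S + N) ** E (d i) = matpoly r (S + N) ** (matpoly ([:-d i, 1:] ^ n) (S + N) ** E (d i))
        + cscale (g (d i)) (E (d i))"
      by (simp add: matpoly_add matpoly_mult mat_distribs matrix_mul_assoc)
    then show ?thesis by (simp add: pow N)
  qed
  have res: "fc P d h = (\<Sum>l\<in>range d. cscale (h l) (E l))" for h
  proof -
    have "fc P d h = fc P d (\<lambda>z. \<Sum>l\<in>range d. h l * (if z = l then 1 else 0))"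
      by (rule fc_cong) (simp add: if_distrib[where f = "\<lambda>x. _ * x"] cong: if_cong)
    then show ?thesis by (simp add: fc_sum fc_cscale E_def)
  qed
  have "(\<Sum>l\<in>range d. E l) = mat 1"
    using res[of "\<lambda>z. 1"] fc_one[OF P, of d] by simp
  then have "matpoly q (S + N) = matpoly q (S + N) ** (\<Sum>l\<in>range d. E l)"
    by simp
  also have "\<dots> = (\<Sum>l\<in>range d. cscale (g l) (E l))"
    by (auto simp: matrix_sum_right qE intro!: sum.cong)
  finally show ?thesis by (simp add: res S_def)
qed

lemma mpow_zero_mono:
  assumes "mpow N k = 0" "k \<le> n"
  shows "mpow N n = 0"
  using mpow_add[of "n - k" k N] assms by simp

text \<open>By interpolation \<open>g(S)\<close> is a polynomial in \<open>S + N\<close>, hence in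
  its bicommutant.\<close>

lemma commute_jordan_fc:
  assumes P: "invertible P" and N: "nilpotent_mat N"
    and comm: "fc P d (\<lambda>z. z) ** N = N ** fc P d (\<lambda>z. z)"
    and M: "(fc P d (\<lambda>z. z) + N) ** M = M ** (fc P d (\<lambda>z. z) + N)"
  shows "fc P d g ** M = M ** fc P d g"
proof -
  obtain n where n: "mpow N n = 0" using N unfolding nilpotent_mat_def by blast
  obtain q where "\<And>l. l \<in> range d \<Longrightarrow> [:-l, 1:] ^ n dvd q - [:g l:]"
    using hermite_interpolation[of "range d" n g] by auto
  then have "matpoly q (fc P d (\<lambda>z. z) + N) = fc P d g"
    using matpoly_eq_fc[OF P n comm] by blast
  then show ?thesis using matpoly_commute[OF M] by metis
qed

section \<open>Jordan decompositions\<close>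

text \<open>One polynomial interpolating the identity on both spectra at once, to an order that
  kills both nilpotent parts, sends \<open>A\<close> to \<open>S\<close> and to
  \<open>S'\<close>.\<close>

lemma add_jordan_unique:
  assumes "add_jordan_decomposition A S N" "add_jordan_decomposition A S' N'"
  shows "S = S'" "N = N'"
proof -
  obtain P d where P: "invertible P" "S = fc P d (\<lambda>z. z)"
    using assms(1) unfolding add_jordan_decomposition_def semisimple_mat_iff by blast
  obtain P' d' where P': "invertible P'" "S' = fc P' d' (\<lambda>z. z)"
    using assms(2) unfolding add_jordan_decomposition_def semisimple_mat_iff by blast
  obtain k k' where k: "mpow N k = 0" "mpow N' k' = 0"
    using assms unfolding add_jordan_decomposition_def nilpotent_mat_def by blast
  have n: "mpow N (max k k') = 0" "mpow N' (max k k') = 0"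
    using k mpow_zero_mono by (metis max.cobounded1, metis max.cobounded2)
  obtain q where q: "\<And>l. l \<in> range d \<union> range d' \<Longrightarrow> [:-l, 1:] ^ (max k k') dvd q - [:l:]"
    using hermite_interpolation[of "range d \<union> range d'" "max k k'" "\<lambda>z. z"] by auto
  have "matpoly q A = S"
    using matpoly_eq_fc[OF P(1) n(1), where q = q and g = "\<lambda>z. z" and d = d] q assms(1) P(2)
    unfolding add_jordan_decomposition_def by auto
  moreover have "matpoly q A = S'"
    using matpoly_eq_fc[OF P'(1) n(2), where q = q and g = "\<lambda>z. z" and d = d'] q assms(2) P'(2)
    unfolding add_jordan_decomposition_def by auto
  ultimately show "S = S'" by simp
  with assms show "N = N'" unfolding add_jordan_decomposition_def by auto
qed

lemma semisimple_part_eq: "add_jordan_decomposition A S N \<Longrightarrow> semisimple_part A = S"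
  unfolding semisimple_part_def using add_jordan_unique by (intro the_equality) blast+

lemma nilpotent_part_eq: "add_jordan_decomposition A S N \<Longrightarrow> nilpotent_part A = N"
  unfolding nilpotent_part_def using add_jordan_unique by (intro the_equality) blast+

text \<open>The Lagrange idempotents of \<open>\<Lambda>\<close>, evaluated at \<open>S\<close>, add
  up to the identity and map into eigenspaces. So eigenvectors span, and a basis chosen among them
  forms the columns of \<open>P\<close>.\<close>

lemma diagonalizable_if_squarefree:
  fixes S :: "complex^'n^'n"
  assumes fin: "finite \<Lambda>" and ann: "matpoly (\<Prod>l\<in>\<Lambda>. [:-l, 1:]) S = 0"
  obtains P d where "invertible P" "S = fc P d (\<lambda>z. z)" "range d \<subseteq> \<Lambda>"
proof -
  define p where "p = (\<Prod>l\<in>\<Lambda>. [:-l, 1:])"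
  have "\<forall>l\<in>\<Lambda>. \<exists>e. [:-l, 1:] ^ 1 dvd e - 1 \<and> (\<forall>\<mu>\<in>\<Lambda> - {l}. [:-\<mu>, 1:] ^ 1 dvd e)"
    using hermite_idempotent[OF fin] by metis
  then obtain e where e: "\<And>l. l \<in> \<Lambda> \<Longrightarrow> [:-l, 1:] dvd e l - 1"
    "\<And>l \<mu>. l \<in> \<Lambda> \<Longrightarrow> \<mu> \<in> \<Lambda> \<Longrightarrow> \<mu> \<noteq> l \<Longrightarrow> [:-\<mu>, 1:] dvd e l"
    by (metis Diff_iff singletonD power_one_right)
  have dvdI: "p dvd r" if "\<And>l. l \<in> \<Lambda> \<Longrightarrow> poly r l = 0" for r
    unfolding p_def using fin that
  proof (induction \<Lambda> arbitrary: r rule: finite_induct)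
    case (insert l \<Lambda>)
    then have "[:-l, 1:] dvd r" by (simp add: poly_eq_0_iff_dvd)
    then obtain r' where r: "r = [:-l, 1:] * r'" by (auto elim: dvdE)
    have "poly r' \<mu> = 0" if "\<mu> \<in> \<Lambda>" for \<mu>
      using insert(2) insert.prems[of \<mu>] that r by auto
    then have "(\<Prod>l\<in>\<Lambda>. [:-l, 1:]) dvd r'" by (rule insert.IH)
    then show ?case unfolding r prod.insert[OF insert(1,2)] by (rule mult_dvd_mono[OF dvd_refl])
  qed simp
  have pe: "poly (e l) \<mu> = (if l = \<mu> then 1 else 0)" if "l \<in> \<Lambda>" "\<mu> \<in> \<Lambda>" for l \<mu>
  proof (cases "l = \<mu>")
    case True
    with e(1)[OF that(1)] show ?thesis by (auto simp flip: poly_eq_0_iff_dvd)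
  next
    case False
    with e(2)[OF that] show ?thesis by (auto simp flip: poly_eq_0_iff_dvd)
  qed
  have "p dvd (\<Sum>l\<in>\<Lambda>. e l) - 1"
    by (rule dvdI) (use fin in \<open>simp add: poly_sum pe\<close>)
  then have one: "(\<Sum>l\<in>\<Lambda>. matpoly (e l) S) = mat 1"
    using matpoly_dvd_zero[of p "(\<Sum>l\<in>\<Lambda>. e l) - 1" S] ann by (simp add: p_def matpoly_diff matpoly_sum)
  have eig: "S ** matpoly (e l) S = cscale l (matpoly (e l) S)" if "l \<in> \<Lambda>" for l
  proof -
    have "p dvd [:-l, 1:] * e l" by (rule dvdI) (use that pe in auto)
    then have "matpoly [:-l, 1:] S ** matpoly (e l) S = 0"
      using matpoly_dvd_zero[of p _ S] ann by (simp only: p_def flip: matpoly_mult)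
    then show ?thesis by (simp add: mat_distribs cscale_distribs)
  qed
  define B0 where "B0 = {v :: complex^'n. \<exists>l\<in>\<Lambda>. S *v v = l *s v}"
  have "vec.span B0 = UNIV"
  proof -
    have "v \<in> vec.span B0" for v
    proof -
      have "v = (\<Sum>l\<in>\<Lambda>. matpoly (e l) S) *v v" by (simp add: one)
      also have "\<dots> = (\<Sum>l\<in>\<Lambda>. matpoly (e l) S *v v)"
        using fin by (induction \<Lambda>) (simp_all add: matrix_vector_mult_add_rdistrib)
      also have "\<dots> \<in> vec.span B0"
      proof (intro vec.span_sum vec.span_base)
        fix l assume "l \<in> \<Lambda>"
        then have "S *v (matpoly (e l) S *v v) = l *s (matpoly (e l) S *v v)"
          by (simp add: matrix_vector_mul_assoc eig)
             (simp add: vec_eq_iff matrix_vector_mult_def sum_distrib_left mult.assoc)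
        with \<open>l \<in> \<Lambda>\<close> show "matpoly (e l) S *v v \<in> B0" unfolding B0_def by blast
      qed
      finally show ?thesis .
    qed
    then show ?thesis by blast
  qed
  obtain B where B: "B \<subseteq> B0" "vec.independent B" "B0 \<subseteq> vec.span B" "card B = vec.dim B0"
    using vec.basis_exists[of B0] by metis
  have span: "vec.span B = UNIV"
    using vec.span_minimal[OF B(3) vec.subspace_span] \<open>vec.span B0 = UNIV\<close> by auto
  have "vec.dim B0 = CARD('n)"
    using vec.dim_span[of B0] \<open>vec.span B0 = UNIV\<close> by (simp add: card_cart_basis)
  with B(4) have "card B = card (UNIV :: 'n set)" by simp
  moreover have "finite B" by (rule vec.finiteI_independent[OF B(2)])
  ultimately obtain f :: "'n \<Rightarrow> complex^'n" where f: "bij_betw f UNIV B"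
    using finite_same_card_bij[of "UNIV :: 'n set" B] by auto
  have "\<forall>i. \<exists>l\<in>\<Lambda>. S *v f i = l *s f i"
    using f B(1) unfolding B0_def bij_betw_def by blast
  then obtain d where d: "\<And>i. d i \<in> \<Lambda>" "\<And>i. S *v f i = d i *s f i" by metis
  define P where "P = (\<chi> i j. f j $ i)"
  have "columns P = B"
  proof -
    have "column j P = f j" for j by (simp add: column_def P_def vec_eq_iff)
    then show ?thesis using f by (auto simp: columns_def bij_betw_def)
  qed
  then have inv: "invertible P"
    using \<open>vec.span B = UNIV\<close> matrix_right_invertible_span_columns[of P] invertible_right_inverse by metis
  have "(S ** P) $ i $ j = (P ** diagmat d) $ i $ j" for i j
  proof -
    have "(S ** P) $ i $ j = (S *v f j) $ i"
      by (simp add: matrix_mul_nth matrix_vector_mult_def P_def)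
    then show ?thesis by (simp add: d(2) P_def)
  qed
  then have "S ** P = P ** diagmat d" by (simp add: vec_eq_iff)
  then have "S = fc P d (\<lambda>z. z)" using inv unfolding fc_def by (metis matrix_inv_cancel(2))
  with inv d(1) show thesis by (intro that[of P d]) auto
qed

text \<open>More powers of \<open>A\<close> than the real dimension of the matrix space are linearly
  dependent; real coefficients suffice.\<close>

lemma exists_annihilator:
  fixes A :: "complex^'n^'n"
  obtains p where "p \<noteq> 0" "matpoly p A = 0"
\<comment> \<open>Dependence concerns a set, so a coincidence between two powers has to be treated
  separately.\<close>
proof (cases "inj (mpow A)")
  case False
  then obtain i j where "i \<noteq> j" "mpow A i = mpow A j" by (auto simp: inj_def)
  then have "monom 1 i - monom 1 j \<noteq> (0 :: complex poly)" "matpoly (monom 1 i - monom 1 j) A = 0"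
    by (auto simp: matpoly_diff matpoly_monom monom_eq_iff')
  then show thesis by (rule that)
next
  case True
  define B where "B = mpow A ` {..DIM(complex^'n^'n)}"
  have "card B = Suc DIM(complex^'n^'n)"
    unfolding B_def using True by (subst card_image) (auto intro: inj_on_subset)
  then have "dependent B"
    by (intro dependent_biggerset) (auto simp: B_def)
  then obtain u where u: "\<exists>v\<in>B. u v \<noteq> 0" "(\<Sum>v\<in>B. u v *\<^sub>R v) = 0"
    using dependent_finite[of B] by (auto simp: B_def)
  define p where "p = (\<Sum>k\<le>DIM(complex^'n^'n). monom (of_real (u (mpow A k))) k :: complex poly)"
  have sc: "r *\<^sub>R M = cscale (of_real r) M" for r and M :: "complex^'n^'n"
    by (simp add: vec_eq_iff) (simp add: scaleR_conv_of_real)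
  have "matpoly p A = (\<Sum>v\<in>B. u v *\<^sub>R v)"
    unfolding B_def using True
    by (subst sum.reindex) (auto simp: p_def matpoly_sum matpoly_monom sc intro: inj_on_subset)
  moreover have "p \<noteq> 0"
  proof -
    obtain k where k: "k \<le> DIM(complex^'n^'n)" "u (mpow A k) \<noteq> 0" using u(1) by (auto simp: B_def)
    then have "coeff p k = of_real (u (mpow A k))"
      by (simp add: p_def coeff_sum)
    with k show ?thesis by (metis coeff_0 of_real_eq_0_iff)
  qed
  ultimately show thesis using u(2) by (intro that) auto
qed

text \<open>\<open>q\<close> takes the value \<open>z\<close> to high order at each root
  \<open>z\<close> of the annihilator. Then \<open>q(A)\<close> is killed by a product of distinct
  linear factors, while \<open>X - q\<close> vanishes at all roots, so \<open>A - q(A)\<close> is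
  nilpotent.\<close>

lemma add_jordan_exists:
  fixes A :: "complex^'n^'n"
  obtains S N where "add_jordan_decomposition A S N"
proof -
  obtain p where p: "p \<noteq> 0" "matpoly p A = 0" by (rule exists_annihilator)
  define \<Lambda> where "\<Lambda> = {z. poly p z = 0}"
  have fin: "finite \<Lambda>" unfolding \<Lambda>_def by (rule poly_roots_finite[OF p(1)])
  \<comment> \<open>At least every root multiplicity, and positive, so that \<open>q(z) = z\<close>
    really holds.\<close>
  define n where "n = Suc (degree p)"
  define ch where "ch = (\<Prod>z\<in>\<Lambda>. [:-z, 1:] ^ Polynomial.order z p)"
  have "p = smult (lead_coeff p) ch"
    unfolding ch_def \<Lambda>_def by (rule complex_poly_decompose[symmetric])
  then have "cscale (lead_coeff p) (matpoly ch A) = 0" using p(2) by (metis matpoly_smult)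
  then have ch0: "matpoly ch A = 0" using p(1) by (simp add: cmat.scale_eq_0_iff)
  have ord: "[:-z, 1:] ^ Polynomial.order z p dvd [:-z, 1:] ^ n" for z
    using order_degree[OF p(1), of z] by (intro le_imp_power_dvd) (simp add: n_def)
  obtain q where q: "\<And>z. z \<in> \<Lambda> \<Longrightarrow> [:-z, 1:] ^ n dvd q - [:z:]"
    using hermite_interpolation[OF fin, of n "\<lambda>z. z"] by auto
  define S where "S = matpoly q A"
  define N where "N = matpoly ([:0, 1:] - q) A"
  have "[:-z, 1:] ^ Polynomial.order z p dvd pcompose [:-z, 1:] q" if "z \<in> \<Lambda>" for z
  proof -
    have "pcompose [:-z, 1:] q = q - [:z:]" by (simp add: pcompose_pCons)
    then show ?thesis using dvd_trans[OF ord q[OF that]] by simp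
  qed
  then have "ch dvd pcompose (\<Prod>z\<in>\<Lambda>. [:-z, 1:]) q"
    unfolding ch_def pcompose_prod by (intro prod_dvd_prod)
  then have "matpoly (\<Prod>z\<in>\<Lambda>. [:-z, 1:]) S = 0"
    unfolding S_def using matpoly_dvd_zero[OF _ ch0] by (simp flip: matpoly_pcompose)
  then have "semisimple_mat S"
    using diagonalizable_if_squarefree[OF fin] semisimple_mat_iff by metis
  moreover have "nilpotent_mat N"
  proof -
    have "[:-z, 1:] dvd [:0, 1:] - q" if "z \<in> \<Lambda>" for z
    proof -
      have "[:-z, 1:] dvd q - [:z:]" 
        using q[OF that] dvd_trans[OF dvd_triv_left] by (simp only: n_def power_Suc)
      then show ?thesis by (simp flip: poly_eq_0_iff_dvd)
    qed
    then have "(\<Prod>z\<in>\<Lambda>. [:-z, 1:] ^ n) dvd (\<Prod>z\<in>\<Lambda>. ([:0, 1:] - q) ^ n)"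
      by (intro prod_dvd_prod dvd_power_same)
    moreover have "ch dvd (\<Prod>z\<in>\<Lambda>. [:-z, 1:] ^ n)"
      unfolding ch_def by (intro prod_dvd_prod ord)
    ultimately have "ch dvd ([:0, 1:] - q) ^ (n * card \<Lambda>)"
      using dvd_trans by (simp add: power_mult)
    then have "mpow N (n * card \<Lambda>) = 0"
      unfolding N_def using matpoly_dvd_zero[OF _ ch0] by (simp only: flip: matpoly_power)
    then show ?thesis unfolding nilpotent_mat_def by blast
  qed
  moreover have "A = S + N"
    unfolding S_def N_def by (simp flip: matpoly_add)
  moreover have "S ** N = N ** S"
    unfolding S_def N_def by (rule matpoly_commute_self)
  ultimately show thesis using that unfolding add_jordan_decomposition_def by blast
qed

text \<open>The eigenvalues are 0 and 1, so the trace counts the rank. This supplies the nonnegative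
  weight multiplicities in the sum of squares.\<close>

lemma trace_idempotent:
  fixes E :: "complex^'n^'n"
  assumes "E ** E = E"
  shows "Re (trace E) \<ge> 0" "Im (trace E) = 0" "trace E = 0 \<Longrightarrow> E = 0"
proof -
  have "(\<Prod>l\<in>{0, 1 :: complex}. [:-l, 1:]) = [:0, -1, 1:]" by simp
  then have "matpoly (\<Prod>l\<in>{0, 1 :: complex}. [:-l, 1:]) E = 0"
    using assms by (simp add: cscale_distribs mat_distribs)
  then obtain P d where P: "invertible P" "E = fc P d (\<lambda>z. z)" "range d \<subseteq> {0, 1}"
    using diagonalizable_if_squarefree[of "{0, 1}" E] by auto
  have tr: "trace E = (\<Sum>i\<in>UNIV. d i)" using P by (simp add: trace_fc)
  have d: "Re (d i) \<ge> 0 \<and> Im (d i) = 0" for i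
    using P(3) by (metis insert_iff rangeI singletonD subsetD complex.sel zero_complex.sel one_complex.sel order_refl zero_le_one)
  show "Re (trace E) \<ge> 0" "Im (trace E) = 0"
    by (simp_all add: tr d sum_nonneg)
  assume "trace E = 0"
  then have "(\<Sum>i\<in>UNIV. Re (d i)) = 0" unfolding tr by (metis Re_sum zero_complex.sel(1))
  then have "\<forall>i. Re (d i) = 0" using d by (simp add: sum_nonneg_eq_0_iff)
  then have "d i = 0" for i using d by (simp add: complex_eq_iff)
  then show "E = 0" using P(2) fc_zero[of P d] fc_cong[of "\<lambda>z. z" d "\<lambda>z. 0" P] by simp
qed

section \<open>Curves of matrices\<close>

definition mderiv :: "(complex \<Rightarrow> complex^'n^'m) \<Rightarrow> complex^'n^'m \<Rightarrow> complex \<Rightarrow> bool" where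
  "mderiv \<gamma> Y t \<longleftrightarrow> (\<forall>i j. ((\<lambda>s. \<gamma> s $ i $ j) has_field_derivative Y $ i $ j) (at t))"

lemma mderiv_const: "mderiv (\<lambda>s. M) 0 t"
  by (simp add: mderiv_def)

lemma mderiv_mult:
  "mderiv \<gamma> Y t \<Longrightarrow> mderiv \<delta> Z t \<Longrightarrow> mderiv (\<lambda>s. \<gamma> s ** \<delta> s) (Y ** \<delta> t + \<gamma> t ** Z) t"
  unfolding mderiv_def
proof (intro allI)
  fix i j
  assume *: "\<forall>i j. ((\<lambda>s. \<gamma> s $ i $ j) has_field_derivative Y $ i $ j) (at t)"
    "\<forall>i j. ((\<lambda>s. \<delta> s $ i $ j) has_field_derivative Z $ i $ j) (at t)"
  have "((\<lambda>s. \<Sum>k\<in>UNIV. \<gamma> s $ i $ k * \<delta> s $ k $ j) has_field_derivative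
      (\<Sum>k\<in>UNIV. Y $ i $ k * \<delta> t $ k $ j + Z $ k $ j * \<gamma> t $ i $ k)) (at t)"
    by (intro DERIV_sum DERIV_mult *[rule_format])
  then show "((\<lambda>s. (\<gamma> s ** \<delta> s) $ i $ j) has_field_derivative (Y ** \<delta> t + \<gamma> t ** Z) $ i $ j) (at t)"
    by (simp add: matrix_mul_nth sum.distrib mult.commute)
qed

lemma mderiv_mult_left: "mderiv \<gamma> Y t \<Longrightarrow> mderiv (\<lambda>s. M ** \<gamma> s) (M ** Y) t"
  using mderiv_mult[OF mderiv_const, of \<gamma> Y t M] by simp

lemma mderiv_mult_right: "mderiv \<gamma> Y t \<Longrightarrow> mderiv (\<lambda>s. \<gamma> s ** M) (Y ** M) t"
  using mderiv_mult[OF _ mderiv_const, of \<gamma> Y t M] by simp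

lemma mderiv_line: "mderiv (\<lambda>s. M + cscale s X) X t"
  unfolding mderiv_def by (auto intro!: derivative_eq_intros)

lemma mderiv_unique: "mderiv \<gamma> Y t \<Longrightarrow> mderiv \<gamma> Z t \<Longrightarrow> Y = Z"
  unfolding mderiv_def vec_eq_iff using DERIV_unique by blast

lemma mderiv_trace:
  "mderiv \<gamma> Y t \<Longrightarrow> ((\<lambda>s. trace (\<gamma> s)) has_field_derivative trace Y) (at t)"
  unfolding mderiv_def trace_def by (auto intro!: derivative_eq_intros)

lemma mderiv_shift: "mderiv \<gamma> Y (t + c) \<Longrightarrow> mderiv (\<lambda>s. \<gamma> (s + c)) Y t"
  unfolding mderiv_def by (simp add: DERIV_shift)

lemma mderiv_minus: "mderiv \<gamma> Y (- t) \<Longrightarrow> mderiv (\<lambda>s. \<gamma> (- s)) (- Y) t"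
  unfolding mderiv_def
proof (intro allI)
  fix i j
  assume "\<forall>i j. ((\<lambda>s. \<gamma> s $ i $ j) has_field_derivative Y $ i $ j) (at (- t))"
  then have "((\<lambda>s. \<gamma> (- s) $ i $ j) has_field_derivative Y $ i $ j * - 1) (at t)"
    by (intro DERIV_chain2[where g = uminus]) (auto intro!: derivative_eq_intros)
  then show "((\<lambda>s. \<gamma> (- s) $ i $ j) has_field_derivative (- Y) $ i $ j) (at t)"
    by simp
qed

lemma mderiv_zero_imp_const:
  assumes "\<And>t. mderiv \<gamma> 0 t"
  shows "\<gamma> s = \<gamma> t"
proof -
  have "\<gamma> s $ i $ j = \<gamma> t $ i $ j" for i j
  proof -
    have "\<exists>c. \<forall>s\<in>UNIV. \<gamma> s $ i $ j = c"
      by (rule has_field_derivative_zero_constant) (use assms in \<open>auto simp: mderiv_def\<close>)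
    then show ?thesis by auto
  qed
  then show ?thesis by (simp add: vec_eq_iff)
qed

section \<open>Gradients of regular functions\<close>

lemma GL_regular_sum:
  assumes "\<And>i. i \<in> I \<Longrightarrow> f i \<in> GL_regular"
  shows "(\<lambda>A. \<Sum>i\<in>I. f i A) \<in> GL_regular"
  using assms by (induction I rule: infinite_finite_induct) (simp_all add: GL_regular.const GL_regular.add)

lemma GL_regular_prod:
  assumes "\<And>i. i \<in> I \<Longrightarrow> f i \<in> GL_regular"
  shows "(\<lambda>A. \<Prod>i\<in>I. f i A) \<in> GL_regular"
  using assms by (induction I rule: infinite_finite_induct) (simp_all add: GL_regular.const GL_regular.mult)

lemma GL_regular_translate:
  fixes A C :: "complex^'n^'n"
  assumes "f \<in> GL_regular"
  shows "(\<lambda>B. f (A ** B ** C)) \<in> GL_regular"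
  using assms
proof induction
  case (entry i j)
  show ?case unfolding matrix_mul_nth
    by (intro GL_regular_sum GL_regular.mult GL_regular.const GL_regular.entry)
next
  case inv_det
  show ?case unfolding det_mul inverse_mult_distrib
    by (intro GL_regular.mult GL_regular.const GL_regular.inv_det)
qed (auto intro: GL_regular.intros)

text \<open>The partial derivatives are required to be regular again, so that a vector field can be
  applied repeatedly to the ideal of a group; the chain rule is built in for every curve.\<close>

definition regular_grad ::
  "(complex^'n^'n \<Rightarrow> complex) \<Rightarrow> ('n \<Rightarrow> 'n \<Rightarrow> complex^'n^'n \<Rightarrow> complex) \<Rightarrow> bool" where
  "regular_grad f D \<longleftrightarrow> (\<forall>i j. D i j \<in> GL_regular) \<and>
     (\<forall>\<gamma> Y t. mderiv \<gamma> Y t \<longrightarrow> invertible (\<gamma> t) \<longrightarrow>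
       ((\<lambda>s. f (\<gamma> s)) has_field_derivative (\<Sum>i\<in>UNIV. \<Sum>j\<in>UNIV. D i j (\<gamma> t) * Y $ i $ j)) (at t))"

lemma regular_grad_const: "regular_grad (\<lambda>A. c) (\<lambda>i j A. 0)"
  by (simp add: regular_grad_def GL_regular.const)

lemma regular_grad_entry:
  "regular_grad (\<lambda>A. A $ a $ b) (\<lambda>i j A. if i = a then if j = b then 1 else 0 else 0)"
  unfolding regular_grad_def
proof (intro conjI allI impI)
  fix \<gamma> :: "complex \<Rightarrow> complex^'a^'a" and Y t
  assume "mderiv \<gamma> Y t"
  moreover have "(\<Sum>i\<in>UNIV. \<Sum>j\<in>UNIV. (if i = a then if j = b then 1 else 0 else 0) * Y $ i $ j)
      = (\<Sum>i\<in>UNIV. if i = a then Y $ a $ b else 0)"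
    by (intro sum.cong) (auto simp: mult_delta_left)
  ultimately show "((\<lambda>s. \<gamma> s $ a $ b) has_field_derivative
      (\<Sum>i\<in>UNIV. \<Sum>j\<in>UNIV. (if i = a then if j = b then 1 else 0 else 0) * Y $ i $ j)) (at t)"
    by (simp add: mderiv_def)
qed (simp add: GL_regular.const)

lemma regular_grad_add:
  "regular_grad f D \<Longrightarrow> regular_grad g E \<Longrightarrow> regular_grad (\<lambda>A. f A + g A) (\<lambda>i j A. D i j A + E i j A)"
  unfolding regular_grad_def
  by (auto intro!: GL_regular.add DERIV_add simp: distrib_right sum.distrib)

lemma regular_grad_mult:
  assumes "regular_grad f D" "regular_grad g E" "f \<in> GL_regular" "g \<in> GL_regular"
  shows "regular_grad (\<lambda>A. f A * g A) (\<lambda>i j A. D i j A * g A + f A * E i j A)"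
  unfolding regular_grad_def
proof (intro conjI allI impI)
  fix \<gamma> :: "complex \<Rightarrow> complex^'a^'a" and Y t
  assume \<gamma>: "mderiv \<gamma> Y t" "invertible (\<gamma> t)"
  have "((\<lambda>s. f (\<gamma> s) * g (\<gamma> s)) has_field_derivative
      (\<Sum>i\<in>UNIV. \<Sum>j\<in>UNIV. D i j (\<gamma> t) * Y $ i $ j) * g (\<gamma> t) + (\<Sum>i\<in>UNIV. \<Sum>j\<in>UNIV. E i j (\<gamma> t) * Y $ i $ j) * f (\<gamma> t)) (at t)"
    by (rule DERIV_mult) (use assms \<gamma> in \<open>auto simp: regular_grad_def\<close>)
  then show "((\<lambda>s. f (\<gamma> s) * g (\<gamma> s)) has_field_derivative
      (\<Sum>i\<in>UNIV. \<Sum>j\<in>UNIV. (D i j (\<gamma> t) * g (\<gamma> t) + f (\<gamma> t) * E i j (\<gamma> t)) * Y $ i $ j)) (at t)"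
    by (rule DERIV_cong) (simp add: algebra_simps sum_distrib_left sum.distrib)
qed (use assms in \<open>auto simp: regular_grad_def intro!: GL_regular.add GL_regular.mult\<close>)

lemma GL_regular_det: "det \<in> GL_regular"
  unfolding det_def[abs_def]
  by (intro GL_regular_sum GL_regular.mult GL_regular_prod GL_regular.const GL_regular.entry)

lemma regular_grad_det: "\<exists>D. regular_grad (det :: complex^'n^'n \<Rightarrow> complex) D"
proof -
  define Q where "Q f \<longleftrightarrow> f \<in> GL_regular \<and> (\<exists>D. regular_grad f D)" for f :: "complex^'n^'n \<Rightarrow> complex"
  have Qc: "Q (\<lambda>A. c)" for c
    unfolding Q_def using GL_regular.const regular_grad_const by blast
  have Qe: "Q (\<lambda>A. A $ i $ j)" for i j
    unfolding Q_def using GL_regular.entry regular_grad_entry by blast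
  have Qa: "Q (\<lambda>A. f A + g A)" if "Q f" "Q g" for f g
    using that unfolding Q_def using GL_regular.add regular_grad_add by blast
  have Qm: "Q (\<lambda>A. f A * g A)" if "Q f" "Q g" for f g
    using that unfolding Q_def using GL_regular.mult regular_grad_mult by blast
  have Qp: "Q (\<lambda>A. \<Prod>i\<in>I. f i A)" if "\<And>i. Q (f i)" for I :: "'n set" and f
    by (induction I rule: infinite_finite_induct) (simp_all add: Qc Qm that)
  have Qs: "Q (\<lambda>A. \<Sum>i\<in>I. f i A)" if "\<And>i. Q (f i)" for I :: "('n \<Rightarrow> 'n) set" and f
    by (induction I rule: infinite_finite_induct) (simp_all add: Qc Qa that)
  have "Q det"
    unfolding det_def[abs_def] by (intro Qs Qm Qp Qc Qe)
  then show ?thesis unfolding Q_def by blast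
qed

lemma GL_regular_grad:
  fixes f :: "complex^'n^'n \<Rightarrow> complex"
  assumes "f \<in> GL_regular"
  obtains D where "regular_grad f D"
proof -
  have "\<exists>D. regular_grad f D"
    using assms
  proof induction
    case inv_det
    obtain D where D: "regular_grad (det :: complex^'n^'n \<Rightarrow> complex) D"
      using regular_grad_det by blast
    have "regular_grad (\<lambda>A. inverse (det A)) (\<lambda>i j A. - 1 * (D i j A * (inverse (det A) * inverse (det A))))"
      unfolding regular_grad_def
    proof (intro conjI allI impI)
      fix i j
      show "(\<lambda>A. - 1 * (D i j A * (inverse (det A) * inverse (det A)))) \<in> GL_regular"
        using D by (intro GL_regular.mult GL_regular.const GL_regular.inv_det) (simp add: regular_grad_def)
    next
      fix \<gamma> :: "complex \<Rightarrow> complex^'n^'n" and Y t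
      assume \<gamma>: "mderiv \<gamma> Y t" "invertible (\<gamma> t)"
      then have nz: "det (\<gamma> t) \<noteq> 0" by (simp add: invertible_det_nz)
      have "((\<lambda>s. inverse (det (\<gamma> s))) has_field_derivative
        - (inverse (det (\<gamma> t)) * (\<Sum>i\<in>UNIV. \<Sum>j\<in>UNIV. D i j (\<gamma> t) * Y $ i $ j) * inverse (det (\<gamma> t)))) (at t)"
        by (rule DERIV_inverse') (use D \<gamma> nz in \<open>auto simp: regular_grad_def\<close>)
      then show "((\<lambda>s. inverse (det (\<gamma> s))) has_field_derivative
        (\<Sum>i\<in>UNIV. \<Sum>j\<in>UNIV. - 1 * (D i j (\<gamma> t) * (inverse (det (\<gamma> t)) * inverse (det (\<gamma> t)))) * Y $ i $ j)) (at t)"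
        by (rule DERIV_cong) (simp add: algebra_simps sum_distrib_left sum_negf)
    qed
    then show ?case by blast
  qed (use regular_grad_const regular_grad_entry regular_grad_add regular_grad_mult in blast)+
  then show thesis using that by blast
qed

lemma regular_gradD:
  assumes "regular_grad f D" "mderiv \<gamma> Y t" "invertible (\<gamma> t)"
  shows "((\<lambda>s. f (\<gamma> s)) has_field_derivative (\<Sum>i\<in>UNIV. \<Sum>j\<in>UNIV. D i j (\<gamma> t) * Y $ i $ j)) (at t)"
  using assms unfolding regular_grad_def by blast

lemma deriv_at_one_eq:
  assumes "regular_grad f D"
  shows "deriv_at_one f X = (\<Sum>i\<in>UNIV. \<Sum>j\<in>UNIV. D i j (mat 1) * X $ i $ j)"
proof -
  have "invertible (mat 1 :: complex^'a^'a)" by (rule invertibleI[of _ "mat 1"]) simp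
  then show ?thesis
    unfolding deriv_at_one_def
    using regular_gradD[OF assms mderiv_line, of "mat 1" 0 X] by (simp add: DERIV_imp_deriv)
qed

lemma deriv_at_one_curve:
  assumes "f \<in> GL_regular" "mderiv \<gamma> X 0" "\<gamma> 0 = mat 1"
  shows "((\<lambda>s. f (\<gamma> s)) has_field_derivative deriv_at_one f X) (at 0)"
proof -
  obtain D where D: "regular_grad f D" using GL_regular_grad[OF assms(1)] by blast
  have "invertible (mat 1 :: complex^'a^'a)" by (rule invertibleI[of _ "mat 1"]) simp
  then show ?thesis
    using regular_gradD[OF D assms(2)] by (simp add: deriv_at_one_eq[OF D] assms(3))
qed

text \<open>By linearity only matrix units matter: a diagonal one changes one diagonal entry of the
  identity, an off-diagonal one is a row operation.\<close>

lemma deriv_at_one_det: "deriv_at_one det X = trace X"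
proof -
  obtain D where D: "regular_grad (det :: complex^'a^'a \<Rightarrow> complex) D"
    using regular_grad_det by blast
  have "D a b (mat 1) = (if a = b then 1 else 0)" for a b
  proof -
    define E where "E = (\<chi> i j. if i = a \<and> j = b then 1 else (0 :: complex))"
    have "(\<Sum>i\<in>UNIV. \<Sum>j\<in>UNIV. D i j (mat 1) * E $ i $ j) =
        (\<Sum>i\<in>UNIV. if i = a then D a b (mat 1) else 0)"
      by (intro sum.cong) (auto simp: E_def if_distrib[of "\<lambda>x. _ * x"] cong: if_cong)
    also have "\<dots> = D a b (mat 1)"
      by simp
    finally have 1: "deriv_at_one det E = D a b (mat 1)" by (simp add: deriv_at_one_eq[OF D])
    show ?thesis
    proof (cases "a = b")
      case True
      have "det (mat 1 + cscale t E) = 1 + t" for t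
      proof -
        have "mat 1 + cscale t E = diagmat (\<lambda>i. if i = a then 1 + t else 1)"
          using True by (auto simp: vec_eq_iff E_def mat_def)
        then show ?thesis by (simp add: det_diagonal)
      qed
      then have "deriv_at_one det E = 1"
        unfolding deriv_at_one_def by (auto intro!: DERIV_imp_deriv derivative_eq_intros)
      with 1 True show ?thesis by simp
    next
      case False
      have "det (mat 1 + cscale t E) = 1" for t
      proof -
        have "mat 1 + cscale t E = (\<chi> k. if k = a then row a (mat 1) + t *s row b (mat 1) else row k (mat 1))"
          using False by (auto simp: vec_eq_iff E_def mat_def row_def)
        then show ?thesis using det_row_operation[OF False, of "mat 1" t] by simp
      qed
      then have "deriv_at_one det E = 0"
        unfolding deriv_at_one_def by simp
      with 1 False show ?thesis by simp
    qed
  qed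
  then show ?thesis
    by (simp add: deriv_at_one_eq[OF D] trace_def mult_delta_left)
qed

section \<open>Polynomial one-parameter groups\<close>

text \<open>A morphism of algebraic groups from the additive group. Polynomial entries force
  determinant one, unipotent values and a nilpotent derivative.\<close>

definition poly_group :: "(complex \<Rightarrow> complex^'n^'n) \<Rightarrow> bool" where
  "poly_group U \<longleftrightarrow> U 0 = mat 1 \<and> (\<forall>s t. U (s + t) = U s ** U t) \<and>
     (\<forall>i j. \<exists>p. \<forall>t. U t $ i $ j = poly p t)"

lemma poly_groupD:
  assumes "poly_group U"
  shows "U 0 = mat 1" "U (s + t) = U s ** U t" "U s ** U (- s) = mat 1" "U (- s) ** U s = mat 1"
  using assms unfolding poly_group_def by (metis, metis, metis add.right_inverse, metis add.left_inverse)

lemma poly_group_invertible: "poly_group U \<Longrightarrow> invertible (U t)"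
  using poly_groupD(3) invertibleI by blast

lemma poly_group_mpow: "poly_group U \<Longrightarrow> U (of_nat k * s) = mpow (U s) k"
  by (induction k) (simp_all add: poly_groupD distrib_right)

text \<open>\<open>det (U t)\<close> and \<open>det (U (- t))\<close> are polynomials in
  \<open>t\<close> with product 1, hence constant.\<close>

lemma poly_group_det:
  assumes "poly_group U"
  shows "det (U t) = 1"
proof -
  define Q where "Q f \<longleftrightarrow> (\<exists>p. \<forall>t. f t = poly p t)" for f :: "complex \<Rightarrow> complex"
  have Qc: "Q (\<lambda>t. c)" for c unfolding Q_def by (rule exI[of _ "[:c:]"]) simp
  have Qa: "Q (\<lambda>t. f t + g t)" if "Q f" "Q g" for f g
    using that unfolding Q_def by (metis poly_add)
  have Qm: "Q (\<lambda>t. f t * g t)" if "Q f" "Q g" for f g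
    using that unfolding Q_def by (metis poly_mult)
  have Qp: "Q (\<lambda>t. \<Prod>i\<in>I. f i t)" if "\<And>i. Q (f i)" for I :: "'a set" and f
    by (induction I rule: infinite_finite_induct) (simp_all add: Qc Qm that)
  have Qs: "Q (\<lambda>t. \<Sum>i\<in>I. f i t)" if "\<And>i. Q (f i)" for I :: "('a \<Rightarrow> 'a) set" and f
    by (induction I rule: infinite_finite_induct) (simp_all add: Qc Qa that)
  have "Q (\<lambda>t. U t $ i $ j)" for i j using assms unfolding poly_group_def Q_def by blast
  then have "Q (\<lambda>t. det (U t))"
    unfolding det_def[abs_def] by (intro Qs Qm Qp Qc)
  then obtain p where p: "\<And>t. det (U t) = poly p t" unfolding Q_def by blast
  have "poly p t * poly p (- t) = 1" for t
    unfolding p[symmetric] det_mul[symmetric] using poly_groupD(3)[OF assms] by simp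
  then have "poly (p * pcompose p [:0, -1:]) t = poly 1 t" for t
    by (simp add: poly_pcompose)
  then have "p * pcompose p [:0, -1:] = 1" by (simp add: poly_eq_poly_eq_iff[symmetric] ext)
  then have "degree p = 0"
    by (metis degree_1 degree_mult_eq add_is_0 mult_zero_left mult_zero_right zero_neq_one)
  then obtain c where "p = [:c:]" by (auto elim: degree_eq_zeroE)
  then have "det (U t) = det (U 0)" by (simp add: p)
  then show ?thesis by (simp add: poly_groupD(1)[OF assms])
qed

lemma poly_group_mderiv:
  assumes U: "poly_group U"
  obtains N where "\<And>t. mderiv U (U t ** N) t" "\<And>t. U t ** N = N ** U t"
proof -
  obtain p where p: "\<And>i j t. U t $ i $ j = poly (p i j) t"
    using U unfolding poly_group_def by metis
  define N where "N = (\<chi> i j. poly (pderiv (p i j)) 0)"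
  have N: "mderiv U N 0"
    unfolding mderiv_def p by (simp add: N_def poly_DERIV)
  have N': "mderiv (\<lambda>s. U (s + - t)) N t" for t
    by (rule mderiv_shift) (simp add: N)
  have 1: "mderiv U (U t ** N) t" for t
  proof -
    have "mderiv (\<lambda>s. U t ** U (s + - t)) (U t ** N) t"
      by (rule mderiv_mult_left[OF N'])
    moreover have "U t ** U (s + - t) = U s" for s
      using poly_groupD(2)[OF U, of t "s + - t"] by simp
    ultimately show ?thesis by simp
  qed
  have 2: "mderiv U (N ** U t) t" for t
  proof -
    have "mderiv (\<lambda>s. U (s + - t) ** U t) (N ** U t) t"
      by (rule mderiv_mult_right[OF N'])
    moreover have "U (s + - t) ** U t = U s" for s
      using poly_groupD(2)[OF U, of "s + - t" t] by simp
    ultimately show ?thesis by simp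
  qed
  show thesis using that[OF 1 mderiv_unique[OF 1 2]] .
qed

text \<open>Multiplication by \<open>M\<close> acts on the entries of \<open>U\<close> as the
  operator \<open>T\<close>, which lowers degrees, so a high power of \<open>M\<close> kills the
  invertible matrix \<open>U 0\<close>. Used with \<open>T\<close> the derivative and with
  \<open>T\<close> a finite difference.\<close>

lemma nilpotent_if_lowers_degree:
  fixes U :: "complex \<Rightarrow> complex^'n^'n" and T :: "complex poly \<Rightarrow> complex poly"
  assumes p: "\<And>t i j. U t $ i $ j = poly (p i j) t" and "invertible (U 0)"
    and M: "\<And>t i j. (M ** U t) $ i $ j = poly (T (p i j)) t"
    and add: "\<And>q r. T (q + r) = T q + T r" and sm: "\<And>c q. T (smult c q) = smult c (T q)"
    and deg: "\<And>q. degree q = 0 \<Longrightarrow> T q = 0" "\<And>q. degree q > 0 \<Longrightarrow> degree (T q) < degree q"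
  shows "nilpotent_mat M"
proof -
  have T0: "T 0 = 0" using deg(1) by simp
  have Tsum: "T (\<Sum>i\<in>I. f i) = (\<Sum>i\<in>I. T (f i))" for f and I :: "'n set"
    by (induction I rule: infinite_finite_induct) (simp_all add: T0 add)
  have Tk: "(T ^^ k) (q + r) = (T ^^ k) q + (T ^^ k) r" "(T ^^ k) (smult c q) = smult c ((T ^^ k) q)"
    "(T ^^ k) 0 = 0" for k q r c
    by (induction k) (simp_all add: add sm T0)
  have Tksum: "(T ^^ k) (\<Sum>i\<in>I. f i) = (\<Sum>i\<in>I. (T ^^ k) (f i))" for f and I :: "'n set" and k
    by (induction I rule: infinite_finite_induct) (simp_all add: Tk)
  have Tp: "T (p i j) = (\<Sum>l\<in>UNIV. smult (M $ i $ l) (p l j))" for i j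
  proof -
    have "poly (T (p i j)) t = poly (\<Sum>l\<in>UNIV. smult (M $ i $ l) (p l j)) t" for t
      using M[of t i j] by (simp add: matrix_mul_nth p poly_sum)
    then show ?thesis by (simp add: poly_eq_poly_eq_iff[symmetric] ext)
  qed
  have pow: "(mpow M k ** U t) $ i $ j = poly ((T ^^ k) (p i j)) t" for k t i j
  proof (induction k arbitrary: i)
    case (Suc k)
    have "(mpow M (Suc k) ** U t) $ i $ j = (M ** (mpow M k ** U t)) $ i $ j"
      by (simp add: matrix_mul_assoc)
    also have "\<dots> = (\<Sum>l\<in>UNIV. M $ i $ l * (mpow M k ** U t) $ l $ j)"
      by (rule matrix_mul_nth)
    also have "\<dots> = poly ((T ^^ k) (T (p i j))) t"
      by (simp only: Suc Tp Tksum Tk poly_sum poly_smult)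
    finally show ?case by (simp add: funpow_swap1)
  qed (simp add: p)
  have vanish: "(T ^^ k) q = 0" if "degree q < k" for k q
    using that
  proof (induction k arbitrary: q)
    case (Suc k)
    have "(T ^^ k) (T q) = 0"
    proof (cases "degree q = 0")
      case True
      then show ?thesis using deg(1) Tk(3) by simp
    next
      case False
      then show ?thesis using deg(2)[of q] Suc by force
    qed
    then show ?case by (simp add: funpow_swap1)
  qed simp
  define K where "K = Suc (\<Sum>i\<in>UNIV. \<Sum>j\<in>UNIV. degree (p i j))"
  have "degree (p i j) < K" for i j
  proof -
    have "degree (p i j) \<le> (\<Sum>j\<in>UNIV. degree (p i j))" by (rule member_le_sum) auto
    also have "\<dots> \<le> (\<Sum>i\<in>UNIV. \<Sum>j\<in>UNIV. degree (p i j))"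
      by (rule member_le_sum[where f = "\<lambda>i. \<Sum>j\<in>UNIV. degree (p i j)"]) auto
    finally show ?thesis by (simp add: K_def)
  qed
  then have "mpow M K ** U 0 = 0" by (simp add: vec_eq_iff pow vanish)
  then have "mpow M K = 0" using \<open>invertible (U 0)\<close> by (metis matrix_inv_cancel(2) matrix_mul_zero_left)
  then show ?thesis unfolding nilpotent_mat_def by blast
qed

lemma poly_group_nilpotent:
  assumes U: "poly_group U" and N: "mderiv U N 0"
  shows "nilpotent_mat N"
proof -
  obtain p where p: "\<And>i j t. U t $ i $ j = poly (p i j) t"
    using U unfolding poly_group_def by metis
  obtain N' where N': "\<And>t. mderiv U (U t ** N') t" "\<And>t. U t ** N' = N' ** U t"
    using poly_group_mderiv[OF U] by blast
  have "N' = N" using mderiv_unique[OF N'(1)[of 0] N] poly_groupD(1)[OF U] by simp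
  show ?thesis
  proof (rule nilpotent_if_lowers_degree[where T = pderiv, OF p poly_group_invertible[OF U]])
    show "(N ** U t) $ i $ j = poly (pderiv (p i j)) t" for t i j
    proof (rule DERIV_unique)
      have "mderiv U (N ** U t) t"
        using N'(1)[of t] N'(2)[of t] \<open>N' = N\<close> by simp
      then show "(poly (p i j) has_field_derivative (N ** U t) $ i $ j) (at t)"
        unfolding mderiv_def p by blast
    qed (rule poly_DERIV)
  qed (auto simp: pderiv_add pderiv_smult pderiv_eq_0_iff degree_pderiv)
qed

lemma coeff_shift:
  "coeff (pcompose q [:t, 1:]) (degree q) = lead_coeff (q :: complex poly)"
proof -
  have "lead_coeff (pcompose q [:t, 1:]) = lead_coeff q" by (subst lead_coeff_comp) simp_all
  then show ?thesis by (simp add: degree_pcompose)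
qed

lemma degree_shift_diff:
  fixes q :: "complex poly"
  assumes "degree q > 0"
  shows "degree (pcompose q [:t, 1:] - q) < degree q"
proof -
  have "coeff (pcompose q [:t, 1:] - q) (degree q) = 0" by (simp add: coeff_shift)
  moreover have "degree (pcompose q [:t, 1:] - q) \<le> degree q"
    by (intro degree_diff_le) (simp_all add: degree_pcompose)
  ultimately show ?thesis using assms
    by (metis degree_0 eq_zero_or_degree_less)
qed

text \<open>On entries, multiplication by \<open>U t - 1\<close> is the finite difference
  \<open>q(x + t) - q(x)\<close>.\<close>

lemma poly_group_unipotent:
  assumes U: "poly_group U"
  shows "unipotent_mat (U t)"
proof -
  obtain p where p: "\<And>i j t. U t $ i $ j = poly (p i j) t"
    using U unfolding poly_group_def by metis
  define T where "T q = pcompose q [:t, 1:] - q" for q :: "complex poly"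
  have "nilpotent_mat (U t - mat 1)"
  proof (rule nilpotent_if_lowers_degree[where T = T, OF p poly_group_invertible[OF U]])
    show "((U t - mat 1) ** U s) $ i $ j = poly (T (p i j)) s" for s i j
      by (simp add: mat_distribs poly_groupD(2)[OF U, symmetric] p T_def poly_pcompose)
  next
    show "T q = 0" if "degree q = 0" for q
      using that by (auto simp: T_def elim!: degree_eq_zeroE)
  next
    show "degree (T q) < degree q" if "degree q > 0" for q
      using degree_shift_diff[OF that] by (simp add: T_def)
  qed (auto simp: T_def pcompose_add pcompose_smult smult_diff_right)
  then show ?thesis by (simp add: unipotent_mat_def)
qed

text \<open>The identity \<open>c\<^sub>n(s + t) = \<Sum>\<^sub>k c\<^sub>k(s) c\<^sub>n\<^sub>-\<^sub>k(t)\<close> turns \<open>\<Sum>\<^sub>k c\<^sub>k(t) N\<^sup>k\<close> into a one-parameter group;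
  below \<open>c\<^sub>k(t) = t\<^sup>k/k!\<close> gives the exponential and \<open>c\<^sub>k(t) = (t choose k)\<close> the powers of \<open>1 + N\<close>.\<close>

lemma poly_group_series:
  fixes N :: "complex^'n^'n" and c :: "nat \<Rightarrow> complex \<Rightarrow> complex"
  assumes K: "mpow N K = 0" "K > 0"
    and c0: "\<And>k. c k 0 = (if k = 0 then 1 else 0)"
    and conv: "\<And>n s t. c n (s + t) = (\<Sum>k\<le>n. c k s * c (n - k) t)"
    and pol: "\<And>k. \<exists>p. \<forall>t. c k t = poly p t"
  shows "poly_group (\<lambda>t. \<Sum>k<K. cscale (c k t) (mpow N k))"
proof -
  define P where "P t = (\<Sum>k<K. monom (c k t) k)" for t
  have MP: "matpoly (P t) N = (\<Sum>k<K. cscale (c k t) (mpow N k))" for t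
    by (simp add: P_def matpoly_sum matpoly_monom)
  have cP: "coeff (P t) k = (if k < K then c k t else 0)" for t k
    by (simp add: P_def coeff_sum)
  have "matpoly (P 0) N = mat 1"
  proof -
    have "P 0 = 1" using K(2) by (intro poly_eqI) (auto simp: cP c0 coeff_1)
    then show ?thesis by simp
  qed
  moreover have "matpoly (P (s + t)) N = matpoly (P s) N ** matpoly (P t) N" for s t
  proof -
    \<comment> \<open>Below degree \<open>K\<close> the convolution identity is exact; the
      truncation error is a multiple of \<open>X^K\<close> and vanishes at \<open>N\<close>.\<close>
    have "coeff (P s * P t - P (s + t)) n = 0" if "n < K" for n
      using that by (simp add: coeff_mult cP conv less_imp_diff_less)
    then have "monom 1 K dvd P s * P t - P (s + t)"
      by (simp add: monom_1_dvd_iff')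
    then have "matpoly (P s * P t - P (s + t)) N = 0"
      by (rule matpoly_dvd_zero) (simp add: matpoly_monom K(1))
    then show ?thesis by (simp add: matpoly_diff matpoly_mult)
  qed
  moreover have "\<exists>p. \<forall>t. matpoly (P t) N $ i $ j = poly p t" for i j
  proof -
    obtain p where p: "\<And>k t. c k t = poly (p k) t" using pol by metis
    have "matpoly (P t) N $ i $ j = poly (\<Sum>k<K. smult (mpow N k $ i $ j) (p k)) t" for t
      by (simp add: MP poly_sum p mult.commute)
    then show ?thesis by blast
  qed
  ultimately show ?thesis unfolding poly_group_def MP by blast
qed

lemma commute_cscale_sum_mpow:
  assumes "M ** N = N ** M"
  shows "M ** (\<Sum>k\<in>I. cscale (c k) (mpow N k)) = (\<Sum>k\<in>I. cscale (c k) (mpow N k)) ** M"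
  by (simp add: matrix_sum_left matrix_sum_right mpow_commute assms)

lemma nilpotent_exp:
  fixes N :: "complex^'n^'n"
  assumes "nilpotent_mat N"
  obtains U where "poly_group U" "mderiv U N 0" "\<And>M t. M ** N = N ** M \<Longrightarrow> M ** U t = U t ** M"
proof -
  obtain k where "mpow N k = 0" using assms unfolding nilpotent_mat_def by blast
  \<comment> \<open>At least 2, so that the linear term, which carries the derivative
    \<open>N\<close>, is present.\<close>
  define K where "K = k + 2"
  have K: "mpow N K = 0" by (rule mpow_zero_mono[OF \<open>mpow N k = 0\<close>]) (simp add: K_def)
  have "1 < K" by (simp add: K_def)
  define c where "c k t = t ^ k / fact k" for k and t :: complex
  have dc: "(c k has_field_derivative (if k = 1 then 1 else 0)) (at 0)" for k
  proof (cases k)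
    case (Suc m)
    then have "((\<lambda>t :: complex. t ^ Suc m / fact (Suc m)) has_field_derivative (of_nat (Suc m) * 0 ^ m / fact (Suc m))) (at 0)"
      by (auto intro!: derivative_eq_intros)
    with Suc show ?thesis by (cases m) (auto simp: c_def[abs_def])
  qed (simp add: c_def[abs_def])
  define U where "U t = (\<Sum>k<K. cscale (c k t) (mpow N k))" for t
  have "poly_group U"
    unfolding U_def
  proof (rule poly_group_series[OF K])
    show "c n (s + t) = (\<Sum>k\<le>n. c k s * c (n - k) t)" for n s t
    proof -
      have "c n (s + t) = (\<Sum>k\<le>n. of_nat (n choose k) * s ^ k * t ^ (n - k) / fact n)"
        unfolding c_def binomial_ring sum_divide_distrib ..
      also have "\<dots> = (\<Sum>k\<le>n. c k s * c (n - k) t)"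
        by (intro sum.cong refl) (simp add: c_def binomial_fact field_simps)
      finally show ?thesis .
    qed
    show "\<exists>p. \<forall>t. c k t = poly p t" for k
      by (rule exI[of _ "monom (1 / fact k) k"]) (simp add: c_def poly_monom)
  qed (simp_all add: c_def K_def power_0_left)
  moreover have "mderiv U N 0"
    unfolding mderiv_def U_def
  proof (intro allI)
    fix i j
    have "((\<lambda>s. \<Sum>k<K. c k s * mpow N k $ i $ j) has_field_derivative
        (\<Sum>k<K. (if k = 1 then 1 else 0) * mpow N k $ i $ j)) (at 0)"
      by (intro DERIV_sum DERIV_cmult_right dc)
    moreover have "(\<Sum>k<K. (if k = 1 then 1 else 0) * mpow N k $ i $ j) = mpow N 1 $ i $ j"
      using \<open>1 < K\<close> by (simp add: mult_delta_left del: funpow.simps)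
    ultimately show "((\<lambda>s. (\<Sum>k<K. cscale (c k s) (mpow N k)) $ i $ j) has_field_derivative N $ i $ j) (at 0)"
      by simp
  qed
  moreover have "M ** N = N ** M \<Longrightarrow> M ** U t = U t ** M" for M t
    unfolding U_def by (rule commute_cscale_sum_mpow)
  ultimately show thesis by (rule that)
qed

lemma unipotent_powers:
  fixes u :: "complex^'n^'n"
  assumes "unipotent_mat u"
  obtains U where "poly_group U" "U 1 = u" "\<And>M t. M ** u = u ** M \<Longrightarrow> M ** U t = U t ** M"
proof -
  define N where "N = u - mat 1"
  obtain k where "mpow N k = 0"
    using assms unfolding unipotent_mat_def nilpotent_mat_def N_def by blast
  \<comment> \<open>At least 2: the value at 1 is \<open>1 + N\<close>, the terms of index 0 and
    1.\<close>
  define K where "K = k + 2"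
  have K: "mpow N K = 0" by (rule mpow_zero_mono[OF \<open>mpow N k = 0\<close>]) (simp add: K_def)
  define c where "c k t = t gchoose k" for k and t :: complex
  define U where "U t = (\<Sum>k<K. cscale (c k t) (mpow N k))" for t
  have "poly_group U"
    unfolding U_def
  proof (rule poly_group_series[OF K])
    show "c n (s + t) = (\<Sum>k\<le>n. c k s * c (n - k) t)" for n s t
      unfolding c_def by (simp add: gbinomial_Vandermonde flip: atLeast0AtMost)
    show "\<exists>p. \<forall>t. c k t = poly p t" for k
      by (rule exI[of _ "smult (1 / fact k) (\<Prod>i = 0..<k. [:- of_nat i, 1:])"])
         (simp add: c_def gbinomial_prod_rev poly_prod)
    show "c k 0 = (if k = 0 then 1 else 0)" for k
      by (cases k) (simp_all add: c_def)
  qed (simp add: K_def)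
  moreover have "U 1 = u"
  proof -
    have "c k 1 = (if k < 2 then 1 else 0)" for k
    proof -
      have "c k 1 = of_nat (1 choose k)" unfolding c_def using binomial_gbinomial[of 1 k, where ?'a = complex] by simp
      then show ?thesis by (cases "k < 2") (auto simp: less_2_cases_iff binomial_eq_0)
    qed
    then have "U 1 = (\<Sum>k<K. if k < 2 then mpow N k else 0)"
      unfolding U_def by (intro sum.cong) auto
    also have "\<dots> = (\<Sum>k<2. mpow N k)"
      by (rule sum.mono_neutral_cong_right) (auto simp: K_def)
    finally show ?thesis by (simp add: N_def numeral_2_eq_2)
  qed
  moreover have "M ** u = u ** M \<Longrightarrow> M ** U t = U t ** M" for M t
    unfolding U_def by (rule commute_cscale_sum_mpow) (simp add: N_def mat_distribs)
  ultimately show thesis by (rule that)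
qed

text \<open>The determinant is constant along the one-parameter group of \<open>N\<close>, and its
  derivative at the identity is the trace.\<close>

lemma trace_nilpotent:
  assumes "nilpotent_mat N"
  shows "trace N = 0"
proof -
  obtain U where U: "poly_group U" "mderiv U N 0" using nilpotent_exp[OF assms] by metis
  have "((\<lambda>s. det (U s)) has_field_derivative trace N) (at 0)"
    using deriv_at_one_curve[OF GL_regular_det U(2)] poly_groupD(1)[OF U(1)]
    by (simp add: deriv_at_one_det)
  moreover have "((\<lambda>s. det (U s)) has_field_derivative 0) (at 0)"
    by (simp add: poly_group_det[OF U(1)])
  ultimately show ?thesis by (rule DERIV_unique)
qed

section \<open>Exponential polynomials\<close>

lemma poly_eq_0_if_nat_roots:
  fixes p :: "complex poly"
  assumes "\<And>m :: nat. poly p (of_nat m) = 0"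
  shows "p = 0"
proof (rule ccontr)
  assume "p \<noteq> 0"
  then have "finite {z. poly p z = 0}" by (rule poly_roots_finite)
  moreover have "range (of_nat :: nat \<Rightarrow> complex) \<subseteq> {z. poly p z = 0}" using assms by auto
  ultimately have "finite (range (of_nat :: nat \<Rightarrow> complex))" by (rule rev_finite_subset)
  then show False by (simp add: finite_image_iff inj_on_def)
qed

text \<open>The shift \<open>F(m) \<mapsto> F(m + 1) - \<beta> F(m)\<close> lowers the degree of the coefficient of \<open>\<beta>\<^sup>m\<close> and
  preserves the degrees of the other coefficients.\<close>

lemma poly_power_independent:
  fixes p :: "complex \<Rightarrow> complex poly"
  assumes "finite A" "0 \<notin> A" "\<And>m :: nat. (\<Sum>\<alpha>\<in>A. poly (p \<alpha>) (of_nat m) * \<alpha> ^ m) = 0" "\<alpha> \<in> A"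
  shows "p \<alpha> = 0"
  using assms
proof (induction A arbitrary: p \<alpha> rule: finite_induct)
  case (insert \<beta> A)
  have \<beta>: "\<beta> \<noteq> 0" using insert.prems(1) by auto
  \<comment> \<open>Induction on a bound for the degree of \<open>p \<beta>\<close>; once
    \<open>p \<beta> = 0\<close>, the outer induction on the set applies.\<close>
  have step: "\<forall>\<alpha>\<in>insert \<beta> A. p \<alpha> = 0"
    if "p \<beta> = 0 \<or> degree (p \<beta>) < n"
      "\<And>m :: nat. (\<Sum>\<alpha>\<in>insert \<beta> A. poly (p \<alpha>) (of_nat m) * \<alpha> ^ m) = 0" for n p
    using that
  proof (induction n arbitrary: p)
    case 0
    then have "p \<beta> = 0" by simp
    with 0(2) have "(\<Sum>\<alpha>\<in>A. poly (p \<alpha>) (of_nat m) * \<alpha> ^ m) = 0" for m :: nat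
      using insert.hyps by simp
    then have "p \<alpha> = 0" if "\<alpha> \<in> A" for \<alpha>
      using insert.IH[of p \<alpha>] insert.prems(1) that by simp
    with \<open>p \<beta> = 0\<close> show ?case by simp
  next
    case (Suc n)
    define F where "F m = (\<Sum>\<alpha>\<in>insert \<beta> A. poly (p \<alpha>) (of_nat m) * \<alpha> ^ m)" for m
    define q where "q \<alpha> = smult \<alpha> (pcompose (p \<alpha>) [:1, 1:]) - smult \<beta> (p \<alpha>)" for \<alpha>
    have q\<beta>: "q \<beta> = smult \<beta> (pcompose (p \<beta>) [:1, 1:] - p \<beta>)"
      by (simp add: q_def smult_diff_right)
    have "q \<beta> = 0 \<or> degree (q \<beta>) < n"
    proof (cases "degree (p \<beta>) = 0")
      case True
      then show ?thesis by (auto simp: q\<beta> elim!: degree_eq_zeroE)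
    next
      case False
      then show ?thesis using degree_shift_diff[of "p \<beta>" 1] Suc.prems(1) \<beta> by (auto simp: q\<beta>)
    qed
    moreover have "(\<Sum>\<alpha>\<in>insert \<beta> A. poly (q \<alpha>) (of_nat m) * \<alpha> ^ m) = 0" for m :: nat
    proof -
      have "(\<Sum>\<alpha>\<in>insert \<beta> A. poly (q \<alpha>) (of_nat m) * \<alpha> ^ m) = F (Suc m) - \<beta> * F m"
        unfolding F_def sum_distrib_left sum_subtractf[symmetric]
        by (intro sum.cong refl) (simp add: q_def poly_pcompose algebra_simps)
      then show ?thesis using Suc.prems(2) by (simp only: F_def) simp
    qed
    ultimately have q0: "\<forall>\<alpha>\<in>insert \<beta> A. q \<alpha> = 0" by (rule Suc.IH)
    have pA: "p \<alpha> = 0" if "\<alpha> \<in> A" for \<alpha>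
    proof -
      \<comment> \<open>For \<open>\<alpha> \<noteq> \<beta>\<close> the leading coefficient is only
        multiplied by \<open>\<alpha> - \<beta>\<close>, so vanishing of \<open>q \<alpha>\<close>
        passes to \<open>p \<alpha>\<close>.\<close>
      have "coeff (q \<alpha>) (degree (p \<alpha>)) = (\<alpha> - \<beta>) * lead_coeff (p \<alpha>)"
        by (simp add: q_def coeff_shift algebra_simps)
      moreover have "\<alpha> \<noteq> \<beta>" using that insert.hyps by auto
      ultimately show ?thesis using q0 that by simp
    qed
    have "poly (p \<beta>) (of_nat m) = 0" for m :: nat
    proof -
      have "(\<Sum>\<alpha>\<in>A. poly (p \<alpha>) (of_nat m) * \<alpha> ^ m) = 0" using pA by (intro sum.neutral) simp
      then show ?thesis using Suc.prems(2)[of m] insert.hyps \<beta> by simp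
    qed
    then have "p \<beta> = 0" by (rule poly_eq_0_if_nat_roots)
    with pA show ?case by simp
  qed
  show ?case
    using step[of p "Suc (degree (p \<beta>))"] insert.prems by auto
qed simp

text \<open>A list \<open>L\<close> of pairs \<open>(p, \<nu>)\<close> stands for the exponential polynomial \<open>\<Sum> p(s) e\<^sup>\<nu>\<close>, in which the
  character \<open>\<nu> \<mapsto> e\<^sup>\<nu>\<close> of \<open>(\<complex>, +)\<close> may be replaced by any other character \<open>y\<close>.\<close>

definition ev :: "(complex poly \<times> complex) list \<Rightarrow> (complex \<Rightarrow> complex) \<Rightarrow> complex \<Rightarrow> complex" where
  "ev L y s = (\<Sum>(p, \<nu>)\<leftarrow>L. poly p s * y \<nu>)"

lemma ev_Nil [simp]: "ev [] y s = 0"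
  and ev_Cons [simp]: "ev ((p, \<nu>) # L) y s = poly p s * y \<nu> + ev L y s"
  and ev_append [simp]: "ev (L @ M) y s = ev L y s + ev M y s"
  by (simp_all add: ev_def)

lemma ev_cong: "(\<And>p \<nu>. (p, \<nu>) \<in> set L \<Longrightarrow> y \<nu> = y' \<nu>) \<Longrightarrow> ev L y s = ev L y' s"
  unfolding ev_def by (intro arg_cong[of _ _ sum_list] map_cong) auto

text \<open>No continuity or holomorphy is asked for: \<open>exp (t * cnj \<nu>)\<close> must
  qualify.\<close>

definition additive_char :: "(complex \<Rightarrow> complex) \<Rightarrow> bool" where
  "additive_char y \<longleftrightarrow> y 0 = 1 \<and> (\<forall>\<mu> \<nu>. y (\<mu> + \<nu>) = y \<mu> * y \<nu>)"

lemma additive_char_exp: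
  assumes "\<And>\<mu> \<nu>. \<psi> (\<mu> + \<nu>) = \<psi> \<mu> + (\<psi> \<nu> :: complex)"
  shows "additive_char (\<lambda>\<nu>. exp (t * \<psi> \<nu>))"
proof -
  have "\<psi> 0 = 0" using assms[of 0 0] by simp
  then show ?thesis by (simp add: additive_char_def assms distrib_left exp_add)
qed

lemma additive_char_minus: "additive_char y \<Longrightarrow> y \<nu> * y (- \<nu>) = 1"
  unfolding additive_char_def by (metis add.right_inverse)

lemma additive_char_nonzero: "additive_char y \<Longrightarrow> y \<nu> \<noteq> 0"
  using additive_char_minus[of y \<nu>] by auto

lemma additive_char_inverse: "additive_char y \<Longrightarrow> inverse (y \<nu>) = y (- \<nu>)"
  using additive_char_minus by (rule inverse_unique)

text \<open>The same list serves all characters. This uniformity is what carries vanishing from one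
  family of characters to every other.\<close>

definition expandable :: "((complex \<Rightarrow> complex) \<Rightarrow> complex \<Rightarrow> complex) \<Rightarrow> bool" where
  "expandable F \<longleftrightarrow> (\<exists>L. \<forall>y s. additive_char y \<longrightarrow> F y s = ev L y s)"

lemma expandable_poly: "expandable (\<lambda>y s. poly p s)"
  unfolding expandable_def by (rule exI[of _ "[(p, 0)]"]) (simp add: additive_char_def)

lemma expandable_const: "expandable (\<lambda>y s. c)"
  using expandable_poly[of "[:c:]"] by simp

lemma expandable_char: "expandable (\<lambda>y s. y \<nu>)"
  unfolding expandable_def by (rule exI[of _ "[(1, \<nu>)]"]) simp

lemma expandable_add:
  assumes "expandable F" "expandable H"
  shows "expandable (\<lambda>y s. F y s + H y s)"
proof -
  obtain L M where "\<forall>y s. additive_char y \<longrightarrow> F y s = ev L y s" "\<forall>y s. additive_char y \<longrightarrow> H y s = ev M y s"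
    using assms unfolding expandable_def by blast
  then show ?thesis unfolding expandable_def by (intro exI[of _ "L @ M"]) simp
qed

lemma ev_mult:
  assumes "additive_char y"
  shows "ev L y s * ev M y s = ev (concat (map (\<lambda>(p, \<nu>). map (\<lambda>(q, \<mu>). (p * q, \<nu> + \<mu>)) M) L)) y s"
proof -
  have 1: "poly p s * y \<nu> * ev M y s = ev (map (\<lambda>(q, \<mu>). (p * q, \<nu> + \<mu>)) M) y s" for p \<nu>
    using assms by (induction M) (auto simp: additive_char_def algebra_simps)
  show ?thesis by (induction L) (auto simp: distrib_right 1)
qed

lemma expandable_mult:
  assumes "expandable F" "expandable H"
  shows "expandable (\<lambda>y s. F y s * H y s)"
proof -
  obtain L M where "\<forall>y s. additive_char y \<longrightarrow> F y s = ev L y s" "\<forall>y s. additive_char y \<longrightarrow> H y s = ev M y s"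
    using assms unfolding expandable_def by blast
  then have "F y s * H y s = ev (concat (map (\<lambda>(p, \<nu>). map (\<lambda>(q, \<mu>). (p * q, \<nu> + \<mu>)) M) L)) y s"
    if "additive_char y" for y s
    using that by (simp only: ev_mult[OF that, symmetric])
  then show ?thesis unfolding expandable_def by blast
qed

lemma expandable_sum: "(\<And>i. i \<in> I \<Longrightarrow> expandable (F i)) \<Longrightarrow> expandable (\<lambda>y s. \<Sum>i\<in>I. F i y s)"
  by (induction I rule: infinite_finite_induct) (simp_all add: expandable_const expandable_add)

lemma expandable_prod: "(\<And>i. i \<in> I \<Longrightarrow> expandable (F i)) \<Longrightarrow> expandable (\<lambda>y s. \<Prod>i\<in>I. F i y s)"
  by (induction I rule: infinite_finite_induct) (simp_all add: expandable_const expandable_mult)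

lemma expandable_cong:
  assumes "expandable F" "\<And>y s. additive_char y \<Longrightarrow> F y s = H y s"
  shows "expandable H"
  using assms unfolding expandable_def by metis

lemma fc_nth: "fc P d y $ i $ j = (\<Sum>k\<in>UNIV. P $ i $ k * y (d k) * matrix_inv P $ k $ j)"
  unfolding fc_def by (subst matrix_mul_nth) simp

lemma regular_expandable:
  fixes P :: "complex^'n^'n"
  assumes P: "invertible P" and U: "poly_group U" and "f \<in> GL_regular"
  shows "expandable (\<lambda>y s. f (fc P d y ** U s))"
  using assms(3)
proof induction
  case (const c)
  show ?case by (rule expandable_const)
next
  case (entry i j)
  obtain p where p: "\<And>i j t. U t $ i $ j = poly (p i j) t"
    using U unfolding poly_group_def by metis
  show ?case
    unfolding matrix_mul_nth fc_nth p
    by (intro expandable_sum expandable_mult expandable_const expandable_char expandable_poly)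
next
  case inv_det
  \<comment> \<open>The inverse determinant stays expandable because \<open>det (U s) = 1\<close>
    and \<open>y\<close> turns negation into inversion.\<close>
  have "expandable (\<lambda>y s. \<Prod>i\<in>UNIV. y (- d i))"
    by (intro expandable_prod expandable_char)
  then show ?case
  proof (rule expandable_cong)
    fix y s assume "additive_char y"
    then show "(\<Prod>i\<in>UNIV. y (- d i)) = inverse (det (fc P d y ** U s))"
      by (simp add: det_mul poly_group_det[OF U] det_fc[OF P] additive_char_inverse flip: prod_inversef)
  qed
next
  case (add f g)
  show ?case by (rule expandable_add[OF add.IH])
next
  case (mult f g)
  show ?case by (rule expandable_mult[OF mult.IH])
qed

text \<open>Collects the terms on which \<open>e\<close> takes the same value; \<open>e\<close> may
  fail to be injective on the exponents.\<close>

lemma ev_group: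
  assumes "finite A" "e ` snd ` set L \<subseteq> A"
  shows "ev L (\<lambda>\<nu>. g (e \<nu>)) s = (\<Sum>\<alpha>\<in>A. poly (\<Sum>(p, \<nu>)\<leftarrow>L. if e \<nu> = \<alpha> then p else 0) s * g \<alpha>)"
  using assms(2)
proof (induction L)
  case (Cons x L)
  obtain p \<nu> where x: "x = (p, \<nu>)" by force
  have "(\<Sum>\<alpha>\<in>A. poly (if e \<nu> = \<alpha> then p else 0) s * g \<alpha>) = (\<Sum>\<alpha>\<in>A. if e \<nu> = \<alpha> then poly p s * g \<alpha> else 0)"
    by (intro sum.cong) auto
  also have "\<dots> = poly p s * g (e \<nu>)"
    using Cons.prems assms(1) by (simp add: x)
  finally show ?case using Cons by (simp add: x distrib_right sum.distrib)
qed simp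

text \<open>After grouping, the hypothesis kills every coefficient polynomial, so the powers may be
  replaced by any function of \<open>e \<nu>\<close>, and the integer argument by any
  \<open>s\<close>.\<close>

lemma ev_zero_power:
  assumes "\<And>m :: nat. ev L (\<lambda>\<nu>. e \<nu> ^ m) (of_nat m) = 0" "\<And>\<nu>. e \<nu> \<noteq> 0"
  shows "ev L (\<lambda>\<nu>. g (e \<nu>)) s = 0"
proof -
  define A where "A = e ` snd ` set L"
  define P where "P \<alpha> = (\<Sum>(p, \<nu>)\<leftarrow>L. if e \<nu> = \<alpha> then p else 0)" for \<alpha>
  have A: "finite A" "e ` snd ` set L \<subseteq> A" "0 \<notin> A" using assms(2) by (auto simp: A_def)
  have eq: "ev L (\<lambda>\<nu>. g (e \<nu>)) s = (\<Sum>\<alpha>\<in>A. poly (P \<alpha>) s * g \<alpha>)" for g s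
    unfolding P_def by (rule ev_group[OF A(1,2)])
  have "P \<alpha> = 0" if "\<alpha> \<in> A" for \<alpha>
    by (rule poly_power_independent[OF A(1,3) _ that]) (simp add: assms(1) flip: eq)
  then show ?thesis by (simp add: eq)
qed

text \<open>Sampling \<open>t\<close> at integer multiples of a small \<epsilon> reduces to powers
  of \<open>exp (\<epsilon> * \<nu>)\<close>. Since \<open>y\<close> is arbitrary, these bases must
  separate the exponents of \<open>L\<close>.\<close>

lemma ev_zero_exp:
  assumes "\<And>t. ev L (\<lambda>\<nu>. exp (t * \<nu>)) t = 0"
  shows "ev L y s = 0"
proof -
  define B where "B = snd ` set L"
  have B: "finite B" by (simp add: B_def)
  define R where "R = 1 + (\<Sum>\<nu>\<in>B. norm \<nu>)"
  have R: "R > 0" unfolding R_def by (intro add_pos_nonneg sum_nonneg) auto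
  have normB: "norm \<nu> < R" if "\<nu> \<in> B" for \<nu>
    using member_le_sum[OF that, of norm] B by (simp add: R_def)
  \<comment> \<open>So small that \<open>\<epsilon> * \<mu>\<close> and
    \<open>\<epsilon> * \<nu>\<close> differ by less than the period of \<open>exp\<close>.\<close>
  define \<epsilon> :: complex where "\<epsilon> = of_real (1 / R)"
  have \<epsilon>: "\<epsilon> \<noteq> 0" "norm \<epsilon> = 1 / R" using R by (simp_all add: \<epsilon>_def norm_divide)
  define e where "e \<nu> = exp (\<epsilon> * \<nu>)" for \<nu>
  have "inj_on e B"
  proof (rule inj_onI)
    fix \<mu> \<nu> assume *: "\<mu> \<in> B" "\<nu> \<in> B" "e \<mu> = e \<nu>"
    then obtain n :: int where n: "\<epsilon> * \<mu> = \<epsilon> * \<nu> + (of_int (2 * n) * pi) * \<i>"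
      unfolding e_def exp_eq by blast
    have "norm (\<epsilon> * \<mu> - \<epsilon> * \<nu>) \<le> norm (\<epsilon> * \<mu>) + norm (\<epsilon> * \<nu>)" by (rule norm_triangle_ineq4)
    also have "\<dots> < 2"
      using normB[OF *(1)] normB[OF *(2)] R by (simp add: norm_mult \<epsilon> field_simps)
    finally have "norm ((of_int (2 * n) * pi) * \<i>) < 2" by (simp add: n)
    then have "2 * \<bar>real_of_int n\<bar> * pi < 2" by (simp add: norm_mult abs_mult)
    then have small: "\<bar>real_of_int n\<bar> * pi < 1" by simp
    have "n = 0"
    proof (rule ccontr)
      assume "n \<noteq> 0"
      then have "1 * 1 \<le> \<bar>real_of_int n\<bar> * pi" using pi_gt3 by (intro mult_mono) auto
      with small show False by simp
    qed
    with n \<epsilon> show "\<mu> = \<nu>" by simp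
  qed
  define L' where "L' = map (\<lambda>(p, \<nu>). (pcompose p [:0, \<epsilon>:], \<nu>)) L"
  have L': "ev L' y s = ev L y (\<epsilon> * s)" for y s
    unfolding L'_def by (induction L) (auto simp: poly_pcompose mult.commute)
  have "ev L' (\<lambda>\<nu>. e \<nu> ^ m) (of_nat m) = 0" for m :: nat
    using assms[of "\<epsilon> * of_nat m"] by (simp add: L' e_def exp_of_nat_mult[symmetric] mult_ac)
  then have "ev L' (\<lambda>\<nu>. (y \<circ> inv_into B e) (e \<nu>)) (s / \<epsilon>) = 0"
    by (rule ev_zero_power) (simp add: e_def)
  also have "ev L' (\<lambda>\<nu>. (y \<circ> inv_into B e) (e \<nu>)) (s / \<epsilon>) = ev L (\<lambda>\<nu>. (y \<circ> inv_into B e) (e \<nu>)) s"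
    using \<epsilon> by (simp add: L')
  also have "\<dots> = ev L y s"
  proof (rule ev_cong)
    fix p \<nu> assume "(p, \<nu>) \<in> set L"
    then have "\<nu> \<in> B" by (force simp: B_def)
    then show "(y \<circ> inv_into B e) (e \<nu>) = y \<nu>" by (simp add: inv_into_f_f[OF \<open>inj_on e B\<close>])
  qed
  finally show ?thesis .
qed

section \<open>Jordan parts and replicas\<close>

text \<open>The hypothesis supplies only the pairs \<open>(m, m)\<close>; exponent \<open>k\<close>
  and parameter \<open>s\<close> then become independent. The pair \<open>(1, 0)\<close> will
  isolate a semisimple part, the pairs \<open>(0, t)\<close> a unipotent one-parameter
  group.\<close>

lemma closed_contains_power_parts:
  fixes P :: "complex^'n^'n"
  assumes Z: "closedin zariski Z" and P: "invertible P" and U: "poly_group U"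
    and mem: "\<And>m :: nat. fc P d (\<lambda>\<nu>. exp \<nu> ^ m) ** U (of_nat m) \<in> Z"
  shows "fc P d (\<lambda>\<nu>. exp \<nu> ^ k) ** U s \<in> Z"
proof -
  obtain S where S: "S \<subseteq> GL_regular" "Z = {A. invertible A \<and> (\<forall>f\<in>S. f A = 0)}"
    using Z unfolding closedin_zariski by blast
  have char: "additive_char (\<lambda>\<nu>. exp \<nu> ^ m)" for m
    by (simp add: additive_char_def exp_add power_mult_distrib)
  have "f (fc P d (\<lambda>\<nu>. exp \<nu> ^ k) ** U s) = 0" if "f \<in> S" for f
  proof -
    have "expandable (\<lambda>y s. f (fc P d y ** U s))"
      using regular_expandable[OF P U] S(1) that by blast
    then obtain L where L: "\<And>y s. additive_char y \<Longrightarrow> f (fc P d y ** U s) = ev L y s"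
      unfolding expandable_def by blast
    have "ev L (\<lambda>\<nu>. exp \<nu> ^ m) (of_nat m) = 0" for m :: nat
      using mem[of m] that unfolding L[OF char, symmetric] S(2) by blast
    then have "ev L (\<lambda>\<nu>. exp \<nu> ^ k) s = 0"
      by (rule ev_zero_power[where e = exp and g = "\<lambda>\<alpha>. \<alpha> ^ k"]) simp
    then show ?thesis by (simp add: L[OF char])
  qed
  moreover have "invertible (fc P d (\<lambda>\<nu>. exp \<nu> ^ k) ** U s)"
    by (intro invertible_mult fc_invertible[OF P] poly_group_invertible[OF U]) simp
  ultimately show ?thesis unfolding S(2) by blast
qed

text \<open>The choice \<open>y(\<nu>) = exp(t \<psi>(\<nu>))\<close> with \<open>\<psi>\<close> additive gives Chevalley's replicas.\<close>

lemma closed_contains_replicas: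
  fixes P :: "complex^'n^'n"
  assumes Z: "closedin zariski Z" and P: "invertible P" and U: "poly_group U"
    and mem: "\<And>t. fc P d (\<lambda>\<nu>. exp (t * \<nu>)) ** U t \<in> Z"
    and y: "additive_char y"
  shows "fc P d y ** U s \<in> Z"
proof -
  obtain S where S: "S \<subseteq> GL_regular" "Z = {A. invertible A \<and> (\<forall>f\<in>S. f A = 0)}"
    using Z unfolding closedin_zariski by blast
  have "f (fc P d y ** U s) = 0" if "f \<in> S" for f
  proof -
    have "expandable (\<lambda>y s. f (fc P d y ** U s))"
      using regular_expandable[OF P U] S(1) that by blast
    then obtain L where L: "\<And>y s. additive_char y \<Longrightarrow> f (fc P d y ** U s) = ev L y s"
      unfolding expandable_def by blast
    have "ev L (\<lambda>\<nu>. exp (t * \<nu>)) t = 0" for t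
      using mem[of t] that
      unfolding L[OF additive_char_exp[of "\<lambda>\<nu>. \<nu>", OF refl], symmetric] S(2) by blast
    then have "ev L y s = 0" by (rule ev_zero_exp)
    then show ?thesis by (simp add: L[OF y])
  qed
  moreover have "invertible (fc P d y ** U s)"
    by (intro invertible_mult fc_invertible[OF P] poly_group_invertible[OF U] additive_char_nonzero[OF y])
  ultimately show ?thesis unfolding S(2) by blast
qed

section \<open>Groups, tangent vectors and integral curves\<close>

lemma inv_GL:
  assumes "invertible A"
  shows "inv\<^bsub>GL\<^esub> A = matrix_inv A"
proof -
  have "B = matrix_inv A" if "A ** B = mat 1" for B
    using matrix_inv_unique_left[OF that] by simp
  then show ?thesis
    unfolding m_inv_def using assms invertible_matrix_inv[OF assms]
    by (intro the_equality) (auto simp: GL_def)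
qed

lemma algebraic_groupD:
  assumes "algebraic_group G"
  shows "mat 1 \<in> G" "A \<in> G \<Longrightarrow> invertible A" "A \<in> G \<Longrightarrow> B \<in> G \<Longrightarrow> A ** B \<in> G"
    "A \<in> G \<Longrightarrow> matrix_inv A \<in> G" "closedin zariski G"
proof -
  have sub: "subgroup G GL" and cl: "closedin zariski G"
    using assms unfolding algebraic_group_def by auto
  show "closedin zariski G" by (rule cl)
  show "mat 1 \<in> G" using subgroup.one_closed[OF sub] by (simp add: GL_def)
  show "A \<in> G \<Longrightarrow> B \<in> G \<Longrightarrow> A ** B \<in> G" using subgroup.m_closed[OF sub] by (simp add: GL_def)
  show inv: "invertible A" if "A \<in> G" for A
    using subgroup.subset[OF sub] that by (auto simp: GL_def)
  show "matrix_inv A \<in> G" if "A \<in> G"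
    using subgroup.m_inv_closed[OF sub that] inv_GL[OF inv[OF that]] by simp
qed

lemma algebraic_group_mpow: "algebraic_group G \<Longrightarrow> A \<in> G \<Longrightarrow> mpow A k \<in> G"
  by (induction k) (simp_all add: algebraic_groupD)

lemma lie_algebraD:
  assumes "X \<in> lie_algebra G" "f \<in> GL_regular" "\<And>A. A \<in> G \<Longrightarrow> f A = 0"
  shows "deriv_at_one f X = 0"
  using assms unfolding lie_algebra_def by simp

lemma lie_algebraI:
  assumes "\<And>t. \<gamma> t \<in> G" "mderiv \<gamma> X 0" "\<gamma> 0 = mat 1"
  shows "X \<in> lie_algebra G"
  unfolding lie_algebra_def
proof (intro CollectI ballI impI)
  fix f assume f: "f \<in> GL_regular" "\<forall>A\<in>G. f A = 0"
  have "((\<lambda>s. f (\<gamma> s)) has_field_derivative deriv_at_one f X) (at 0)"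
    by (rule deriv_at_one_curve[OF f(1) assms(2,3)])
  moreover have "(\<lambda>s. f (\<gamma> s)) = (\<lambda>s. 0)" using f(2) assms(1) by auto
  ultimately show "deriv_at_one f X = 0" using DERIV_unique[OF _ DERIV_const] by metis
qed

text \<open>The left-invariant vector field of \<open>X\<close> preserves the ideal of \<open>G\<close>, so all derivatives at
  \<open>0\<close> of \<open>f \<circ> \<gamma>\<close> vanish if \<open>f\<close> vanishes on \<open>G\<close>.\<close>

lemma lie_algebra_integral_curve:
  assumes G: "algebraic_group G" and X: "X \<in> lie_algebra G"
    and \<gamma>: "\<And>t. mderiv \<gamma> (\<gamma> t ** X) t" "\<gamma> 0 = mat 1" "\<And>t. invertible (\<gamma> t)"
  shows "\<gamma> t \<in> G"
proof -
  define I where "I = {f \<in> GL_regular. \<forall>A\<in>G. f A = 0}"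
  have step: "\<exists>g\<in>I. \<forall>t. ((\<lambda>s. f (\<gamma> s)) has_field_derivative g (\<gamma> t)) (at t)" if f: "f \<in> I" for f
  proof -
    obtain D where D: "regular_grad f D" using GL_regular_grad f unfolding I_def by blast
    define g where "g A = (\<Sum>i\<in>UNIV. \<Sum>j\<in>UNIV. D i j A * (A ** X) $ i $ j)" for A
    have "g \<in> GL_regular"
      unfolding g_def[abs_def] matrix_mul_nth
      by (intro GL_regular_sum GL_regular.mult GL_regular.const GL_regular.entry)
         (use D in \<open>simp add: regular_grad_def\<close>)
    \<comment> \<open>\<open>g A\<close> is the derivative at \<open>B = 1\<close> in direction
      \<open>X\<close> of the translate \<open>f (A ** B)\<close>, and this translate vanishes on
      the group.\<close>
    moreover have "g A = 0" if A: "A \<in> G" for A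
    proof -
      have "deriv_at_one (\<lambda>B. f (A ** B)) X = 0"
        by (rule lie_algebraD[OF X])
           (use f algebraic_groupD(3)[OF G A] GL_regular_translate[of f A "mat 1"] in \<open>auto simp: I_def\<close>)
      moreover have "((\<lambda>s. f (A ** (mat 1 + cscale s X))) has_field_derivative g A) (at 0)"
        using regular_gradD[OF D mderiv_mult_left[OF mderiv_line[of "mat 1" X 0]], of A] algebraic_groupD(2)[OF G A]
        by (simp add: g_def)
      ultimately show ?thesis unfolding deriv_at_one_def by (simp add: DERIV_imp_deriv)
    qed
    moreover have "((\<lambda>s. f (\<gamma> s)) has_field_derivative g (\<gamma> t)) (at t)" for t
      unfolding g_def by (rule regular_gradD[OF D \<gamma>(1) \<gamma>(3)])
    ultimately show ?thesis by (auto simp: I_def)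
  qed
  have der: "\<exists>g\<in>I. \<forall>t. (deriv ^^ n) (\<lambda>s. f (\<gamma> s)) t = g (\<gamma> t)" if f: "f \<in> I" for f n
  proof (induction n)
    case 0
    show ?case using f by auto
  next
    case (Suc n)
    then obtain g where g: "g \<in> I" "(deriv ^^ n) (\<lambda>s. f (\<gamma> s)) = (\<lambda>s. g (\<gamma> s))" by auto
    obtain h where "h \<in> I" "\<And>t. ((\<lambda>s. g (\<gamma> s)) has_field_derivative h (\<gamma> t)) (at t)"
      using step[OF g(1)] by blast
    then show ?case by (intro bexI[of _ h]) (simp_all add: g(2) DERIV_imp_deriv)
  qed
  have der0: "(deriv ^^ n) (\<lambda>s. f (\<gamma> s)) 0 = 0" if f: "f \<in> I" for f n
  proof -
    obtain g where "g \<in> I" "(deriv ^^ n) (\<lambda>s. f (\<gamma> s)) 0 = g (\<gamma> 0)" using der[OF f] by blast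
    then show ?thesis using algebraic_groupD(1)[OF G] by (simp add: \<gamma>(2) I_def)
  qed
  have "f (\<gamma> t) = 0" if f: "f \<in> I" for f
  proof -
    have "(\<lambda>s. f (\<gamma> s)) holomorphic_on UNIV"
      using step[OF f] unfolding holomorphic_on_def field_differentiable_def by auto
    then show ?thesis
      by (rule holomorphic_fun_eq_0_on_connected[where S = UNIV and z = 0]) (use der0[OF f] in auto)
  qed
  moreover obtain S where "S \<subseteq> GL_regular" "G = {A. invertible A \<and> (\<forall>f\<in>S. f A = 0)}"
    using algebraic_groupD(5)[OF G] unfolding closedin_zariski by blast
  ultimately show ?thesis using \<gamma>(3) unfolding I_def by blast
qed

lemma mderiv_fc_exp:
  assumes P: "invertible P"
  shows "mderiv (\<lambda>t. fc P d (\<lambda>\<nu>. exp (t * \<psi> \<nu>))) (fc P d (\<lambda>\<nu>. exp (t * \<psi> \<nu>)) ** fc P d \<psi>) t"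
  unfolding mderiv_def fc_mult[OF P] fc_nth
proof (intro allI DERIV_sum DERIV_cmult_right DERIV_cmult)
  fix k
  show "((\<lambda>t. exp (t * \<psi> (d k))) has_field_derivative exp (t * \<psi> (d k)) * \<psi> (d k)) (at t)"
    by (auto intro!: derivative_eq_intros)
qed

text \<open>The product of \<open>exp(t S)\<close> and \<open>U t = exp(t N)\<close> solves
  \<open>\<gamma>' = \<gamma> X\<close>, so it stays in \<open>G\<close>. Then the character
  \<open>exp (t * \<nu>)\<close> may be exchanged for any other, independently of the parameter of
  \<open>U\<close>.\<close>

lemma lie_algebra_replicas:
  fixes X :: "complex^'n^'n"
  assumes G: "algebraic_group G" and X: "X \<in> lie_algebra G"
  obtains P d N U where "invertible P" "X = fc P d (\<lambda>z. z) + N" "nilpotent_mat N"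
    "fc P d (\<lambda>z. z) ** N = N ** fc P d (\<lambda>z. z)" "poly_group U" "mderiv U N 0"
    "\<And>M t. M ** N = N ** M \<Longrightarrow> M ** U t = U t ** M"
    "\<And>y s. additive_char y \<Longrightarrow> fc P d y ** U s \<in> G"
proof -
  obtain S N where "add_jordan_decomposition X S N" by (rule add_jordan_exists)
  then obtain P d where P: "invertible P" "S = fc P d (\<lambda>z. z)"
    and N: "nilpotent_mat N" "S ** N = N ** S" "X = S + N"
    unfolding add_jordan_decomposition_def semisimple_mat_iff by blast
  obtain U where U: "poly_group U" "mderiv U N 0" "\<And>M t. M ** N = N ** M \<Longrightarrow> M ** U t = U t ** M"
    using nilpotent_exp[OF N(1)] by metis
  define \<gamma> where "\<gamma> t = fc P d (\<lambda>\<nu>. exp (t * \<nu>)) ** U t" for t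
  have "N ** fc P d y = fc P d y ** N" for y
    by (rule commute_fc[OF P(1)]) (use N(2) P(2) in simp)
  then have Ucomm: "fc P d y ** U t = U t ** fc P d y" for y t
    using U(3) by metis
  have "mderiv \<gamma> (\<gamma> t ** X) t" for t
  proof -
    obtain N' where N': "\<And>t. mderiv U (U t ** N') t" using poly_group_mderiv[OF U(1)] by metis
    have "N' = N" using mderiv_unique[OF N'[of 0] U(2)] poly_groupD(1)[OF U(1)] by simp
    have "mderiv \<gamma> (fc P d (\<lambda>\<nu>. exp (t * \<nu>)) ** S ** U t + fc P d (\<lambda>\<nu>. exp (t * \<nu>)) ** (U t ** N)) t"
      unfolding \<gamma>_def[abs_def] P(2)
      by (rule mderiv_mult) (use mderiv_fc_exp[OF P(1), of d "\<lambda>z. z" t] N'[of t] \<open>N' = N\<close> in simp_all)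
    moreover have "fc P d (\<lambda>\<nu>. exp (t * \<nu>)) ** S ** U t = \<gamma> t ** S"
      unfolding P(2) \<gamma>_def by (simp only: Ucomm[of "\<lambda>z. z"] flip: matrix_mul_assoc)
    ultimately show ?thesis by (simp add: N(3) mat_distribs \<gamma>_def matrix_mul_assoc)
  qed
  moreover have "\<gamma> 0 = mat 1" by (simp add: \<gamma>_def fc_one[OF P(1)] poly_groupD(1)[OF U(1)])
  moreover have "invertible (\<gamma> t)" for t
    unfolding \<gamma>_def by (intro invertible_mult fc_invertible[OF P(1)] poly_group_invertible[OF U(1)]) simp
  ultimately have "\<gamma> t \<in> G" for t by (rule lie_algebra_integral_curve[OF G X])
  then have "fc P d y ** U s \<in> G" if "additive_char y" for y s
    unfolding \<gamma>_def by (rule closed_contains_replicas[OF algebraic_groupD(5)[OF G] P(1) U(1) _ that])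
  with P N U show thesis by (intro that[of P d N U]) auto
qed

text \<open>\<open>a^m = s^m U(m)\<close> puts the pairs \<open>(m, m)\<close> into
  \<open>Z\<close>. The set is only assumed closed and to contain the powers of \<open>a\<close>, so
  that the lemma serves \<open>G\<close> as well as \<open>trace_kernel G\<close>.\<close>

lemma mult_jordan_parts:
  fixes a :: "complex^'n^'n"
  assumes Z: "closedin zariski Z" and jd: "mult_jordan_decomposition a s u"
    and inv: "invertible a" and mem: "\<And>m. mpow a m \<in> Z"
  obtains U where "s \<in> Z" "poly_group U" "U 1 = u"
    "\<And>M t. M ** u = u ** M \<Longrightarrow> M ** U t = U t ** M" "\<And>t. U t \<in> Z"
proof -
  obtain P c where P: "invertible P" "s = fc P c (\<lambda>z. z)"
    using jd unfolding mult_jordan_decomposition_def semisimple_mat_iff by blast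
  have a: "a = s ** u" "s ** u = u ** s" "unipotent_mat u"
    using jd unfolding mult_jordan_decomposition_def by auto
  obtain U where U: "poly_group U" "U 1 = u" "\<And>M t. M ** u = u ** M \<Longrightarrow> M ** U t = U t ** M"
    using unipotent_powers[OF a(3)] by metis
  have "det s \<noteq> 0"
    using inv unfolding a(1) by (auto simp: invertible_det_nz det_mul)
  then have "c i \<noteq> 0" for i by (auto simp: P(2) det_fc[OF P(1)])
  \<comment> \<open>The eigenvalues are nonzero and have logarithms, which brings \<open>s\<close>
    into exponential form; only \<open>exp (d i) = c i\<close> is used.\<close>
  define d where "d i = Ln (c i)" for i
  have fcd: "fc P d (\<lambda>\<nu>. g (exp \<nu>)) = fc P c g" for g
    by (simp add: fc_def d_def \<open>\<And>i. c i \<noteq> 0\<close>)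
  have pow: "fc P d (\<lambda>\<nu>. exp \<nu> ^ m) = mpow s m" for m
  proof -
    have "fc P c (\<lambda>z. z ^ m) = mpow s m"
      by (induction m) (simp_all add: fc_one[OF P(1)] P(2) flip: fc_mult[OF P(1)])
    then show ?thesis using fcd[of "\<lambda>z. z ^ m"] by simp
  qed
  have "fc P d (\<lambda>\<nu>. exp \<nu> ^ m) ** U (of_nat m) \<in> Z" for m :: nat
    using mem[of m] mpow_mult[OF a(2)] poly_group_mpow[OF U(1), of m 1]
    by (simp add: pow U(2) a(1))
  then have *: "fc P d (\<lambda>\<nu>. exp \<nu> ^ k) ** U t \<in> Z" for k t
    by (rule closed_contains_power_parts[OF Z P(1) U(1)])
  show thesis
  proof (rule that[OF _ U])
    show "s \<in> Z" using *[of 1 0] by (simp only: pow poly_groupD(1)[OF U(1)]) simp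
    show "U t \<in> Z" for t using *[of 0 t] by (simp add: fc_one[OF P(1)])
  qed
qed

section \<open>The Lie algebra of an algebraic group\<close>

lemma deriv_at_one_linear:
  assumes "f \<in> GL_regular"
  shows "deriv_at_one f (X + Y) = deriv_at_one f X + deriv_at_one f Y"
    "deriv_at_one f (cscale c X) = c * deriv_at_one f X"
proof -
  obtain D where D: "regular_grad f D" using GL_regular_grad[OF assms] by blast
  show "deriv_at_one f (X + Y) = deriv_at_one f X + deriv_at_one f Y"
    by (simp add: deriv_at_one_eq[OF D] distrib_left sum.distrib)
  show "deriv_at_one f (cscale c X) = c * deriv_at_one f X"
    by (simp add: deriv_at_one_eq[OF D] sum_distrib_left mult.left_commute)
qed

lemma subspace_lie_algebra: "cmat.subspace (lie_algebra G)"
proof (rule cmat.subspaceI)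
  show "0 \<in> lie_algebra G"
    unfolding lie_algebra_def using deriv_at_one_linear(2)[where c = 0 and X = 0] by auto
qed (auto simp: lie_algebra_def deriv_at_one_linear)

lemmas lie_algebra_add = cmat.subspace_add[OF subspace_lie_algebra]
  and lie_algebra_diff = cmat.subspace_diff[OF subspace_lie_algebra]
  and lie_algebra_cscale = cmat.subspace_scale[OF subspace_lie_algebra]
  and lie_algebra_zero = cmat.subspace_0[OF subspace_lie_algebra]

lemma Ad_lie_algebra:
  assumes G: "algebraic_group G" and b: "b \<in> G" and X: "X \<in> lie_algebra G"
  shows "Ad b X \<in> lie_algebra G"
  unfolding lie_algebra_def
proof (intro CollectI ballI impI)
  fix f assume f: "f \<in> GL_regular" "\<forall>A\<in>G. f A = 0"
  have "(\<lambda>B. f (b ** B ** matrix_inv b)) \<in> GL_regular"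
    by (rule GL_regular_translate[OF f(1)])
  then have "deriv_at_one (\<lambda>B. f (b ** B ** matrix_inv b)) X = 0"
    by (rule lie_algebraD[OF X]) (use f(2) b algebraic_groupD[OF G] in simp)
  moreover have "b ** (mat 1 + cscale t X) ** matrix_inv b = mat 1 + cscale t (Ad b X)" for t
    using algebraic_groupD(2)[OF G b] by (simp add: Ad_def mat_distribs)
  ultimately show "deriv_at_one f (Ad b X) = 0" by (simp add: deriv_at_one_def)
qed

lemma semisimple_zero: "semisimple_mat 0"
proof -
  have "fc (mat 1) (\<lambda>i. 0) (\<lambda>z. z) = (0 :: complex^'a^'a)"
    using fc_cong[of "\<lambda>z. z" "\<lambda>i. 0" "\<lambda>z. 0" "mat 1"] by (simp add: fc_zero)
  moreover have "invertible (mat 1 :: complex^'a^'a)" by (rule invertibleI[of _ "mat 1"]) simp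
  ultimately show ?thesis unfolding semisimple_mat_iff by metis
qed

text \<open>This is \<open>exp(t X)\<close>, as the product of the exponentials of the two Jordan
  parts.\<close>

lemma lie_algebra_one_parameter:
  fixes X :: "complex^'n^'n"
  assumes G: "algebraic_group G" and X: "X \<in> lie_algebra G"
  obtains \<gamma> where "\<And>t. \<gamma> t \<in> G" "\<gamma> 0 = mat 1" "mderiv \<gamma> X 0" "\<And>t. matrix_inv (\<gamma> t) = \<gamma> (- t)"
    "\<And>M t. X ** M = M ** X \<Longrightarrow> \<gamma> t ** M = M ** \<gamma> t"
proof -
  obtain P d N U where P: "invertible P" and N: "X = fc P d (\<lambda>z. z) + N" "nilpotent_mat N"
    "fc P d (\<lambda>z. z) ** N = N ** fc P d (\<lambda>z. z)"
    and U: "poly_group U" "mderiv U N 0" "\<And>M t. M ** N = N ** M \<Longrightarrow> M ** U t = U t ** M"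
    and mem: "\<And>y s. additive_char y \<Longrightarrow> fc P d y ** U s \<in> G"
    using lie_algebra_replicas[OF G X] by metis
  define E where "E t = fc P d (\<lambda>\<nu>. exp (t * \<nu>))" for t
  define \<gamma> where "\<gamma> t = E t ** U t" for t
  have EE: "E t ** E (- t) = mat 1" for t
    by (simp add: E_def fc_mult[OF P] fc_one[OF P] flip: exp_add)
  have "N ** E t = E t ** N" for t
    unfolding E_def by (rule commute_fc[OF P]) (simp add: N(3))
  then have EU: "E t ** U s = U s ** E t" for s t by (simp add: U(3))
  show thesis
  proof (rule that[of \<gamma>])
    show "\<gamma> t \<in> G" for t
      unfolding \<gamma>_def E_def by (intro mem additive_char_exp) simp
    show "\<gamma> 0 = mat 1"
      by (simp add: \<gamma>_def E_def fc_one[OF P] poly_groupD(1)[OF U(1)])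
    have "mderiv \<gamma> ((E 0 ** fc P d (\<lambda>z. z)) ** U 0 + E 0 ** N) 0"
      unfolding \<gamma>_def[abs_def] E_def by (intro mderiv_mult mderiv_fc_exp[OF P] U(2))
    then show "mderiv \<gamma> X 0"
      by (simp add: E_def fc_one[OF P] poly_groupD(1)[OF U(1)] N(1))
    show "matrix_inv (\<gamma> t) = \<gamma> (- t)" for t
    proof (rule matrix_inv_unique_left)
      have "\<gamma> t ** \<gamma> (- t) = E t ** (U t ** E (- t)) ** U (- t)"
        by (simp add: \<gamma>_def matrix_mul_assoc)
      also have "\<dots> = (E t ** E (- t)) ** (U t ** U (- t))"
        by (simp only: EU[symmetric] matrix_mul_assoc)
      finally show "\<gamma> t ** \<gamma> (- t) = mat 1" by (simp add: EE poly_groupD(3)[OF U(1)])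
    qed
    fix M t assume M: "X ** M = M ** X"
    have fcM: "fc P d g ** M = M ** fc P d g" for g
      by (rule commute_jordan_fc[OF P N(2,3)]) (use M N(1) in simp)
    then have "N ** M = M ** N"
      using M fcM[of "\<lambda>z. z"] by (simp add: N(1) mat_distribs)
    then have "U t ** M = M ** U t" using U(3)[of M t] by simp
    then show "\<gamma> t ** M = M ** \<gamma> t"
      unfolding \<gamma>_def E_def by (metis fcM matrix_mul_assoc)
  qed
qed

lemma mderiv_Ad:
  assumes "mderiv \<gamma> X 0" "\<gamma> 0 = mat 1" "\<And>t. matrix_inv (\<gamma> t) = \<gamma> (- t)"
  shows "mderiv (\<lambda>t. Ad (\<gamma> t) Y) (bracket X Y) 0"
proof -
  have "mderiv (\<lambda>t. \<gamma> t ** Y) (X ** Y) 0" by (rule mderiv_mult_right[OF assms(1)])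
  moreover have "mderiv (\<lambda>t. \<gamma> (- t)) (- X) 0" by (rule mderiv_minus) (simp add: assms(1))
  ultimately have "mderiv (\<lambda>t. \<gamma> t ** Y ** \<gamma> (- t)) (X ** Y ** \<gamma> (- 0) + \<gamma> 0 ** Y ** (- X)) 0"
    by (rule mderiv_mult)
  then show ?thesis by (simp add: Ad_def assms bracket_def)
qed

text \<open>A linear map given by a coefficient array: linearity and differentiation along curves
  are then immediate on all matrices, not only on tangent vectors.\<close>

definition coord_map ::
  "('m \<Rightarrow> 'm \<Rightarrow> 'n \<Rightarrow> 'n \<Rightarrow> complex) \<Rightarrow> complex^'n^'n \<Rightarrow> complex^'m^'m" where
  "coord_map c X = (\<chi> i j. \<Sum>k\<in>UNIV. \<Sum>l\<in>UNIV. c i j k l * X $ k $ l)"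

lemma coord_map_linear:
  "coord_map c (X + Y) = coord_map c X + coord_map c Y"
  "coord_map c (cscale z X) = cscale z (coord_map c X)"
  by (simp_all add: coord_map_def vec_eq_iff distrib_left sum.distrib sum_distrib_left mult.left_commute)

lemma mderiv_coord_map: "mderiv \<gamma> Y t \<Longrightarrow> mderiv (\<lambda>s. coord_map c (\<gamma> s)) (coord_map c Y) t"
  unfolding mderiv_def coord_map_def vec_lambda_beta by (intro allI DERIV_sum DERIV_cmult) blast

text \<open>For \<open>f\<close> in the ideal of \<open>G\<close>, \<open>deriv_at_one f\<close> is
  linear and vanishes along the curve \<open>Ad (\<gamma> t) Y\<close> in the Lie algebra, hence on
  its velocity.\<close>

lemma bracket_lie_algebra:
  assumes G: "algebraic_group G" and X: "X \<in> lie_algebra G" and Y: "Y \<in> lie_algebra G"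
  shows "bracket X Y \<in> lie_algebra G"
  unfolding lie_algebra_def
proof (intro CollectI ballI impI)
  fix f assume f: "f \<in> GL_regular" "\<forall>A\<in>G. f A = 0"
  obtain \<gamma> where \<gamma>: "\<And>t. \<gamma> t \<in> G" "\<gamma> 0 = mat 1" "mderiv \<gamma> X 0" "\<And>t. matrix_inv (\<gamma> t) = \<gamma> (- t)"
    using lie_algebra_one_parameter[OF G X] by metis
  obtain D where D: "regular_grad f D" using GL_regular_grad[OF f(1)] by blast
  have "deriv_at_one f (Ad (\<gamma> t) Y) = 0" for t
    using lie_algebraD[OF Ad_lie_algebra[OF G \<gamma>(1) Y] f(1)] f(2) by blast
  moreover have "((\<lambda>t. deriv_at_one f (Ad (\<gamma> t) Y)) has_field_derivative deriv_at_one f (bracket X Y)) (at 0)"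
    unfolding deriv_at_one_eq[OF D]
    using mderiv_Ad[OF \<gamma>(3,2,4), of Y] unfolding mderiv_def by (intro DERIV_sum DERIV_cmult) blast
  ultimately show "deriv_at_one f (bracket X Y) = 0"
    using DERIV_unique[OF _ DERIV_const] by simp
qed

lemma invertible_mat_1: "invertible (mat 1 :: complex^'n^'n)"
  by (rule invertibleI[of _ "mat 1"]) simp

text \<open>Special case of the expansion: zero exponents and the trivial character leave only the
  polynomial coefficients.\<close>

lemma poly_group_regular:
  fixes U :: "complex \<Rightarrow> complex^'n^'n"
  assumes U: "poly_group U" and f: "f \<in> GL_regular"
  shows "\<exists>p. \<forall>t. f (U t) = poly p t"
proof -
  have "expandable (\<lambda>y s. f (fc (mat 1) (\<lambda>_. 0) y ** U s))"
    by (rule regular_expandable[OF invertible_mat_1 U f])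
  then obtain M where "\<And>y s. additive_char y \<Longrightarrow> f (fc (mat 1) (\<lambda>_. 0) y ** U s) = ev M y s"
    unfolding expandable_def by blast
  from this[of "\<lambda>_. 1"] have "f (U t) = ev M (\<lambda>_. 1) t" for t
    by (simp add: additive_char_def fc_one[OF invertible_mat_1])
  moreover have "ev M (\<lambda>_. 1) t = poly (\<Sum>(p, \<nu>)\<leftarrow>M. p) t" for t
    by (induction M) auto
  ultimately show ?thesis by metis
qed

section \<open>Rational representations\<close>

locale faithful_rep =
  fixes G :: "(complex^'n^'n) set" and \<pi> :: "complex^'n^'n \<Rightarrow> complex^'m^'m"
  assumes G: "algebraic_group G" and \<pi>: "rational_rep G \<pi>"
    and faithful: "infinitesimally_faithful G \<pi>"
begin

abbreviation "\<gg> \<equiv> lie_algebra G"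

lemmas one_mem = algebraic_groupD(1)[OF G]
  and inv_mem = algebraic_groupD(2)[OF G]
  and mult_mem = algebraic_groupD(3)[OF G]
  and minv_mem = algebraic_groupD(4)[OF G]

lemma pi_mult: "A \<in> G \<Longrightarrow> B \<in> G \<Longrightarrow> \<pi> (A ** B) = \<pi> A ** \<pi> B"
  using \<pi> by (auto simp: rational_rep_def hom_def GL_def)

lemma pi_invertible: "A \<in> G \<Longrightarrow> invertible (\<pi> A)"
  using \<pi> by (auto simp: rational_rep_def hom_def GL_def)

lemma pi_one: "\<pi> (mat 1) = mat 1"
proof -
  have "\<pi> (mat 1) ** \<pi> (mat 1) = \<pi> (mat 1)" using pi_mult[OF one_mem one_mem] by simp
  then show ?thesis using pi_invertible[OF one_mem] by (metis matrix_inv_cancel(2) matrix_inv_right)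
qed

lemma pi_inv: "A \<in> G \<Longrightarrow> \<pi> (matrix_inv A) = matrix_inv (\<pi> A)"
  using pi_mult[of A "matrix_inv A"] minv_mem inv_mem pi_one
  by (intro matrix_inv_unique_left[symmetric]) simp

text \<open>Two regular extensions agree along a curve in \<open>G\<close> tangent to
  \<open>X\<close>, hence have the same derivative there; this makes the description in
  \<open>differential\<close> unique.\<close>

lemma exists_differential:
  obtains c where
    "\<And>X. X \<in> \<gg> \<Longrightarrow> differential G \<pi> X = coord_map c X"
    "\<And>\<gamma> X. (\<And>t. \<gamma> t \<in> G) \<Longrightarrow> mderiv \<gamma> X 0 \<Longrightarrow> \<gamma> 0 = mat 1 \<Longrightarrow> mderiv (\<lambda>t. \<pi> (\<gamma> t)) (coord_map c X) 0"
proof -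
  have "\<forall>i j. \<exists>f. regular_extension G (\<lambda>g. \<pi> g $ i $ j) f"
    using \<pi> unfolding rational_rep_def by blast
  then obtain f where f: "\<And>i j. regular_extension G (\<lambda>g. \<pi> g $ i $ j) (f i j)" by metis
  then have "\<forall>i j. \<exists>D. regular_grad (f i j) D"
    unfolding regular_extension_def using GL_regular_grad by metis
  then obtain D where D: "\<And>i j. regular_grad (f i j) (D i j)" by metis
  define c where "c i j k l = D i j k l (mat 1)" for i j k l
  have c: "coord_map c X $ i $ j = deriv_at_one (f i j) X" for X i j
    by (simp add: coord_map_def c_def deriv_at_one_eq[OF D])
  have curve: "((\<lambda>t. \<pi> (\<gamma> t) $ i $ j) has_field_derivative deriv_at_one h X) (at 0)"
    if "\<And>t. \<gamma> t \<in> G" "mderiv \<gamma> X 0" "\<gamma> 0 = mat 1" "regular_extension G (\<lambda>g. \<pi> g $ i $ j) h"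
    for \<gamma> X i j h
    using deriv_at_one_curve[of h \<gamma> X] that by (simp add: regular_extension_def)
  show thesis
  proof (rule that[of c])
    fix X assume X: "X \<in> \<gg>"
    obtain \<gamma> where \<gamma>: "\<And>t. \<gamma> t \<in> G" "mderiv \<gamma> X 0" "\<gamma> 0 = mat 1"
      using lie_algebra_one_parameter[OF G X] by metis
    have "(THE d. \<exists>h. regular_extension G (\<lambda>g. \<pi> g $ i $ j) h \<and> d = deriv_at_one h X) = deriv_at_one (f i j) X" for i j
    proof (rule the_equality)
      show "\<exists>h. regular_extension G (\<lambda>g. \<pi> g $ i $ j) h \<and> deriv_at_one (f i j) X = deriv_at_one h X"
        using f by blast
    next
      fix d assume "\<exists>h. regular_extension G (\<lambda>g. \<pi> g $ i $ j) h \<and> d = deriv_at_one h X"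
      then obtain h where h: "regular_extension G (\<lambda>g. \<pi> g $ i $ j) h" "d = deriv_at_one h X" by blast
      show "d = deriv_at_one (f i j) X"
        unfolding h(2) by (rule DERIV_unique[OF curve[OF \<gamma> h(1)] curve[OF \<gamma> f]])
    qed
    then show "differential G \<pi> X = coord_map c X"
      by (simp add: vec_eq_iff differential_def c)
  next
    fix \<gamma> X assume "\<And>t. \<gamma> t \<in> G" "mderiv \<gamma> X 0" "\<gamma> 0 = mat 1"
    then show "mderiv (\<lambda>t. \<pi> (\<gamma> t)) (coord_map c X) 0"
      using curve[OF _ _ _ f] unfolding mderiv_def[of "\<lambda>t. \<pi> (\<gamma> t)"] c by blast
  qed
qed

definition coords where
  "coords = (SOME c. (\<forall>X\<in>\<gg>. differential G \<pi> X = coord_map c X) \<and>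
    (\<forall>\<gamma> X. (\<forall>t. \<gamma> t \<in> G) \<longrightarrow> mderiv \<gamma> X 0 \<longrightarrow> \<gamma> 0 = mat 1 \<longrightarrow> mderiv (\<lambda>t. \<pi> (\<gamma> t)) (coord_map c X) 0))"

text \<open>A linear extension of the differential to all matrices.\<close>

definition L :: "complex^'n^'n \<Rightarrow> complex^'m^'m" where
  "L = coord_map coords"

lemma L_differential: "X \<in> \<gg> \<Longrightarrow> differential G \<pi> X = L X"
  and L_curve: "(\<And>t. \<gamma> t \<in> G) \<Longrightarrow> mderiv \<gamma> X 0 \<Longrightarrow> \<gamma> 0 = mat 1 \<Longrightarrow> mderiv (\<lambda>t. \<pi> (\<gamma> t)) (L X) 0"
proof -
  have "\<exists>c. (\<forall>X\<in>\<gg>. differential G \<pi> X = coord_map c X) \<and>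
    (\<forall>\<gamma> X. (\<forall>t. \<gamma> t \<in> G) \<longrightarrow> mderiv \<gamma> X 0 \<longrightarrow> \<gamma> 0 = mat 1 \<longrightarrow> mderiv (\<lambda>t. \<pi> (\<gamma> t)) (coord_map c X) 0)"
    using exists_differential by metis
  then have *: "(\<forall>X\<in>\<gg>. differential G \<pi> X = L X) \<and>
    (\<forall>\<gamma> X. (\<forall>t. \<gamma> t \<in> G) \<longrightarrow> mderiv \<gamma> X 0 \<longrightarrow> \<gamma> 0 = mat 1 \<longrightarrow> mderiv (\<lambda>t. \<pi> (\<gamma> t)) (L X) 0)"
    unfolding L_def coords_def by (rule someI_ex)
  then show "X \<in> \<gg> \<Longrightarrow> differential G \<pi> X = L X"
    and "(\<And>t. \<gamma> t \<in> G) \<Longrightarrow> mderiv \<gamma> X 0 \<Longrightarrow> \<gamma> 0 = mat 1 \<Longrightarrow> mderiv (\<lambda>t. \<pi> (\<gamma> t)) (L X) 0"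
    by simp_all
qed

section \<open>Linearity and equivariance of the differential\<close>

lemma L_add: "L (X + Y) = L X + L Y"
  and L_cscale: "L (cscale c X) = cscale c (L X)"
  by (simp_all add: L_def coord_map_linear)

lemma L_zero: "L 0 = 0"
  using L_cscale[of 0 0] by simp

lemma L_diff: "L (X - Y) = L X - L Y"
  using L_add[of "X - Y" Y] by simp

lemma L_mderiv: "mderiv \<gamma> Y t \<Longrightarrow> mderiv (\<lambda>s. L (\<gamma> s)) (L Y) t"
  unfolding L_def by (rule mderiv_coord_map)

lemma L_eq_0: "X \<in> \<gg> \<Longrightarrow> L X = 0 \<Longrightarrow> X = 0"
  using inj_onD[OF faithful[unfolded infinitesimally_faithful_def], of X 0]
  by (simp add: L_differential lie_algebra_zero L_zero)

lemma L_Ad: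
  assumes b: "b \<in> G" and X: "X \<in> \<gg>"
  shows "L (Ad b X) = Ad (\<pi> b) (L X)"
proof -
  obtain \<gamma> where \<gamma>: "\<And>t. \<gamma> t \<in> G" "\<gamma> 0 = mat 1" "mderiv \<gamma> X 0"
    using lie_algebra_one_parameter[OF G X] by metis
  have 1: "mderiv (\<lambda>t. \<pi> (b ** \<gamma> t ** matrix_inv b)) (L (Ad b X)) 0"
  proof (rule L_curve)
    show "b ** \<gamma> t ** matrix_inv b \<in> G" for t
      by (intro mult_mem minv_mem b \<gamma>(1))
    show "mderiv (\<lambda>t. b ** \<gamma> t ** matrix_inv b) (Ad b X) 0"
      unfolding Ad_def by (intro mderiv_mult_right mderiv_mult_left \<gamma>(3))
    show "b ** \<gamma> 0 ** matrix_inv b = mat 1" by (simp add: \<gamma>(2) inv_mem[OF b])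
  qed
  have 2: "\<pi> (b ** \<gamma> t ** matrix_inv b) = \<pi> b ** \<pi> (\<gamma> t) ** matrix_inv (\<pi> b)" for t
    by (simp add: pi_mult mult_mem minv_mem b \<gamma>(1) pi_inv)
  have 3: "mderiv (\<lambda>t. \<pi> b ** \<pi> (\<gamma> t) ** matrix_inv (\<pi> b)) (Ad (\<pi> b) (L X)) 0"
    unfolding Ad_def by (intro mderiv_mult_right mderiv_mult_left L_curve \<gamma>)
  show ?thesis by (rule mderiv_unique[OF 1[unfolded 2] 3])
qed

lemma L_bracket:
  assumes X: "X \<in> \<gg>" and Y: "Y \<in> \<gg>"
  shows "L (bracket X Y) = bracket (L X) (L Y)"
proof -
  obtain \<gamma> where \<gamma>: "\<And>t. \<gamma> t \<in> G" "\<gamma> 0 = mat 1" "mderiv \<gamma> X 0" "\<And>t. matrix_inv (\<gamma> t) = \<gamma> (- t)"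
    using lie_algebra_one_parameter[OF G X] by metis
  have 1: "mderiv (\<lambda>t. L (Ad (\<gamma> t) Y)) (L (bracket X Y)) 0"
    by (intro L_mderiv mderiv_Ad \<gamma>)
  have 2: "mderiv (\<lambda>t. Ad (\<pi> (\<gamma> t)) (L Y)) (bracket (L X) (L Y)) 0"
    by (intro mderiv_Ad L_curve \<gamma>) (simp_all add: pi_one \<gamma>(1,2) \<gamma>(4)[symmetric] pi_inv)
  show ?thesis by (rule mderiv_unique[OF 1[unfolded L_Ad[OF \<gamma>(1) Y]] 2])
qed

lemma Ad_eq_iff:
  fixes b X :: "complex^'k^'k"
  assumes "invertible b"
  shows "Ad b X = X \<longleftrightarrow> b ** X = X ** b"
  unfolding Ad_def using assms by (metis matrix_inv_cancel(1) matrix_inv_cancel(2))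

lemma L_commute_pi:
  assumes b: "b \<in> G" and X: "X \<in> \<gg>" and "b ** X = X ** b"
  shows "\<pi> b ** L X = L X ** \<pi> b"
  using L_Ad[OF b X] assms(3) by (metis Ad_eq_iff inv_mem[OF b] pi_invertible[OF b])

lemma L_commute:
  assumes "X \<in> \<gg>" "Y \<in> \<gg>" "X ** Y = Y ** X"
  shows "L X ** L Y = L Y ** L X"
  using L_bracket[OF assms(1,2)] assms(3) by (simp add: bracket_def L_zero)

lemma pi_regular:
  obtains f where "\<And>i j. f i j \<in> GL_regular" "\<And>A i j. A \<in> G \<Longrightarrow> \<pi> A $ i $ j = f i j A"
proof -
  have "\<forall>i j. \<exists>f. f \<in> GL_regular \<and> (\<forall>A\<in>G. \<pi> A $ i $ j = f A)"
    using \<pi> unfolding rational_rep_def regular_extension_def by metis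
  then show thesis using that by metis
qed

lemma pi_poly_group:
  assumes U: "poly_group U" and mem: "\<And>t. U t \<in> G"
  shows "poly_group (\<lambda>t. \<pi> (U t))"
  unfolding poly_group_def
proof (intro conjI allI)
  show "\<pi> (U 0) = mat 1" by (simp add: poly_groupD(1)[OF U] pi_one)
  show "\<pi> (U (s + t)) = \<pi> (U s) ** \<pi> (U t)" for s t
    by (simp add: poly_groupD(2)[OF U] pi_mult mem)
  fix i j
  obtain f where f: "\<And>i j. f i j \<in> GL_regular" "\<And>A i j. A \<in> G \<Longrightarrow> \<pi> A $ i $ j = f i j A"
    using pi_regular by metis
  show "\<exists>p. \<forall>t. \<pi> (U t) $ i $ j = poly p t"
    using poly_group_regular[OF U f(1)] by (simp add: f(2)[OF mem])
qed

text \<open>Uniqueness of the Jordan decomposition identifies \<open>N\<close> with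
  \<open>X\<close>, and the trivial character removes the semisimple factor.\<close>

lemma nilpotent_curve:
  assumes X: "X \<in> \<gg>" "nilpotent_mat X"
  obtains U where "poly_group U" "mderiv U X 0" "\<And>t. U t \<in> G"
proof -
  obtain P d N U where P: "invertible P" and N: "X = fc P d (\<lambda>z. z) + N" "nilpotent_mat N"
    "fc P d (\<lambda>z. z) ** N = N ** fc P d (\<lambda>z. z)"
    and U: "poly_group U" "mderiv U N 0"
    and mem: "\<And>y s. additive_char y \<Longrightarrow> fc P d y ** U s \<in> G"
    using lie_algebra_replicas[OF G X(1)] by metis
  have "add_jordan_decomposition X (fc P d (\<lambda>z. z)) N"
    unfolding add_jordan_decomposition_def semisimple_mat_iff using P N by blast
  moreover have "add_jordan_decomposition X 0 X"
    unfolding add_jordan_decomposition_def using X(2) by (simp add: semisimple_zero)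
  ultimately have "N = X" using add_jordan_unique(2) by blast
  moreover have "U t \<in> G" for t
    using mem[of "\<lambda>_. 1" t] by (simp add: additive_char_def fc_one[OF P])
  ultimately show thesis using U by (intro that[of U]) auto
qed

text \<open>\<pi> preserves polynomial one-parameter groups, and their velocities are
  nilpotent.\<close>

lemma L_nilpotent:
  assumes "X \<in> \<gg>" "nilpotent_mat X"
  shows "nilpotent_mat (L X)"
proof -
  obtain U where U: "poly_group U" "mderiv U X 0" "\<And>t. U t \<in> G"
    using nilpotent_curve[OF assms] by metis
  have "mderiv (\<lambda>t. \<pi> (U t)) (L X) 0" by (intro L_curve U poly_groupD(1))
  then show ?thesis by (rule poly_group_nilpotent[OF pi_poly_group[OF U(1,3)]])
qed

lemma trace_nilpotent_commute:
  assumes "X \<in> \<gg>" "nilpotent_mat X" "Y \<in> \<gg>" "X ** Y = Y ** X"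
  shows "trace (L X ** L Y) = 0"
  by (intro trace_nilpotent nilpotent_mult_commute(1) L_nilpotent L_commute assms)

end

section \<open>Weights and the nilpotency criterion\<close>

lemma exp_independent:
  fixes m :: "complex \<Rightarrow> complex"
  assumes "finite A" "\<And>t. (\<Sum>\<nu>\<in>A. m \<nu> * exp (t * \<nu>)) = 0" "\<mu> \<in> A"
  shows "m \<mu> = 0"
proof -
  obtain xs where xs: "set xs = A" "distinct xs" using finite_distinct_list[OF assms(1)] by blast
  define M where "M = map (\<lambda>\<nu>. ([:m \<nu>:], \<nu>)) xs"
  have ev: "ev M y s = (\<Sum>\<nu>\<in>A. m \<nu> * y \<nu>)" for y s
    unfolding M_def ev_def xs(1)[symmetric] by (simp add: sum.distinct_set_conv_list[OF xs(2)] o_def)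
  \<comment> \<open>\<open>ev_zero_exp\<close> admits any function in place of a character, so the
    indicator of \<mu> isolates its coefficient.\<close>
  have "ev M (\<lambda>\<nu>. if \<nu> = \<mu> then 1 else 0) 0 = 0"
    by (rule ev_zero_exp) (simp add: ev assms(2))
  then show ?thesis using assms(1,3) by (simp add: ev mult_delta_right)
qed

context faithful_rep
begin

text \<open>The weight decomposition of \<open>\<pi>\<close> with respect to the torus of all \<open>P diag(y(d\<^sub>i)) P\<^sup>-\<^sup>1\<close>.\<close>

lemma weight_decomposition:
  assumes P: "invertible P" and mem: "\<And>y. additive_char y \<Longrightarrow> fc P d y \<in> G"
  obtains A C where "finite A" "\<forall>\<nu>\<in>A. \<forall>\<mu>\<in>A. C \<nu> ** C \<mu> = (if \<nu> = \<mu> then C \<mu> else 0)"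
    "\<forall>\<psi>. Modules.additive \<psi> \<longrightarrow> L (fc P d \<psi>) = (\<Sum>\<nu>\<in>A. cscale (\<psi> \<nu>) (C \<nu>))"
proof -
  obtain f where f: "\<And>i j. f i j \<in> GL_regular" "\<And>A i j. A \<in> G \<Longrightarrow> \<pi> A $ i $ j = f i j A"
    using pi_regular by metis
  have "\<exists>p. \<forall>t. (mat 1 :: complex^'n^'n) $ i $ j = poly p t" for i j
    by (rule exI[of _ "[:mat 1 $ i $ j:]"]) simp
  then have "poly_group (\<lambda>t. mat 1 :: complex^'n^'n)"
    unfolding poly_group_def by simp
  then have "\<forall>i j. expandable (\<lambda>y s. f i j (fc P d y ** mat 1))"
    using regular_expandable[OF P] f(1) by blast
  then obtain M where M: "\<And>i j y s. additive_char y \<Longrightarrow> f i j (fc P d y) = ev (M i j) y s"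
    unfolding expandable_def matrix_mul_rid by metis
  define A where "A = (\<Union>i j. snd ` set (M i j))"
  have A: "finite A" by (simp add: A_def)
  \<comment> \<open>The polynomial group is constant here, so the coefficient polynomials may be
    read at 0; \<open>C \<nu>\<close> turns out to be the projection onto the weight space of
    \<nu>.\<close>
  define C where "C \<nu> = (\<chi> i j. poly (\<Sum>(p, \<mu>)\<leftarrow>M i j. if \<mu> = \<nu> then p else 0) 0)" for \<nu>
  have Q: "\<pi> (fc P d y) = (\<Sum>\<nu>\<in>A. cscale (y \<nu>) (C \<nu>))" if y: "additive_char y" for y
  proof -
    have "\<pi> (fc P d y) $ i $ j = (\<Sum>\<nu>\<in>A. cscale (y \<nu>) (C \<nu>)) $ i $ j" for i j
    proof -
      have "\<pi> (fc P d y) $ i $ j = ev (M i j) (\<lambda>\<nu>. y ((\<lambda>\<nu>. \<nu>) \<nu>)) 0"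
        by (simp add: f(2)[OF mem[OF y]] M[OF y])
      also have "\<dots> = (\<Sum>\<nu>\<in>A. poly (\<Sum>(p, \<mu>)\<leftarrow>M i j. if \<mu> = \<nu> then p else 0) 0 * y \<nu>)"
        by (rule ev_group[OF A]) (auto simp: A_def)
      finally show ?thesis by (simp add: C_def mult.commute)
    qed
    then show ?thesis by (simp add: vec_eq_iff)
  qed
  have add: "additive_char (\<lambda>\<nu>. exp (t * \<nu>))" for t
    by (rule additive_char_exp) simp
  \<comment> \<open>\<pi> is multiplicative on the characters with parameters \<open>s\<close>,
    \<open>t\<close> and \<open>s + t\<close>. The identity is arranged as an exponential sum in
    \<open>t\<close>, so that coefficients can be compared first in \<open>t\<close> and then in
    \<open>s\<close>.\<close>
  have prod: "(\<Sum>\<mu>\<in>A. ((\<Sum>\<nu>\<in>A. exp (s * \<nu>) * (C \<nu> ** C \<mu>) $ i $ j) - exp (s * \<mu>) * C \<mu> $ i $ j) * exp (t * \<mu>)) = 0"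
    for s t i j
  proof -
    have "(\<Sum>\<nu>\<in>A. cscale (exp (s * \<nu>)) (C \<nu>)) ** (\<Sum>\<mu>\<in>A. cscale (exp (t * \<mu>)) (C \<mu>))
        = \<pi> (fc P d (\<lambda>\<nu>. exp (s * \<nu>)) ** fc P d (\<lambda>\<nu>. exp (t * \<nu>)))"
      by (simp add: Q[OF add] pi_mult[OF mem[OF add] mem[OF add]])
    also have "fc P d (\<lambda>\<nu>. exp (s * \<nu>)) ** fc P d (\<lambda>\<nu>. exp (t * \<nu>)) = fc P d (\<lambda>\<nu>. exp ((s + t) * \<nu>))"
      by (simp add: fc_mult[OF P] exp_add distrib_right)
    also have "\<pi> \<dots> = (\<Sum>\<mu>\<in>A. cscale (exp ((s + t) * \<mu>)) (C \<mu>))" by (rule Q[OF add])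
    finally have "((\<Sum>\<nu>\<in>A. cscale (exp (s * \<nu>)) (C \<nu>)) ** (\<Sum>\<mu>\<in>A. cscale (exp (t * \<mu>)) (C \<mu>))) $ i $ j
        = (\<Sum>\<mu>\<in>A. cscale (exp ((s + t) * \<mu>)) (C \<mu>)) $ i $ j" by simp
    moreover have "((\<Sum>\<nu>\<in>A. cscale (exp (s * \<nu>)) (C \<nu>)) ** (\<Sum>\<mu>\<in>A. cscale (exp (t * \<mu>)) (C \<mu>))) $ i $ j
        = (\<Sum>\<mu>\<in>A. (\<Sum>\<nu>\<in>A. exp (s * \<nu>) * (C \<nu> ** C \<mu>) $ i $ j) * exp (t * \<mu>))"
      by (subst matrix_sum_right) (simp add: matrix_sum_left mult.commute)
    moreover have "(\<Sum>\<mu>\<in>A. cscale (exp ((s + t) * \<mu>)) (C \<mu>)) $ i $ j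
        = (\<Sum>\<mu>\<in>A. exp (s * \<mu>) * C \<mu> $ i $ j * exp (t * \<mu>))"
      by (simp add: distrib_right exp_add) (simp add: mult_ac)
    ultimately have "(\<Sum>\<mu>\<in>A. (\<Sum>\<nu>\<in>A. exp (s * \<nu>) * (C \<nu> ** C \<mu>) $ i $ j) * exp (t * \<mu>))
        = (\<Sum>\<mu>\<in>A. exp (s * \<mu>) * C \<mu> $ i $ j * exp (t * \<mu>))"
      by (simp only:)
    then show ?thesis
      by (simp only: left_diff_distrib sum_subtractf) simp
  qed
  have idem: "C \<nu> ** C \<mu> = (if \<nu> = \<mu> then C \<mu> else 0)" if \<mu>\<nu>: "\<mu> \<in> A" "\<nu> \<in> A" for \<mu> \<nu>
  proof -
    have "(C \<nu> ** C \<mu>) $ i $ j - (if \<nu> = \<mu> then C \<mu> $ i $ j else 0) = 0" for i j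
    proof (rule exp_independent[OF A _ \<mu>\<nu>(2)])
      fix s
      have "(\<Sum>\<nu>\<in>A. exp (s * \<nu>) * (C \<nu> ** C \<mu>) $ i $ j) - exp (s * \<mu>) * C \<mu> $ i $ j = 0"
        by (rule exp_independent[OF A prod \<mu>\<nu>(1)])
      moreover have "(\<Sum>\<nu>\<in>A. ((C \<nu> ** C \<mu>) $ i $ j - (if \<nu> = \<mu> then C \<mu> $ i $ j else 0)) * exp (s * \<nu>))
          = (\<Sum>\<nu>\<in>A. exp (s * \<nu>) * (C \<nu> ** C \<mu>) $ i $ j) - (\<Sum>\<nu>\<in>A. if \<nu> = \<mu> then exp (s * \<mu>) * C \<mu> $ i $ j else 0)"
        unfolding sum_subtractf[symmetric] by (intro sum.cong refl) (auto simp: algebra_simps)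
      ultimately show "(\<Sum>\<nu>\<in>A. ((C \<nu> ** C \<mu>) $ i $ j - (if \<nu> = \<mu> then C \<mu> $ i $ j else 0)) * exp (s * \<nu>)) = 0"
        using A \<mu>\<nu>(1) by simp
    qed
    then show ?thesis by (simp add: vec_eq_iff)
  qed
  have der: "L (fc P d \<psi>) = (\<Sum>\<nu>\<in>A. cscale (\<psi> \<nu>) (C \<nu>))"
    if "Modules.additive \<psi>" for \<psi>
  proof -
    have \<psi>: "\<And>\<mu> \<nu>. \<psi> (\<mu> + \<nu>) = \<psi> \<mu> + \<psi> \<nu>" by (rule Modules.additive.add[OF that])
    define \<gamma> where "\<gamma> t = fc P d (\<lambda>\<nu>. exp (t * \<psi> \<nu>))" for t
    have "mderiv \<gamma> (fc P d \<psi>) 0"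
      unfolding \<gamma>_def[abs_def] using mderiv_fc_exp[OF P, of d \<psi> 0] by (simp add: fc_one[OF P])
    then have 1: "mderiv (\<lambda>t. \<pi> (\<gamma> t)) (L (fc P d \<psi>)) 0"
      by (rule L_curve[rotated]) (auto simp: \<gamma>_def fc_one[OF P] intro!: mem additive_char_exp \<psi>)
    have 2: "\<pi> (\<gamma> t) = (\<Sum>\<nu>\<in>A. cscale (exp (t * \<psi> \<nu>)) (C \<nu>))" for t
      unfolding \<gamma>_def by (rule Q) (rule additive_char_exp[OF \<psi>])
    have 3: "mderiv (\<lambda>t. \<Sum>\<nu>\<in>A. cscale (exp (t * \<psi> \<nu>)) (C \<nu>)) (\<Sum>\<nu>\<in>A. cscale (\<psi> \<nu>) (C \<nu>)) 0"
      unfolding mderiv_def sum_component cscale_nth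
    proof (intro allI DERIV_sum DERIV_cmult_right)
      fix \<nu>
      show "((\<lambda>t. exp (t * \<psi> \<nu>)) has_field_derivative \<psi> \<nu>) (at 0)"
        by (auto intro!: derivative_eq_intros)
    qed
    show ?thesis by (rule mderiv_unique[OF 1[unfolded 2] 3])
  qed
  show thesis by (rule that[of A C]) (simp_all add: A idem der)
qed

text \<open>The parts and replicas also lie in the bicommutant of \<open>X\<close>: these are the
  elements against which \<open>nilpotent_if_trace_zero\<close> assumes orthogonality.\<close>

lemma jordan_parts_lie_algebra:
  assumes X: "X \<in> \<gg>"
  obtains P d N where "invertible P" "add_jordan_decomposition X (fc P d (\<lambda>z. z)) N"
    "\<forall>\<psi>. Modules.additive \<psi> \<longrightarrow> fc P d \<psi> \<in> \<gg>" "N \<in> \<gg>"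
    "\<forall>y. additive_char y \<longrightarrow> fc P d y \<in> G"
    "\<forall>M. X ** M = M ** X \<longrightarrow> (\<forall>g. fc P d g ** M = M ** fc P d g) \<and> N ** M = M ** N"
proof -
  obtain P d N U where P: "invertible P" and N: "X = fc P d (\<lambda>z. z) + N" "nilpotent_mat N"
    "fc P d (\<lambda>z. z) ** N = N ** fc P d (\<lambda>z. z)"
    and U: "poly_group U" "mderiv U N 0"
    and mem: "\<And>y s. additive_char y \<Longrightarrow> fc P d y ** U s \<in> G"
    using lie_algebra_replicas[OF G X(1)] by metis
  have Gfc: "fc P d y \<in> G" if "additive_char y" for y
    using mem[OF that, of 0] by (simp add: poly_groupD(1)[OF U(1)])
  have fcM: "fc P d g ** M = M ** fc P d g" if "X ** M = M ** X" for M g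
    by (rule commute_jordan_fc[OF P N(2,3)]) (use that N(1) in simp)
  show thesis
  proof (rule that[OF P])
    show "add_jordan_decomposition X (fc P d (\<lambda>z. z)) N"
      unfolding add_jordan_decomposition_def semisimple_mat_iff using P N by blast
    have "U t \<in> G" for t
      using mem[of "\<lambda>_. 1" t] by (simp add: additive_char_def fc_one[OF P])
    then show "N \<in> \<gg>" by (rule lie_algebraI[OF _ U(2) poly_groupD(1)[OF U(1)]])
    show "\<forall>\<psi>. Modules.additive \<psi> \<longrightarrow> fc P d \<psi> \<in> \<gg>"
    proof (intro allI impI)
      fix \<psi> :: "complex \<Rightarrow> complex" assume "Modules.additive \<psi>"
      show "fc P d \<psi> \<in> \<gg>"
      proof (rule lie_algebraI)
        show "fc P d (\<lambda>\<nu>. exp (t * \<psi> \<nu>)) \<in> G" for t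
          by (rule Gfc) (rule additive_char_exp[OF Modules.additive.add[OF \<open>Modules.additive \<psi>\<close>]])
        show "mderiv (\<lambda>t. fc P d (\<lambda>\<nu>. exp (t * \<psi> \<nu>))) (fc P d \<psi>) 0"
          using mderiv_fc_exp[OF P, of d \<psi> 0] by (simp add: fc_one[OF P])
      qed (simp add: fc_one[OF P])
    qed
    show "\<forall>y. additive_char y \<longrightarrow> fc P d y \<in> G" using Gfc by simp
    show "\<forall>M. X ** M = M ** X \<longrightarrow> (\<forall>g. fc P d g ** M = M ** fc P d g) \<and> N ** M = M ** N"
    proof (intro allI impI conjI)
      fix M assume M: "X ** M = M ** X"
      show "fc P d g ** M = M ** fc P d g" for g by (rule fcM[OF M])
      show "N ** M = M ** N"
        using M fcM[OF M, of "\<lambda>z. z"] by (simp add: N(1) mat_distribs)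
    qed
  qed
qed

text \<open>The replica \<open>Y\<close> of \<open>X\<close> with complex conjugate eigenvalues satisfies
  \<open>tr(\<pi>'(X) \<pi>'(Y)) = \<Sum> \<bar>\<nu>\<bar>\<^sup>2 dim V\<^sub>\<nu>\<close>, the sum over the weights \<open>\<nu>\<close> of the semisimple part of \<open>X\<close>.\<close>

lemma nilpotent_if_trace_zero:
  assumes X: "X \<in> \<gg>"
    and tr: "\<And>Y. Y \<in> \<gg> \<Longrightarrow> (\<And>M. X ** M = M ** X \<Longrightarrow> Y ** M = M ** Y) \<Longrightarrow> trace (L X ** L Y) = 0"
  shows "nilpotent_mat X"
proof -
  obtain P d N where P: "invertible P" and jd: "add_jordan_decomposition X (fc P d (\<lambda>z. z)) N"
    and repl: "\<forall>\<psi>. Modules.additive \<psi> \<longrightarrow> fc P d \<psi> \<in> \<gg>" and N: "N \<in> \<gg>"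
    and Gfc: "\<forall>y. additive_char y \<longrightarrow> fc P d y \<in> G"
    and comm: "\<forall>M. X ** M = M ** X \<longrightarrow> (\<forall>g. fc P d g ** M = M ** fc P d g) \<and> N ** M = M ** N"
    by (rule jordan_parts_lie_algebra[OF X])
  obtain A C where A: "finite A"
    and C: "\<forall>\<nu>\<in>A. \<forall>\<mu>\<in>A. C \<nu> ** C \<mu> = (if \<nu> = \<mu> then C \<mu> else 0)"
    and LC: "\<forall>\<psi>. Modules.additive \<psi> \<longrightarrow> L (fc P d \<psi>) = (\<Sum>\<nu>\<in>A. cscale (\<psi> \<nu>) (C \<nu>))"
    by (rule weight_decomposition[OF P Gfc[rule_format]])
  have add: "Modules.additive (\<lambda>z. z :: complex)" "Modules.additive cnj"
    by (simp_all add: Modules.additive_def)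
  define Y where "Y = fc P d cnj"
  have Y: "Y \<in> \<gg>" unfolding Y_def using repl add by blast
  have XN: "X = fc P d (\<lambda>z. z) + N" "nilpotent_mat N"
    using jd unfolding add_jordan_decomposition_def by auto
  \<comment> \<open>The nilpotent part does not contribute to the trace, as it commutes with the
    replica.\<close>
  have "N ** Y = Y ** N"
  proof -
    have "X ** N = N ** X" using comm[rule_format, of X] by simp
    then show ?thesis unfolding Y_def using comm[rule_format, of N] by simp
  qed
  then have "trace (L N ** L Y) = 0" by (rule trace_nilpotent_commute[OF N XN(2) Y])
  moreover have "trace (L X ** L Y) = 0"
    by (rule tr[OF Y]) (use comm in \<open>simp add: Y_def\<close>)
  ultimately have "trace (L (fc P d (\<lambda>z. z)) ** L Y) = 0"
    by (simp add: XN(1) L_add mat_distribs trace_add)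
  moreover have "L (fc P d (\<lambda>z. z)) ** L Y = (\<Sum>\<nu>\<in>A. cscale (\<nu> * cnj \<nu>) (C \<nu>))"
  proof -
    have "L (fc P d (\<lambda>z. z)) ** L Y = (\<Sum>\<nu>\<in>A. \<Sum>\<mu>\<in>A. cscale (\<nu> * cnj \<mu>) (C \<nu> ** C \<mu>))"
      unfolding Y_def LC[rule_format, OF add(1)] LC[rule_format, OF add(2)]
      by (subst matrix_sum_left) (simp add: matrix_sum_right cscale_distribs cscale_sum mult.commute)
    also have "\<dots> = (\<Sum>\<nu>\<in>A. \<Sum>\<mu>\<in>A. if \<nu> = \<mu> then cscale (\<nu> * cnj \<nu>) (C \<nu>) else 0)"
      by (intro sum.cong refl) (use C in auto)
    finally show ?thesis using A by simp
  qed
  ultimately have "(\<Sum>\<nu>\<in>A. \<nu> * cnj \<nu> * trace (C \<nu>)) = 0" by (simp add: trace_sum)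
  then have "Re (\<Sum>\<nu>\<in>A. \<nu> * cnj \<nu> * trace (C \<nu>)) = 0" by simp
  then have sum0: "(\<Sum>\<nu>\<in>A. (cmod \<nu>)\<^sup>2 * Re (trace (C \<nu>))) = 0"
    by (simp add: complex_norm_square[symmetric] del: of_real_power)
  have CC: "C \<nu> ** C \<nu> = C \<nu>" if "\<nu> \<in> A" for \<nu> using C that by simp
  have "cscale \<nu> (C \<nu>) = 0" if \<nu>: "\<nu> \<in> A" for \<nu>
  proof -
    \<comment> \<open>A vanishing sum of nonnegative terms: for each \<nu> the weight or its
      projection is zero.\<close>
    have "(cmod \<nu>)\<^sup>2 * Re (trace (C \<nu>)) = 0"
      using sum0 A \<nu> by (subst (asm) sum_nonneg_eq_0_iff) (auto intro!: mult_nonneg_nonneg trace_idempotent(1) CC)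
    then have "\<nu> = 0 \<or> trace (C \<nu>) = 0"
      using trace_idempotent(2)[OF CC[OF \<nu>]] by (auto simp: complex_eq_iff)
    then show ?thesis using trace_idempotent(3)[OF CC[OF \<nu>]] by auto
  qed
  then have "L (fc P d (\<lambda>z. z)) = 0"
    unfolding LC[rule_format, OF add(1)] by (intro sum.neutral) blast
  then have "fc P d (\<lambda>z. z) = 0" by (rule L_eq_0[OF repl[rule_format, OF add(1)]])
  then show ?thesis using XN by simp
qed

end

section \<open>Engel's theorem\<close>

lemma scaleR_eq_cscale: "r *\<^sub>R M = cscale (of_real r) M"
  by (simp add: vec_eq_iff) (simp add: scaleR_conv_of_real)

text \<open>\<open>flag T k\<close> consists of the vectors killed by every product of
  \<open>k\<close> elements of \<open>T\<close>; reaching the whole space means that all products of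
  that length vanish.\<close>

primrec flag :: "(complex^'n^'n) set \<Rightarrow> nat \<Rightarrow> (complex^'n) set" where
  "flag T 0 = {0}"
| "flag T (Suc k) = {v. \<forall>t\<in>T. t *v v \<in> flag T k}"

lemma zero_mem_flag: "0 \<in> flag T k"
  by (induction k) auto

lemma flag_Suc: "flag T k \<subseteq> flag T (Suc k)"
  by (induction k) (auto simp: zero_mem_flag)

lemma flag_mono: "i \<le> j \<Longrightarrow> flag T i \<subseteq> flag T j"
  using lift_Suc_mono_le[of "flag T" i j] flag_Suc by blast

lemma flag_add: "v \<in> flag T k \<Longrightarrow> w \<in> flag T k \<Longrightarrow> v + w \<in> flag T k"
  by (induction k arbitrary: v w) (auto simp: matrix_vector_right_distrib)

lemma matrix_vector_scaleR:
  fixes A :: "complex^'n^'m"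
  shows "A *v (c *\<^sub>R v) = c *\<^sub>R (A *v v)" "(c *\<^sub>R A) *v v = c *\<^sub>R (A *v v)"
  by (simp_all add: vec_eq_iff matrix_vector_mult_def scaleR_sum_right)

lemma flag_scaleR: "v \<in> flag T k \<Longrightarrow> c *\<^sub>R v \<in> flag T k"
  by (induction k arbitrary: v) (auto simp: matrix_vector_scaleR)

lemma flag_diff: "v \<in> flag T k \<Longrightarrow> w \<in> flag T k \<Longrightarrow> v - w \<in> flag T k"
  using flag_add[of v T k "- w"] flag_scaleR[of w T k "- 1"] by simp

lemma bracket_mult_vec: "bracket X Y *v v = X *v (Y *v v) - Y *v (X *v v)"
  by (simp add: bracket_def matrix_vector_mult_diff_rdistrib matrix_vector_mul_assoc)

lemma flag_normalizer:
  assumes "\<And>t. t \<in> T \<Longrightarrow> bracket t x \<in> T" "v \<in> flag T k"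
  shows "x *v v \<in> flag T k"
  using assms(2)
proof (induction k arbitrary: v)
  case (Suc k)
  have "t *v (x *v v) \<in> flag T k" if t: "t \<in> T" for t
  proof -
    have "t *v (x *v v) = x *v (t *v v) + bracket t x *v v"
      by (simp add: bracket_mult_vec)
    then show ?thesis using Suc assms(1)[OF t] t by (auto intro: flag_add)
  qed
  then show ?case by simp
qed simp

text \<open>\<open>x\<close> preserves each \<open>flag T k\<close> and is nilpotent. If
  \<open>v\<close> is one step above \<open>flag T k\<close> and \<open>x^j v\<close> lies in it,
  then elements of \<open>T\<close> send \<open>v\<close> into \<open>flag T k\<close> and
  \<open>x\<close> lowers \<open>j\<close>, so \<open>j\<close> more steps of the new flag
  suffice.\<close>

lemma engel_step:
  assumes norm: "\<And>t. t \<in> T \<Longrightarrow> bracket t x \<in> T" and nil: "nilpotent_mat x" and K: "flag T K = UNIV"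
  obtains K' where "flag {t + c *\<^sub>R x | t c. t \<in> T} K' = UNIV"
proof -
  define T' where "T' = {t + c *\<^sub>R x | t c. t \<in> T}"
  obtain d where d: "mpow x d = 0" using nil unfolding nilpotent_mat_def by blast
  have "\<exists>m. flag T k \<subseteq> flag T' m" for k
  proof (induction k)
    case 0
    show ?case by (rule exI[of _ 0]) simp
  next
    case (Suc k)
    then obtain m where m: "flag T k \<subseteq> flag T' m" by blast
    have "v \<in> flag T' (m + j)" if "v \<in> flag T (Suc k)" "mpow x j *v v \<in> flag T k" for j v
      using that
    proof (induction j arbitrary: v)
      case 0
      then show ?case using m by auto
    next
      case (Suc j)
      have xv: "x *v v \<in> flag T' (m + j)"
      proof (rule Suc.IH)
        show "x *v v \<in> flag T (Suc k)" by (rule flag_normalizer[OF norm Suc.prems(1)])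
        have "mpow x (Suc j) = mpow x j ** x" using mpow_commute[of x x j] by simp
        then show "mpow x j *v (x *v v) \<in> flag T k"
          using Suc.prems(2) by (simp add: matrix_vector_mul_assoc)
      qed
      have "t *v v \<in> flag T' (m + j)" if "t \<in> T" for t
        using Suc.prems(1) that m flag_mono[of m "m + j" T'] by auto
      then have "(t + c *\<^sub>R x) *v v \<in> flag T' (m + j)" if "t \<in> T" for t c
        using xv that
        by (auto simp: matrix_vector_mult_add_rdistrib matrix_vector_scaleR(2) intro!: flag_add flag_scaleR)
      then show ?case by (auto simp: T'_def)
    qed
    from this[of _ d] have "flag T (Suc k) \<subseteq> flag T' (m + d)"
      by (auto simp: d zero_mem_flag simp del: flag.simps)
    then show ?case by blast
  qed
  then obtain m where "flag T K \<subseteq> flag T' m" by blast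
  then show thesis using that[of m] K by (auto simp: T'_def)
qed

text \<open>Iterated brackets with \<open>T\<close> eventually vanish because products of \<open>K\<close> elements of \<open>T\<close> do;
  the last bracket outside \<open>T\<close> normalizes \<open>T\<close>.\<close>

lemma exists_normalizing:
  assumes K: "flag T K = UNIV" and 0: "0 \<in> T"
    and br: "\<And>t y. t \<in> T \<Longrightarrow> y \<in> S \<Longrightarrow> bracket t y \<in> S" and "T \<subset> S"
  obtains x where "x \<in> S - T" "\<And>t. t \<in> T \<Longrightarrow> bracket t x \<in> T"
proof (rule ccontr)
  note ex = that
  assume "\<not> thesis"
  then have neg: "\<exists>t\<in>T. bracket t x \<notin> T" if "x \<in> S - T" for x using ex[OF that] by blast
  \<comment> \<open>Reads: \<open>M\<close> maps step \<open>i\<close> into step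
    \<open>i + K - j\<close>. For \<open>j = 0\<close> this holds since every step from
    \<open>K\<close> on is the whole space, each bracket gains one, and \<open>j = K + K\<close>
    forces \<open>M = 0\<close>.\<close>
  define F where "F j M \<longleftrightarrow> (\<forall>i l. i + K \<le> l + j \<longrightarrow> (\<forall>v\<in>flag T i. M *v v \<in> flag T l))"
    for j and M :: "complex^'a^'a"
  have "\<exists>y\<in>S - T. F j y" for j
  proof (induction j)
    case 0
    obtain y where "y \<in> S - T" using \<open>T \<subset> S\<close> by blast
    moreover have "flag T l = UNIV" if "K \<le> l" for l
      using K flag_mono[OF that, of T] by blast
    then have "F 0 y" unfolding F_def by simp
    ultimately show ?case by blast
  next
    case (Suc j)
    then obtain y where y: "y \<in> S - T" "F j y" by blast
    then obtain t where t: "t \<in> T" "bracket t y \<notin> T" using neg by blast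
    have "F (Suc j) (bracket t y)"
      unfolding F_def
    proof (intro allI impI ballI)
      fix i l v assume le: "i + K \<le> l + Suc j" and v: "v \<in> flag T i"
      have "y *v v \<in> flag T (Suc l)"
        by (rule y(2)[unfolded F_def, rule_format, OF _ v]) (use le in simp)
      then have 1: "t *v (y *v v) \<in> flag T l" using t(1) by simp
      have 2: "y *v (t *v v) \<in> flag T l"
      proof (cases i)
        case 0
        then show ?thesis using v by (simp add: zero_mem_flag)
      next
        case (Suc i')
        then have "t *v v \<in> flag T i'" using v t(1) by simp
        then show ?thesis
          by (rule y(2)[unfolded F_def, rule_format, rotated]) (use le Suc in simp)
      qed
      show "bracket t y *v v \<in> flag T l"
        unfolding bracket_mult_vec by (rule flag_diff[OF 1 2])
    qed
    then show ?case using t y(1) br by blast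
  qed
  then obtain y where y: "y \<in> S - T" "F (K + K) y" by blast
  have "y *v v \<in> flag T 0" for v
    using y(2) K unfolding F_def by (metis UNIV_I add_0 order_refl)
  then have "y = 0" by (simp add: matrix_eq)
  with y(1) 0 show False by simp
qed

text \<open>Among the subalgebras whose flag reaches the whole space, one of maximal dimension must
  be \<open>S\<close>, since otherwise a normalizing element would enlarge it.\<close>

lemma engel:
  fixes S :: "(complex^'n^'n) set"
  assumes S: "subspace S" and br: "\<And>x y. x \<in> S \<Longrightarrow> y \<in> S \<Longrightarrow> bracket x y \<in> S"
    and nil: "\<And>x. x \<in> S \<Longrightarrow> nilpotent_mat x"
  obtains K where "flag S K = UNIV"
proof -
  define good where "good T \<longleftrightarrow> T \<subseteq> S \<and> subspace T \<and> (\<forall>x\<in>T. \<forall>y\<in>T. bracket x y \<in> T) \<and> (\<exists>K. flag T K = UNIV)" for T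
  have "good {0}"
    unfolding good_def using subspace_0[OF S] by (auto simp: bracket_def subspace_def intro!: exI[of _ 1])
  moreover have "\<forall>T. good T \<longrightarrow> dim T < Suc DIM(complex^'n^'n)"
    using dim_subset_UNIV[where 'a = "complex^'n^'n"] by (simp only: less_Suc_eq_le simp_thms)
  ultimately obtain T where T: "good T" and max: "\<And>T'. good T' \<Longrightarrow> dim T' \<le> dim T"
    using ex_has_greatest_nat[of good "{0}" dim "Suc DIM(complex^'n^'n)"] by blast
  obtain K where K: "flag T K = UNIV" using T unfolding good_def by blast
  have sT: "subspace T" and TS: "T \<subseteq> S" using T unfolding good_def by auto
  have "T = S"
  proof (rule ccontr)
    assume "T \<noteq> S"
    with TS have "T \<subset> S" by blast
    obtain x where x: "x \<in> S - T" and nx: "\<And>t. t \<in> T \<Longrightarrow> bracket t x \<in> T"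
      using exists_normalizing[OF K subspace_0[OF sT] _ \<open>T \<subset> S\<close>] br TS by blast
    \<comment> \<open>A real line is added: subspaces and dimensions are real throughout this
      argument.\<close>
    define T' where "T' = {t + c *\<^sub>R x | t c. t \<in> T}"
    have TT': "t \<in> T'" if "t \<in> T" for t
    proof -
      have "t = t + 0 *\<^sub>R x" by simp
      with that show ?thesis unfolding T'_def by blast
    qed
    have "T' \<subseteq> S"
      using TS x by (auto simp: T'_def intro!: subspace_add[OF S] subspace_scale[OF S])
    moreover have sT': "subspace T'"
    proof (rule subspaceI)
      show "0 \<in> T'" by (rule TT'[OF subspace_0[OF sT]])
    next
      fix y z assume "y \<in> T'" "z \<in> T'"
      then obtain t c u e where "y = t + c *\<^sub>R x" "t \<in> T" "z = u + e *\<^sub>R x" "u \<in> T"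
        unfolding T'_def by blast
      moreover from this have "y + z = (t + u) + (c + e) *\<^sub>R x" by (simp add: algebra_simps)
      ultimately show "y + z \<in> T'" unfolding T'_def using subspace_add[OF sT] by blast
    next
      fix r y assume "y \<in> T'"
      then obtain t c where "y = t + c *\<^sub>R x" "t \<in> T" unfolding T'_def by blast
      moreover from this have "r *\<^sub>R y = r *\<^sub>R t + (r * c) *\<^sub>R x" by (simp add: algebra_simps)
      ultimately show "r *\<^sub>R y \<in> T'" unfolding T'_def using subspace_scale[OF sT] by blast
    qed
    moreover have "bracket y z \<in> T'" if yz: "y \<in> T'" "z \<in> T'" for y z
    proof -
      obtain t c u e where y: "y = t + c *\<^sub>R x" "t \<in> T" and z: "z = u + e *\<^sub>R x" "u \<in> T"
        using yz unfolding T'_def by blast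
      have "bracket y z = bracket t u + e *\<^sub>R bracket t x - c *\<^sub>R bracket u x"
        unfolding y(1) z(1) bracket_def scaleR_eq_cscale
        by (simp add: mat_distribs cscale_distribs algebra_simps)
      moreover have "bracket t u \<in> T" using T y(2) z(2) unfolding good_def by blast
      ultimately have "bracket y z \<in> T"
        using nx y(2) z(2) by (simp add: subspace_add[OF sT] subspace_diff[OF sT] subspace_scale[OF sT])
      then show ?thesis by (rule TT')
    qed
    moreover have "nilpotent_mat x" using nil x by blast
    from engel_step[OF nx this K] have "\<exists>K. flag T' K = UNIV"
      unfolding T'_def by blast
    ultimately have "good T'" unfolding good_def by blast
    then have "dim T' \<le> dim T" by (rule max)
    moreover have "T \<subset> T'"
    proof
      show "T \<subseteq> T'" using TT' by blast
      have "x = 0 + 1 *\<^sub>R x" by simp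
      then have "x \<in> T'" unfolding T'_def using subspace_0[OF sT] by blast
      with x show "T \<noteq> T'" by blast
    qed
    then have "dim T < dim T'"
      using dim_psubset[of T T'] sT sT' by (simp add: span_eq_iff[THEN iffD2])
    ultimately show False by simp
  qed
  with K that show thesis by blast
qed

text \<open>\<open>h\<close> preserves the flag and \<open>x\<close> descends in it, so the product
  descends even when the factors do not commute. Applied to group elements \<open>h\<close>.\<close>

lemma nilpotent_mult_flag:
  assumes K: "flag T K = UNIV" and x: "x \<in> T" and h: "\<And>k v. v \<in> flag T k \<Longrightarrow> h *v v \<in> flag T k"
  shows "nilpotent_mat (x ** h)"
proof -
  have "mpow (x ** h) j *v v \<in> flag T m" if "v \<in> flag T (m + j)" for j m v
    using that
  proof (induction j arbitrary: m v)
    case (Suc j)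
    have "v \<in> flag T (Suc m + j)" using Suc.prems by simp
    then have "mpow (x ** h) j *v v \<in> flag T (Suc m)" by (rule Suc.IH)
    then have "h *v (mpow (x ** h) j *v v) \<in> flag T (Suc m)" by (rule h)
    then have "x *v (h *v (mpow (x ** h) j *v v)) \<in> flag T m" using x by simp
    then show ?case by (simp add: matrix_vector_mul_assoc matrix_mul_assoc)
  qed simp
  from this[of _ 0 K] have "mpow (x ** h) K *v v = 0" for v using K by simp
  then have "mpow (x ** h) K = 0" by (simp add: matrix_eq)
  then show ?thesis unfolding nilpotent_mat_def by blast
qed

section \<open>Nondegenerate bilinear forms\<close>

text \<open>\<open>T\<close> encodes the functional \<open>b X\<close> by its values on a basis;
  nondegeneracy makes it injective on \<open>V\<close>, and dimension makes it onto.\<close>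

lemma bilinear_form_represents:
  fixes b :: "'a::euclidean_space \<Rightarrow> 'a \<Rightarrow> real"
  assumes V: "subspace V" and lin: "\<And>Y. linear (\<lambda>X. b X Y)" "\<And>X. linear (b X)"
    and nd: "\<And>X. X \<in> V \<Longrightarrow> (\<And>Y. Y \<in> V \<Longrightarrow> b X Y = 0) \<Longrightarrow> X = 0"
    and l: "linear l"
  obtains X where "X \<in> V" "\<And>Y. Y \<in> V \<Longrightarrow> b X Y = l Y"
proof -
  obtain E where E: "E \<subseteq> V" "independent E" "card E = dim V" "span E = V"
    using orthonormal_basis_subspace[OF V] by metis
  have fin: "finite E" using E(2) independent_imp_finite by blast
  have ext: "f Y = 0" if "linear f" "\<And>e. e \<in> E \<Longrightarrow> f e = 0" "Y \<in> V" for f :: "'a \<Rightarrow> real" and Y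
    using linear_eq_0_on_span[OF that(1), of E Y] that(2,3) E(4) by blast
  define T where "T X = (\<Sum>e\<in>E. b X e *\<^sub>R e)" for X
  have T: "linear T"
    unfolding T_def
    by (intro linear_compose_sum ballI linear_compose_scale_right lin(1)
        linear_compose[OF lin(1) linear_scaleR_left, unfolded o_def])
  have coeff: "c e = 0" if "(\<Sum>e\<in>E. c e *\<^sub>R e) = 0" "e \<in> E" for c e
    using independentD[OF E(2) fin order_refl that] .
  have inj: "X = 0" if X: "X \<in> V" "T X = 0" for X
  proof (rule nd[OF X(1)])
    fix Y assume "Y \<in> V"
    then show "b X Y = 0" using ext[OF lin(2)] coeff[of "b X"] X(2) unfolding T_def by blast
  qed
  have "inj_on T V"
  proof (rule inj_onI)
    fix X Y assume "X \<in> V" "Y \<in> V" "T X = T Y"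
    then show "X = Y"
      using inj[of "X - Y"] linear_diff[OF T] subspace_diff[OF V] by simp
  qed
  then have "dim (T ` V) = dim V"
    using dim_image_eq[OF T, of V] V by (simp add: span_eq_iff[THEN iffD2])
  moreover have "T ` V \<subseteq> V"
    using E(1) by (auto simp: T_def intro!: subspace_sum[OF V] subspace_scale[OF V])
  ultimately have "T ` V = V"
    using subspace_dim_equal[OF linear_subspace_image[OF T V] V] by simp
  moreover have "(\<Sum>e\<in>E. l e *\<^sub>R e) \<in> V"
    using E(1) by (auto intro!: subspace_sum[OF V] subspace_scale[OF V])
  ultimately obtain X where X: "X \<in> V" "T X = (\<Sum>e\<in>E. l e *\<^sub>R e)" by (metis imageE)
  have "(\<Sum>e\<in>E. (b X e - l e) *\<^sub>R e) = 0"
    using X(2) by (simp add: T_def scaleR_diff_left sum_subtractf)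
  then have "b X e - l e = 0" if "e \<in> E" for e using coeff[of "\<lambda>e. b X e - l e", OF _ that] by simp
  then have "b X Y - l Y = 0" if "Y \<in> V" for Y
    using ext[OF linear_compose_sub[OF lin(2) l] _ that] by blast
  with X(1) show thesis by (intro that[of X]) auto
qed

text \<open>Split off the Euclidean component \<open>z\<close> of \<open>W\<close> orthogonal to
  \<open>U\<close> and represent the inner product with \<open>z\<close> by some \<open>Z\<close>.
  Then \<open>Z\<close> is orthogonal to \<open>U\<close>, so
  \<open>0 = b Z W = z \<bullet> z\<close>.\<close>

lemma double_orthogonal:
  fixes b :: "'a::euclidean_space \<Rightarrow> 'a \<Rightarrow> real"
  assumes V: "subspace V" and lin: "\<And>Y. linear (\<lambda>X. b X Y)" "\<And>X. linear (b X)"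
    and nd: "\<And>X. X \<in> V \<Longrightarrow> (\<And>Y. Y \<in> V \<Longrightarrow> b X Y = 0) \<Longrightarrow> X = 0"
    and U: "subspace U" "U \<subseteq> V" and W: "W \<in> V"
    and perp: "\<And>Z. Z \<in> V \<Longrightarrow> (\<And>Y. Y \<in> U \<Longrightarrow> b Z Y = 0) \<Longrightarrow> b Z W = 0"
  shows "W \<in> U"
proof -
  obtain y z where yz: "y \<in> span U" "\<And>w. w \<in> span U \<Longrightarrow> orthogonal z w" "W = y + z"
    using orthogonal_subspace_decomp_exists[of U W] by metis
  have [simp]: "span U = U" using U(1) by (simp add: span_eq_iff)
  obtain Z where Z: "Z \<in> V" "\<And>Y. Y \<in> V \<Longrightarrow> b Z Y = z \<bullet> Y"
    using bilinear_form_represents[OF V lin nd, of "\<lambda>Y. z \<bullet> Y"] bounded_linear.linear[OF bounded_linear_inner_right]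
    by metis
  have "b Z W = 0"
  proof (rule perp[OF Z(1)])
    show "b Z Y = 0" if "Y \<in> U" for Y
      using that yz(2)[of Y] Z(2)[of Y] U(2) by (auto simp: orthogonal_def)
  qed
  then have "z \<bullet> z = 0"
    using Z(2)[OF W] yz(1) yz(2)[of y] by (simp add: yz(3) orthogonal_def inner_add_right)
  then show ?thesis using yz(1,3) by simp
qed

lemma real_subspace: "cmat.subspace V \<Longrightarrow> subspace V"
  unfolding cmat.subspace_def subspace_def by (simp add: scaleR_eq_cscale)

section \<open>The trace form\<close>

context faithful_rep
begin

definition B :: "complex^'n^'n \<Rightarrow> complex^'n^'n \<Rightarrow> complex" where
  "B X Y = trace (L X ** L Y)"

lemma B_sym: "B X Y = B Y X"
  unfolding B_def by (rule trace_mul_sym)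

lemma B_linear:
  "B (X + X') Y = B X Y + B X' Y" "B X (Y + Y') = B X Y + B X Y'"
  "B (X - X') Y = B X Y - B X' Y" "B X (Y - Y') = B X Y - B X Y'"
  "B (cscale c X) Y = c * B X Y" "B X (cscale c Y) = c * B X Y" "B 0 Y = 0" "B X 0 = 0"
  by (simp_all add: B_def L_add L_diff L_cscale L_zero mat_distribs trace_add trace_sub)

lemma linear_Re_B: "linear (\<lambda>X. Re (B X Y))" "linear (\<lambda>Y. Re (B X Y))"
  by (intro linearI; simp add: B_linear scaleR_eq_cscale)+

text \<open>The real part of \<open>f\<close> at \<open>- \<i>\<close> times \<open>Y\<close> is the
  imaginary part of \<open>f Y\<close>. This transfers the real duality results to the complex form
  \<open>B\<close>.\<close>

lemma Re_zero_on_subspace: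
  assumes V: "cmat.subspace V" and f: "\<And>c Y. f (cscale c Y) = c * f Y"
    and "\<And>Y. Y \<in> V \<Longrightarrow> Re (f Y) = 0" "Y \<in> V"
  shows "f Y = (0 :: complex)"
  using assms(3)[OF assms(4)] assms(3)[OF cmat.subspace_scale[OF V assms(4), of "- \<i>"], unfolded f]
  by (simp add: complex_eq_iff)

lemma B_represents:
  assumes V: "cmat.subspace V" and nd: "\<And>X. X \<in> V \<Longrightarrow> (\<And>Y. Y \<in> V \<Longrightarrow> B X Y = 0) \<Longrightarrow> X = 0"
  obtains X where "X \<in> V" "\<And>Y. Y \<in> V \<Longrightarrow> B X Y = trace (M ** L Y)"
proof -
  have lin: "linear (\<lambda>Y. Re (trace (M ** L Y)))"
    by (intro linearI; simp add: L_add L_cscale mat_distribs trace_add scaleR_eq_cscale)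
  have nd': "X = 0" if X: "X \<in> V" "\<And>Y. Y \<in> V \<Longrightarrow> Re (B X Y) = 0" for X
    by (rule nd[OF X(1)]) (rule Re_zero_on_subspace[OF V B_linear(6) X(2)])
  obtain X where X: "X \<in> V" "\<And>Y. Y \<in> V \<Longrightarrow> Re (B X Y) = Re (trace (M ** L Y))"
    using bilinear_form_represents[OF real_subspace[OF V] linear_Re_B nd' lin] by blast
  have "B X Y - trace (M ** L Y) = 0" if "Y \<in> V" for Y
    by (rule Re_zero_on_subspace[OF V, where f = "\<lambda>Y. B X Y - trace (M ** L Y)"])
       (use X(2) that in \<open>simp_all add: B_linear L_cscale right_diff_distrib\<close>)
  with X(1) show thesis by (intro that[of X]) auto
qed

lemma B_double_orthogonal:
  assumes V: "cmat.subspace V" and nd: "\<And>X. X \<in> V \<Longrightarrow> (\<And>Y. Y \<in> V \<Longrightarrow> B X Y = 0) \<Longrightarrow> X = 0"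
    and U: "cmat.subspace U" "U \<subseteq> V" and W: "W \<in> V"
    and perp: "\<And>Z. Z \<in> V \<Longrightarrow> (\<And>Y. Y \<in> U \<Longrightarrow> B Z Y = 0) \<Longrightarrow> B Z W = 0"
  shows "W \<in> U"
proof (rule double_orthogonal[OF real_subspace[OF V] linear_Re_B _ real_subspace[OF U(1)] U(2) W])
  show "X = 0" if X: "X \<in> V" "\<And>Y. Y \<in> V \<Longrightarrow> Re (B X Y) = 0" for X
    by (rule nd[OF X(1)]) (rule Re_zero_on_subspace[OF V B_linear(6) X(2)])
  show "Re (B Z W) = 0" if Z: "Z \<in> V" "\<And>Y. Y \<in> U \<Longrightarrow> Re (B Z Y) = 0" for Z
  proof -
    have "B Z W = 0"
      by (rule perp[OF Z(1)]) (rule Re_zero_on_subspace[OF U(1) B_linear(6) Z(2)])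
    then show ?thesis by simp
  qed
qed

lemma B_bracket:
  assumes "X \<in> \<gg>" "Y \<in> \<gg>" "Z \<in> \<gg>"
  shows "B (bracket X Y) Z = B X (bracket Y Z)"
proof -
  have "trace (L Y ** L X ** L Z) = trace (L X ** (L Z ** L Y))"
    using trace_mul_sym[of "L Y" "L X ** L Z"] by (simp add: matrix_mul_assoc)
  then show ?thesis
    unfolding B_def L_bracket[OF assms(1,2)] L_bracket[OF assms(2,3)]
    by (simp add: bracket_def mat_distribs trace_sub matrix_mul_assoc)
qed

lemma trace_Ad:
  fixes M :: "complex^'k^'k"
  assumes "invertible b"
  shows "trace (Ad b M) = trace M"
  unfolding Ad_def using trace_mul_sym[of "b ** M" "matrix_inv b"] assms by simp

lemma Ad_mult:
  fixes M :: "complex^'k^'k"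
  assumes "invertible b"
  shows "Ad b (M ** M') = Ad b M ** Ad b M'"
  unfolding Ad_def using assms by (simp add: matrix_mul_assoc)

lemma Ad_inverse:
  fixes M :: "complex^'k^'k"
  assumes "invertible b"
  shows "Ad b (Ad (matrix_inv b) M) = M" "Ad (matrix_inv b) (Ad b M) = M"
  unfolding Ad_def using assms by (simp_all add: matrix_mul_assoc matrix_inv_matrix_inv)

lemma B_Ad:
  assumes "b \<in> G" "X \<in> \<gg>" "Y \<in> \<gg>"
  shows "B (Ad b X) (Ad b Y) = B X Y"
  unfolding B_def L_Ad[OF assms(1,2)] L_Ad[OF assms(1,3)]
  by (simp add: trace_Ad pi_invertible assms(1) flip: Ad_mult[OF pi_invertible[OF assms(1)]])

end

section \<open>The unipotent radical\<close>

lemma group_GL: "group (GL :: (complex^'n^'n) monoid)"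
proof (rule groupI)
  fix A :: "complex^'n^'n" assume "A \<in> carrier GL"
  then show "\<exists>B\<in>carrier GL. B \<otimes>\<^bsub>GL\<^esub> A = \<one>\<^bsub>GL\<^esub>"
    by (auto simp: GL_def intro!: bexI[of _ "matrix_inv A"] invertible_matrix_inv)
qed (auto simp: GL_def matrix_mul_assoc intro: invertible_mult invertible_mat_1)

text \<open>A nonempty relatively open subset of the range contains \<open>U t\<close> for all
  \<open>t\<close> off the roots of a nonzero polynomial, and two such subsets meet.\<close>

lemma connectedin_range_poly_group:
  assumes U: "poly_group U"
  shows "connectedin zariski (range U)"
  unfolding connectedin
proof (intro conjI notI)
  show "range U \<subseteq> topspace zariski"
    using poly_group_invertible[OF U] by (auto simp: topspace_zariski)
  assume "\<exists>E1 E2. openin zariski E1 \<and> openin zariski E2 \<and> range U \<subseteq> E1 \<union> E2 \<and>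
      E1 \<inter> E2 \<inter> range U = {} \<and> E1 \<inter> range U \<noteq> {} \<and> E2 \<inter> range U \<noteq> {}"
  then obtain E1 E2 where E: "openin zariski E1" "openin zariski E2" "E1 \<inter> E2 \<inter> range U = {}"
    "E1 \<inter> range U \<noteq> {}" "E2 \<inter> range U \<noteq> {}" by blast
  have poly: "\<exists>p. p \<noteq> 0 \<and> (\<forall>t. poly p t \<noteq> 0 \<longrightarrow> U t \<in> E)"
    if opn: "openin zariski E" and ne: "E \<inter> range U \<noteq> {}" for E
  proof -
    obtain S where S: "S \<subseteq> GL_regular" "E = {A. invertible A \<and> (\<exists>f\<in>S. f A \<noteq> 0)}"
      using opn unfolding openin_zariski by blast
    obtain t where "U t \<in> E" using ne by auto
    then obtain f where tf: "f \<in> S" "f (U t) \<noteq> 0" unfolding S(2) by auto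
    then have "f \<in> GL_regular" using S(1) by auto
    then obtain p where p: "\<And>t. f (U t) = poly p t"
      using poly_group_regular[OF U] by metis
    have "p \<noteq> 0" using tf(2) p by auto
    moreover have "U t \<in> E" if "poly p t \<noteq> 0" for t
      using that tf(1) poly_group_invertible[OF U] by (auto simp: S(2) p intro!: bexI[of _ f])
    ultimately show ?thesis by blast
  qed
  obtain p q where p: "p \<noteq> 0" "\<And>t. poly p t \<noteq> 0 \<Longrightarrow> U t \<in> E1"
    and q: "q \<noteq> 0" "\<And>t. poly q t \<noteq> 0 \<Longrightarrow> U t \<in> E2"
    using poly[OF E(1,4)] poly[OF E(2,5)] by blast
  have "\<not> (\<forall>m :: nat. poly (p * q) (of_nat m) = 0)"
    using poly_eq_0_if_nat_roots[of "p * q"] p(1) q(1) by auto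
  then obtain t where "poly p t \<noteq> 0" "poly q t \<noteq> 0" by auto
  then show False using p(2) q(2) E(3) by blast
qed

text \<open>The trace of \<open>p(u)\<close> is \<open>p(1)\<close> times the size of
  \<open>u\<close>, for every polynomial \<open>p\<close>. For an eigenvalue other than 1, a
  \<open>p\<close> interpolating its spectral projection has \<open>p(1) = 0\<close>, yet the trace
  is the multiplicity.\<close>

lemma unipotent_if_traces:
  fixes u :: "complex^'n^'n"
  assumes tr: "\<And>k. trace (mpow u k) = trace (mat 1 :: complex^'n^'n)"
  shows "unipotent_mat u"
proof -
  have "trace (mpow u k ** matpoly p u) = poly p 1 * trace (mat 1 :: complex^'n^'n)" for k p
  proof (induction p arbitrary: k)
    case (pCons a p)
    have "mpow u k ** u = mpow u (Suc k)" using mpow_commute[of u u k] by simp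
    then have "mpow u k ** (u ** matpoly p u) = mpow u (Suc k) ** matpoly p u"
      by (simp only: matrix_mul_assoc)
    then show ?case using pCons.IH[of "Suc k"] tr[of k]
      by (simp add: mat_distribs trace_add distrib_right)
  qed simp
  from this[of 0] have trp: "trace (matpoly p u) = poly p 1 * trace (mat 1 :: complex^'n^'n)" for p
    by simp
  obtain S N where "add_jordan_decomposition u S N" by (rule add_jordan_exists)
  then obtain P d n where P: "invertible P" and N: "u = fc P d (\<lambda>z. z) + N" "mpow N n = 0"
    "fc P d (\<lambda>z. z) ** N = N ** fc P d (\<lambda>z. z)"
    unfolding add_jordan_decomposition_def semisimple_mat_iff nilpotent_mat_def by blast
  \<comment> \<open>With a positive order the interpolation condition at 1 does determine
    \<open>q(1)\<close>.\<close>
  have N': "mpow N (Suc n) = 0" using N(2) by simp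
  have "d i = 1" for i
  proof (rule ccontr)
    assume i: "d i \<noteq> 1"
    define g where "g z = (if z = d i then 1 else 0 :: complex)" for z
    obtain q where q: "\<And>z. z \<in> range d \<union> {1} \<Longrightarrow> [:-z, 1:] ^ Suc n dvd q - [:g z:]"
      using hermite_interpolation[of "range d \<union> {1}" "Suc n" g] by auto
    have "matpoly q u = fc P d g"
      unfolding N(1) by (rule matpoly_eq_fc[OF P N' N(3)]) (use q in blast)
    then have "trace (fc P d g) = poly q 1 * trace (mat 1 :: complex^'n^'n)" using trp by metis
    moreover have "poly q 1 = 0"
    proof -
      have "[:-1, 1:] dvd q - [:g 1:]"
        using q[of 1] dvd_trans[OF dvd_triv_left] by (simp only: power_Suc) blast
      then show ?thesis using i by (simp flip: poly_eq_0_iff_dvd add: g_def)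
    qed
    ultimately have "(\<Sum>j\<in>UNIV. g (d j)) = 0" by (simp add: trace_fc[OF P])
    moreover have "(\<Sum>j\<in>UNIV. g (d j)) = of_nat (card {j. d j = d i})"
      by (simp add: g_def sum.If_cases)
    ultimately have "{j. d j = d i} = {}" by simp
    then show False by blast
  qed
  then have "fc P d (\<lambda>z. z) = mat 1"
    using fc_cong[of "\<lambda>z. z" d "\<lambda>z. 1" P] fc_one[OF P] by simp
  then have "u - mat 1 = N" using N(1) by simp
  then show ?thesis using N(2) unfolding unipotent_mat_def nilpotent_mat_def by blast
qed

text \<open>This is the largest unipotent normal subgroup: \<open>u - 1\<close> is required to lie in the radical of
  the trace form on the associative algebra spanned by \<open>G\<close>.\<close>

definition trace_kernel :: "(complex^'n^'n) set \<Rightarrow> (complex^'n^'n) set" where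
  "trace_kernel G = {u\<in>G. \<forall>h\<in>G. trace (u ** h) = trace h}"

lemma trace_kernelD:
  "u \<in> trace_kernel G \<Longrightarrow> u \<in> G"
  "u \<in> trace_kernel G \<Longrightarrow> h \<in> G \<Longrightarrow> trace (u ** h) = trace h"
  by (simp_all add: trace_kernel_def)

text \<open>Besides normality the point is connectedness: every element is unipotent and lies on a
  polynomial one-parameter group through the identity that stays inside.\<close>

lemma trace_kernel_subset_unipotent_radical:
  fixes G :: "(complex^'n^'n) set"
  assumes G: "algebraic_group G"
  shows "trace_kernel G \<subseteq> unipotent_radical G"
proof -
  let ?H = "trace_kernel G"
  note mem = algebraic_groupD[OF G]
  have one: "mat 1 \<in> ?H" using mem(1) by (simp add: trace_kernel_def)
  have mult: "u ** v \<in> ?H" if "u \<in> ?H" "v \<in> ?H" for u v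
    using that mem(3) by (auto simp: trace_kernel_def simp flip: matrix_mul_assoc)
  have pow: "mpow u k \<in> ?H" if "u \<in> ?H" for u k
    by (induction k) (simp_all add: one mult that)
  have inv: "matrix_inv u \<in> ?H" if u: "u \<in> ?H" for u
  proof -
    have "trace (matrix_inv u ** h) = trace h" if h: "h \<in> G" for h
    proof -
      have "trace (u ** (matrix_inv u ** h)) = trace (matrix_inv u ** h)"
        by (intro trace_kernelD(2)[OF u] mem(3) mem(4) trace_kernelD(1)[OF u] h)
      then show ?thesis using mem(2)[OF trace_kernelD(1)[OF u]] by simp
    qed
    then show ?thesis using u mem(4) by (simp add: trace_kernel_def)
  qed
  have conj: "g ** u ** matrix_inv g \<in> ?H" if g: "g \<in> G" and u: "u \<in> ?H" for g u
  proof -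
    have "trace (g ** u ** matrix_inv g ** h) = trace h" if h: "h \<in> G" for h
    proof -
      have "trace (g ** u ** matrix_inv g ** h) = trace (u ** (matrix_inv g ** h ** g))"
        using trace_mul_sym[of g "u ** matrix_inv g ** h"] by (simp add: matrix_mul_assoc)
      also have "\<dots> = trace (matrix_inv g ** h ** g)"
        by (intro trace_kernelD(2)[OF u] mem(3) mem(4) g h)
      also have "\<dots> = trace (g ** (matrix_inv g ** h))" by (rule trace_mul_sym)
      also have "\<dots> = trace h" using mem(2)[OF g] by simp
      finally show ?thesis .
    qed
    then show ?thesis using g u mem(3,4) by (simp add: trace_kernel_def)
  qed
  have closed: "closedin zariski ?H"
  proof -
    obtain S where S: "S \<subseteq> GL_regular" "G = {A. invertible A \<and> (\<forall>f\<in>S. f A = 0)}"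
      using mem(5) unfolding closedin_zariski by blast
    define R where "R = (\<lambda>h A. trace (A ** h) + (- trace h)) ` G"
    have "R \<subseteq> GL_regular"
      unfolding R_def trace_def matrix_mul_nth
      by (intro image_subsetI GL_regular.add GL_regular_sum GL_regular.mult GL_regular.entry GL_regular.const)
    moreover have "?H = {A. invertible A \<and> (\<forall>f\<in>S \<union> R. f A = 0)}"
    proof (rule Set.set_eqI)
      fix A
      have G_iff: "A \<in> G \<longleftrightarrow> invertible A \<and> (\<forall>f\<in>S. f A = 0)" using S(2) by blast
      have "(\<forall>f\<in>R. f A = 0) \<longleftrightarrow> (\<forall>h\<in>G. trace (A ** h) = trace h)" by (simp add: R_def)
      then show "A \<in> ?H \<longleftrightarrow> A \<in> {A. invertible A \<and> (\<forall>f\<in>S \<union> R. f A = 0)}"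
        unfolding trace_kernel_def mem_Collect_eq ball_Un G_iff by blast
    qed
    ultimately show ?thesis
      unfolding closedin_zariski by (intro exI[of _ "S \<union> R"] conjI Un_least S(1))
  qed
  have connected: "connectedin zariski ?H"
  proof -
    have "\<exists>U. poly_group U \<and> U 1 = u \<and> range U \<subseteq> ?H" if u: "u \<in> ?H" for u
    proof -
      have "trace (mpow u k) = trace (mat 1 :: complex^'n^'n)" for k
        using trace_kernelD(2)[OF pow[OF u] mem(1), of k] by simp
      then have "unipotent_mat u" by (rule unipotent_if_traces)
      moreover have "semisimple_mat (mat 1 :: complex^'n^'n)"
        unfolding semisimple_mat_iff
        using fc_one[OF invertible_mat_1] fc_cong[of "\<lambda>z. z" "\<lambda>_. 1" "\<lambda>z. 1" "mat 1"] invertible_mat_1 by metis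
      \<comment> \<open>With trivial semisimple part, the Jordan lemma keeps the one-parameter group
        inside the closed set that contains the powers of \<open>u\<close>.\<close>
      ultimately have "mult_jordan_decomposition u (mat 1) u"
        by (simp add: mult_jordan_decomposition_def)
      then obtain U where "poly_group U" "U 1 = u" "\<And>t. U t \<in> ?H"
        using mult_jordan_parts[OF closed _ mem(2)[OF trace_kernelD(1)[OF u]] pow[OF u]] by metis
      then show ?thesis by blast
    qed
    then obtain U where U: "\<And>u. u \<in> ?H \<Longrightarrow> poly_group (U u)" "\<And>u. u \<in> ?H \<Longrightarrow> U u 1 = u"
      "\<And>u. u \<in> ?H \<Longrightarrow> range (U u) \<subseteq> ?H" by metis
    have "connectedin zariski (\<Union>u\<in>?H. range (U u))"
    proof (rule connectedin_Union)
      show "connectedin zariski S" if "S \<in> (\<lambda>u. range (U u)) ` ?H" for S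
        using that U(1) connectedin_range_poly_group by blast
      have "mat 1 \<in> range (U u)" if "u \<in> ?H" for u
        using poly_groupD(1)[OF U(1)[OF that]] by (metis rangeI)
      then show "\<Inter>((\<lambda>u. range (U u)) ` ?H) \<noteq> {}" by blast
    qed
    moreover have "(\<Union>u\<in>?H. range (U u)) = ?H"
    proof
      show "?H \<subseteq> (\<Union>u\<in>?H. range (U u))"
      proof
        fix u assume "u \<in> ?H"
        then show "u \<in> (\<Union>u\<in>?H. range (U u))" using U(2) by (metis UN_I rangeI)
      qed
    qed (use U(3) in blast)
    ultimately show ?thesis by simp
  qed
  have subG: "subgroup G GL" using G by (simp add: algebraic_group_def)
  have "?H \<lhd> GL\<lparr>carrier := G\<rparr>"
  proof (rule group.normal_invI)
    show grp: "group (GL\<lparr>carrier := G\<rparr>)"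
      by (rule subgroup.subgroup_is_group[OF subG group_GL])
    have invG: "inv\<^bsub>GL\<lparr>carrier := G\<rparr>\<^esub> A = matrix_inv A" if "A \<in> G" for A
      using group.m_inv_consistent[OF group_GL subG that] inv_GL[OF mem(2)[OF that]] by simp
    show "subgroup ?H (GL\<lparr>carrier := G\<rparr>)"
    proof (rule group.subgroupI[OF grp])
      show "?H \<subseteq> carrier (GL\<lparr>carrier := G\<rparr>)" by (auto simp: trace_kernel_def)
      show "?H \<noteq> {}" using one by blast
      show "inv\<^bsub>GL\<lparr>carrier := G\<rparr>\<^esub> u \<in> ?H" if "u \<in> ?H" for u
        using inv[OF that] that invG by (simp add: trace_kernel_def)
      show "u \<otimes>\<^bsub>GL\<lparr>carrier := G\<rparr>\<^esub> v \<in> ?H" if "u \<in> ?H" "v \<in> ?H" for u v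
        using mult[OF that] by (simp add: GL_def)
    qed
    show "x \<otimes>\<^bsub>GL\<lparr>carrier := G\<rparr>\<^esub> h \<otimes>\<^bsub>GL\<lparr>carrier := G\<rparr>\<^esub> inv\<^bsub>GL\<lparr>carrier := G\<rparr>\<^esub> x \<in> ?H"
      if "x \<in> carrier (GL\<lparr>carrier := G\<rparr>)" "h \<in> ?H" for x h
      using conj[of x h] that invG by (simp add: GL_def)
  qed
  moreover have "unipotent_mat u" if u: "u \<in> ?H" for u
  proof (rule unipotent_if_traces)
    show "trace (mpow u k) = trace (mat 1 :: complex^'n^'n)" for k
      using trace_kernelD(2)[OF pow[OF u] mem(1), of k] by simp
  qed
  ultimately show ?thesis
    using closed connected unfolding unipotent_radical_def by blast
qed

locale reductive_rep = faithful_rep +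
  assumes radical: "unipotent_radical G = {mat 1}"
begin

lemma B_nondegenerate:
  assumes X0: "X0 \<in> \<gg>" and orth: "\<And>Y. Y \<in> \<gg> \<Longrightarrow> B X0 Y = 0"
  shows "X0 = 0"
proof -
  define r where "r = {X\<in>\<gg>. \<forall>Y\<in>\<gg>. B X Y = 0}"
  have nil: "nilpotent_mat X" if "X \<in> r" for X
    by (rule nilpotent_if_trace_zero) (use that in \<open>auto simp: r_def B_def\<close>)
  have "subspace r"
    unfolding subspace_def r_def
    by (auto simp: scaleR_eq_cscale B_linear lie_algebra_zero lie_algebra_add lie_algebra_cscale)
  moreover have "bracket X Y \<in> r" if "X \<in> r" "Y \<in> r" for X Y
    using that by (auto simp: r_def bracket_lie_algebra[OF G] B_bracket)
  ultimately obtain K where K: "flag r K = UNIV" using engel nil by metis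
  have Ad_r: "Ad b X \<in> r" if b: "b \<in> G" and X: "X \<in> r" for b X
  proof -
    have "B (Ad b X) Y = 0" if Y: "Y \<in> \<gg>" for Y
    proof -
      have "B (Ad b X) (Ad b (Ad (matrix_inv b) Y)) = B X (Ad (matrix_inv b) Y)"
        using X by (intro B_Ad b Ad_lie_algebra[OF G] minv_mem Y) (simp add: r_def)
      then show ?thesis
        using X Ad_lie_algebra[OF G minv_mem[OF b] Y] by (simp add: Ad_inverse inv_mem[OF b] r_def)
    qed
    then show ?thesis using X Ad_lie_algebra[OF G b] by (simp add: r_def)
  qed
  \<comment> \<open>The radical \<open>r\<close> is stable under \<open>Ad\<close>, so the group
    preserves its Engel flag.\<close>
  have flag_G: "h *v v \<in> flag r k" if h: "h \<in> G" and v: "v \<in> flag r k" for h k v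
    using v
  proof (induction k arbitrary: v)
    case (Suc k)
    have "t *v (h *v v) \<in> flag r k" if t: "t \<in> r" for t
    proof -
      have "t ** h = h ** Ad (matrix_inv h) t"
        using inv_mem[OF h] by (simp add: Ad_def matrix_inv_matrix_inv matrix_mul_assoc)
      moreover have "Ad (matrix_inv h) t *v v \<in> flag r k"
        using Suc.prems Ad_r[OF minv_mem[OF h] t] by simp
      ultimately show ?thesis using Suc.IH by (simp add: matrix_vector_mul_assoc) (simp flip: matrix_vector_mul_assoc)
    qed
    then show ?case by simp
  qed simp
  have X0r: "X0 \<in> r" using X0 orth by (simp add: r_def)
  have tr0: "trace (X0 ** h) = 0" if "h \<in> G" for h
    by (intro trace_nilpotent nilpotent_mult_flag[OF K X0r] flag_G that)
  obtain U where U: "poly_group U" "mderiv U X0 0" "\<And>t. U t \<in> G"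
    using nilpotent_curve[OF X0 nil[OF X0r]] by metis
  obtain N where N: "\<And>t. mderiv U (U t ** N) t" "\<And>t. U t ** N = N ** U t"
    using poly_group_mderiv[OF U(1)] by metis
  have "N = X0" using mderiv_unique[OF N(1)[of 0] U(2)] poly_groupD(1)[OF U(1)] by simp
  \<comment> \<open>The derivative in \<open>t\<close> is \<open>trace (X0 ** (U t ** h))\<close>,
    and \<open>U t ** h\<close> is again in the group.\<close>
  have "trace (U t ** h) = trace h" if h: "h \<in> G" for t h
  proof -
    have "((\<lambda>t. trace (U t ** h)) has_field_derivative 0) (at t within UNIV)" for t
    proof -
      have "mderiv (\<lambda>t. U t ** h) (U t ** N ** h) t" by (rule mderiv_mult_right[OF N(1)])
      then have "((\<lambda>t. trace (U t ** h)) has_field_derivative trace (U t ** N ** h)) (at t)"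
        by (rule mderiv_trace)
      moreover have "U t ** N ** h = X0 ** (U t ** h)"
        using N(2)[of t] \<open>N = X0\<close> by (simp add: matrix_mul_assoc)
      ultimately show ?thesis by (simp add: tr0 mult_mem U(3) h)
    qed
    then have "\<exists>c. \<forall>t\<in>UNIV. trace (U t ** h) = c"
      by (intro has_field_derivative_zero_constant) auto
    then have "trace (U t ** h) = trace (U 0 ** h)" by auto
    then show ?thesis by (simp add: poly_groupD(1)[OF U(1)])
  qed
  then have "U t \<in> trace_kernel G" for t by (simp add: trace_kernel_def U(3))
  then have "U t = mat 1" for t
    using trace_kernel_subset_unipotent_radical[OF G] radical by blast
  then have "U = (\<lambda>t. mat 1)" by auto
  then show ?thesis using mderiv_unique[OF U(2)] mderiv_const by metis
qed

end

section \<open>The Cayley map\<close>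

text \<open>\<open>ad S\<close> acts diagonally in an eigenbasis of \<open>S\<close>, with factors
  \<open>d i - d j\<close>, so its square has the same kernel.\<close>

lemma semisimple_bracket_bracket:
  fixes S Y :: "complex^'n^'n"
  assumes S: "semisimple_mat S" and 0: "bracket S (bracket S Y) = 0"
  shows "bracket S Y = 0"
proof -
  obtain P :: "complex^'n^'n" and d where P: "invertible P" "S = P ** diagmat d ** matrix_inv P"
    using S unfolding semisimple_mat_iff fc_def by blast
  have conj: "bracket S (P ** M ** matrix_inv P) = P ** bracket (diagmat d) M ** matrix_inv P" for M
    using P(1) by (simp add: P(2) bracket_def mat_distribs matrix_mul_assoc)
  define Y' where "Y' = matrix_inv P ** Y ** P"
  have Y: "Y = P ** Y' ** matrix_inv P" using P(1) by (simp add: Y'_def matrix_mul_assoc)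
  have "P ** bracket (diagmat d) (bracket (diagmat d) Y') ** matrix_inv P = 0"
    using 0 by (simp add: Y conj)
  then have "matrix_inv P ** (P ** bracket (diagmat d) (bracket (diagmat d) Y') ** matrix_inv P) ** P = 0"
    by simp
  then have "bracket (diagmat d) (bracket (diagmat d) Y') = 0"
    using P(1) by (simp add: matrix_mul_assoc)
  then have "d i * (d i * Y' $ i $ j - Y' $ i $ j * d j) - (d i * Y' $ i $ j - Y' $ i $ j * d j) * d j = 0" for i j
    by (simp add: bracket_def vec_eq_iff)
  then have "(d i - d j) * ((d i - d j) * Y' $ i $ j) = 0" for i j
    by (simp add: algebra_simps)
  then have "(d i - d j) * Y' $ i $ j = 0" for i j
    by (metis mult_eq_0_iff)
  then have "bracket (diagmat d) Y' = 0"
    by (simp add: bracket_def vec_eq_iff algebra_simps)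
  then show ?thesis by (simp add: Y conj)
qed

lemma bracket_eq_0_iff: "bracket X Y = 0 \<longleftrightarrow> X ** Y = Y ** X"
  by (simp add: bracket_def)

text \<open>\<open>a = s + s (u - 1)\<close> is the additive Jordan decomposition, to which the
  bicommutant property applies.\<close>

lemma mult_jordan_commute:
  fixes a :: "complex^'n^'n"
  assumes jd: "mult_jordan_decomposition a s u" and inv: "invertible a" and M: "a ** M = M ** a"
  shows "s ** M = M ** s" "u ** M = M ** u"
proof -
  have a: "a = s ** u" "s ** u = u ** s" "nilpotent_mat (u - mat 1)"
    using jd unfolding mult_jordan_decomposition_def unipotent_mat_def by auto
  obtain P d where P: "invertible P" "s = fc P d (\<lambda>z. z)"
    using jd unfolding mult_jordan_decomposition_def semisimple_mat_iff by blast
  define N where "N = s ** (u - mat 1)"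
  have "s ** (u - mat 1) = (u - mat 1) ** s" using a(2) by (simp add: mat_distribs)
  then have nil: "nilpotent_mat N"
    unfolding N_def using nilpotent_mult_commute(2)[OF a(3), of s] by simp
  have sN: "s ** N = N ** s"
    unfolding N_def by (simp add: mat_distribs a(2) matrix_mul_assoc)
  have aN: "a = s + N" unfolding N_def a(1) by (simp add: mat_distribs)
  show sM: "s ** M = M ** s"
    unfolding P(2) by (rule commute_jordan_fc[OF P(1) nil]) (use sN aN M P(2) in simp_all)
  have "invertible s" using inv unfolding a(1) by (simp add: invertible_det_nz det_mul)
  then have "matrix_inv s ** a = u" "matrix_inv s ** M = M ** matrix_inv s"
    using matrix_inv_commute[OF _ sM] by (simp_all add: a(1))
  then show "u ** M = M ** u" using M by (metis matrix_mul_assoc)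
qed

lemma poly_group_commute_derivative:
  assumes U: "poly_group U" and N: "mderiv U N 0" and Z: "Z ** N = N ** Z"
  shows "U t ** Z = Z ** U t"
proof -
  obtain N' where N': "\<And>t. mderiv U (U t ** N') t" "\<And>t. U t ** N' = N' ** U t"
    using poly_group_mderiv[OF U] by metis
  have "N' = N" using mderiv_unique[OF N'(1)[of 0] N] poly_groupD(1)[OF U] by simp
  define \<kappa> where "\<kappa> t = U t ** Z ** U (- t)" for t
  have "mderiv \<kappa> 0 t" for t
  proof -
    have "mderiv (\<lambda>t. U t ** Z) (U t ** N ** Z) t"
      using mderiv_mult_right[OF N'(1)] \<open>N' = N\<close> by blast
    moreover have "mderiv (\<lambda>t. U (- t)) (- (U (- t) ** N)) t"
      using mderiv_minus[OF N'(1)] \<open>N' = N\<close> by blast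
    ultimately have "mderiv \<kappa> (U t ** N ** Z ** U (- t) + U t ** Z ** (- (U (- t) ** N))) t"
      unfolding \<kappa>_def[abs_def] by (rule mderiv_mult)
    moreover have "U t ** Z ** (U (- t) ** N) = U t ** N ** Z ** U (- t)"
    proof -
      have "U t ** Z ** (U (- t) ** N) = U t ** (Z ** N) ** U (- t)"
        using N'(2)[of "- t"] \<open>N' = N\<close> by (simp add: matrix_mul_assoc)
      then show ?thesis by (simp add: Z matrix_mul_assoc)
    qed
    ultimately show ?thesis by simp
  qed
  then have "\<kappa> t = \<kappa> 0" by (rule mderiv_zero_imp_const)
  then have "U t ** Z ** U (- t) ** U t = Z ** U t"
    by (simp add: \<kappa>_def poly_groupD(1)[OF U])
  then show ?thesis by (simp add: poly_groupD(4)[OF U] flip: matrix_mul_assoc)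
qed

section \<open>Existence and equivariance of the Cayley map\<close>

context reductive_rep
begin

lemma B_unique:
  assumes "X \<in> \<gg>" "Y \<in> \<gg>" "\<And>W. W \<in> \<gg> \<Longrightarrow> B X W = B Y W"
  shows "X = Y"
  using B_nondegenerate[of "X - Y"] lie_algebra_diff[OF assms(1,2)] assms(3) by (simp add: B_linear)

abbreviation "\<Phi> \<equiv> cayley_map G \<pi>"

lemma cayley_map: "\<Phi> g \<in> \<gg>" "X \<in> \<gg> \<Longrightarrow> B (\<Phi> g) X = trace (\<pi> g ** L X)"
proof -
  obtain Y where Y: "Y \<in> \<gg>" "\<And>X. X \<in> \<gg> \<Longrightarrow> B Y X = trace (\<pi> g ** L X)"
    using B_represents[OF subspace_lie_algebra B_nondegenerate] by metis
  have "\<Phi> g = Y"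
    unfolding cayley_map_def
  proof (rule the_equality)
    show "Y \<in> \<gg> \<and> (\<forall>X\<in>\<gg>. trace (differential G \<pi> Y ** differential G \<pi> X) = trace (\<pi> g ** differential G \<pi> X))"
      using Y by (simp add: L_differential B_def)
  next
    fix Y' assume "Y' \<in> \<gg> \<and> (\<forall>X\<in>\<gg>. trace (differential G \<pi> Y' ** differential G \<pi> X) = trace (\<pi> g ** differential G \<pi> X))"
    then have Y': "Y' \<in> \<gg>"
      and "\<forall>X\<in>\<gg>. trace (differential G \<pi> Y' ** differential G \<pi> X) = trace (\<pi> g ** differential G \<pi> X)"
      by blast+
    then have "B Y' X = trace (\<pi> g ** L X)" if "X \<in> \<gg>" for X
      using that by (simp add: L_differential B_def)
    with Y' have "Y' \<in> \<gg>" "\<And>X. X \<in> \<gg> \<Longrightarrow> B Y' X = trace (\<pi> g ** L X)" by blast+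
    then show "Y' = Y" using Y by (intro B_unique) auto
  qed
  with Y show "\<Phi> g \<in> \<gg>" "X \<in> \<gg> \<Longrightarrow> B (\<Phi> g) X = trace (\<pi> g ** L X)" by simp_all
qed

text \<open>\<open>Ad b (\<Phi> g)\<close> and \<open>\<Phi> g\<close> represent the same
  functional: by invariance of \<open>B\<close> the conjugation moves to \<open>\<pi> g\<close>,
  which commutes with \<open>\<pi> b\<close>.\<close>

lemma cayley_map_commute:
  assumes b: "b \<in> G" and g: "g \<in> G" and bg: "b ** g = g ** b"
  shows "b ** \<Phi> g = \<Phi> g ** b"
proof -
  let ?b = "\<pi> b"
  have inv: "invertible ?b" by (rule pi_invertible[OF b])
  have comm: "?b ** \<pi> g = \<pi> g ** ?b" using bg by (simp add: b g flip: pi_mult)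
  have "Ad b (\<Phi> g) = \<Phi> g"
  proof (rule B_unique)
    fix X assume X: "X \<in> \<gg>"
    have X': "Ad (matrix_inv b) X \<in> \<gg>" by (rule Ad_lie_algebra[OF G minv_mem[OF b] X])
    have "B (Ad b (\<Phi> g)) X = B (Ad b (\<Phi> g)) (Ad b (Ad (matrix_inv b) X))"
      by (simp add: Ad_inverse inv_mem[OF b])
    also have "\<dots> = B (\<Phi> g) (Ad (matrix_inv b) X)" by (rule B_Ad[OF b cayley_map(1) X'])
    also have "\<dots> = trace (\<pi> g ** Ad (matrix_inv ?b) (L X))"
      by (simp add: cayley_map(2)[OF X'] L_Ad[OF minv_mem[OF b] X] pi_inv[OF b])
    also have "\<dots> = trace (\<pi> g ** matrix_inv ?b ** L X ** ?b)"
      by (simp add: Ad_def matrix_inv_matrix_inv[OF inv] matrix_mul_assoc)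
    also have "\<dots> = trace (?b ** (\<pi> g ** matrix_inv ?b ** L X))"
      by (rule trace_mul_sym)
    also have "\<dots> = trace (\<pi> g ** L X)"
      using inv by (simp add: matrix_mul_assoc comm)
    finally show "B (Ad b (\<Phi> g)) X = B (\<Phi> g) X" by (simp add: cayley_map(2)[OF X])
  qed (simp_all add: cayley_map(1) Ad_lie_algebra[OF G b])
  then show ?thesis by (simp add: Ad_eq_iff inv_mem[OF b])
qed

end

section \<open>The centralizer of the semisimple part\<close>

locale cayley_jordan = reductive_rep +
  fixes a s u
  assumes a: "a \<in> G" and jd: "mult_jordan_decomposition a s u"
begin

lemma semisimple_s: "semisimple_mat s"
  and a_eq: "a = s ** u"
  and su: "s ** u = u ** s"
  using jd unfolding mult_jordan_decomposition_def by auto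

lemma jordan_parts_mem:
  obtains U where "s \<in> G" "u \<in> G" "poly_group U" "U 1 = u"
    "\<And>M t. M ** u = u ** M \<Longrightarrow> M ** U t = U t ** M" "\<And>t. U t \<in> G"
  using mult_jordan_parts[OF algebraic_groupD(5)[OF G] jd inv_mem[OF a] algebraic_group_mpow[OF G a]] by metis

lemma s_mem: "s \<in> G" and u_mem: "u \<in> G"
  using jordan_parts_mem by metis+

abbreviation "\<hh> \<equiv> fixed_by \<gg> s"
abbreviation "\<cc> \<equiv> lie_center \<hh>"
abbreviation "\<ss> \<equiv> derived_algebra \<hh>"

lemma h_iff: "X \<in> \<hh> \<longleftrightarrow> X \<in> \<gg> \<and> s ** X = X ** s"
  by (simp add: fixed_by_def Ad_eq_iff inv_mem[OF s_mem])

lemma subspace_h: "cmat.subspace \<hh>"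
  by (rule cmat.subspaceI)
     (auto simp: h_iff lie_algebra_zero lie_algebra_add lie_algebra_cscale mat_distribs)

lemma bracket_h:
  assumes "X \<in> \<hh>" "Y \<in> \<hh>"
  shows "bracket X Y \<in> \<hh>"
proof -
  have X: "X \<in> \<gg>" "s ** X = X ** s" and Y: "Y \<in> \<gg>" "s ** Y = Y ** s"
    using assms by (auto simp: h_iff)
  have "s ** (X ** Y) = X ** Y ** s" "s ** (Y ** X) = Y ** X ** s"
    using X(2) Y(2) by (metis matrix_mul_assoc)+
  then show ?thesis
    using bracket_lie_algebra[OF G X(1) Y(1)] by (simp add: h_iff) (simp add: bracket_def mat_distribs)
qed

text \<open>The algebra fixed by \<open>s\<close> is the kernel of \<open>Ad s - 1\<close>, and what
  is \<open>B\<close>-orthogonal to it lies in the image of that map. Kernel and image meet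
  trivially because \<open>s\<close> is semisimple.\<close>

lemma B_nondegenerate_h:
  assumes X: "X \<in> \<hh>" and orth: "\<And>Y. Y \<in> \<hh> \<Longrightarrow> B X Y = 0"
  shows "X = 0"
proof -
  note sinv = inv_mem[OF s_mem]
  define I where "I = (\<lambda>Y. Ad s Y - Y) ` \<gg>"
  have Ad_lin: "Ad s (Y + Z) = Ad s Y + Ad s Z" "Ad s (cscale c Y) = cscale c (Ad s Y)" for Y Z c
    by (simp_all add: Ad_def mat_distribs)
  have sub: "cmat.subspace I"
  proof (rule cmat.subspaceI)
    show "0 \<in> I" unfolding I_def
      by (rule image_eqI[of _ _ 0]) (simp_all add: Ad_def lie_algebra_zero)
  next
    fix Y Z assume "Y \<in> I" "Z \<in> I"
    then obtain Y' Z' where "Y' \<in> \<gg>" "Z' \<in> \<gg>" "Y = Ad s Y' - Y'" "Z = Ad s Z' - Z'"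
      unfolding I_def by blast
    then show "Y + Z \<in> I" unfolding I_def
      by (intro image_eqI[of _ _ "Y' + Z'"]) (simp_all add: Ad_lin lie_algebra_add)
  next
    fix c Y assume "Y \<in> I"
    then obtain Y' where "Y' \<in> \<gg>" "Y = Ad s Y' - Y'" unfolding I_def by blast
    then show "cscale c Y \<in> I" unfolding I_def
      by (intro image_eqI[of _ _ "cscale c Y'"]) (simp_all add: Ad_lin cscale_distribs lie_algebra_cscale)
  qed
  have Ig: "I \<subseteq> \<gg>"
    unfolding I_def using Ad_lie_algebra[OF G s_mem] lie_algebra_diff by blast
  have Xg: "X \<in> \<gg>" using X by (simp add: h_iff)
  have "X \<in> I"
  proof (rule B_double_orthogonal[OF subspace_lie_algebra B_nondegenerate sub Ig Xg])
    \<comment> \<open>Orthogonality to the image means, by invariance, that \<open>Z\<close> is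
      fixed by \<open>Ad s\<close>.\<close>
    fix Z assume Z: "Z \<in> \<gg>" and ZI: "\<And>Y. Y \<in> I \<Longrightarrow> B Z Y = 0"
    have "Ad s Z = Z"
    proof (rule B_unique)
      fix W assume W: "W \<in> \<gg>"
      define W' where "W' = Ad (matrix_inv s) W"
      have W': "W' \<in> \<gg>" "Ad s W' = W"
        using Ad_lie_algebra[OF G minv_mem[OF s_mem] W] by (simp_all add: W'_def Ad_inverse sinv)
      have "B (Ad s Z) W = B Z W'" using B_Ad[OF s_mem Z W'(1)] by (simp add: W'(2))
      moreover have "B Z (Ad s W' - W') = 0" by (rule ZI) (simp add: I_def W'(1))
      ultimately show "B (Ad s Z) W = B Z W" by (simp add: B_linear W'(2))
    qed (simp_all add: Z Ad_lie_algebra[OF G s_mem])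
    then have "Z \<in> \<hh>" using Z by (simp add: fixed_by_def)
    then show "B Z X = 0" using orth[of Z] by (simp add: B_sym[of Z X])
  qed
  then obtain Y where Y: "X = Ad s Y - Y" unfolding I_def by blast
  \<comment> \<open>Turns \<open>X = Ad s Y - Y\<close> into an additive commutator, so that
    semisimplicity of \<open>s\<close> as a matrix can be used.\<close>
  have "X ** s = bracket s Y"
    unfolding Y Ad_def bracket_def using sinv by (simp add: mat_distribs)
  moreover have sX: "s ** X = X ** s" using X by (simp add: h_iff)
  ultimately have "bracket s (bracket s Y) = 0"
    by (metis bracket_eq_0_iff matrix_mul_assoc)
  then have "bracket s Y = 0" by (rule semisimple_bracket_bracket[OF semisimple_s])
  then have "X ** s = 0" using \<open>X ** s = bracket s Y\<close> by simp
  then show ?thesis using sinv by (metis matrix_inv_cancel(2) matrix_mul_zero_left)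
qed

lemma c_iff: "Z \<in> \<cc> \<longleftrightarrow> Z \<in> \<hh> \<and> (\<forall>Y\<in>\<hh>. Z ** Y = Y ** Z)"
  by (simp add: lie_center_def bracket_eq_0_iff)

lemma subspace_c: "cmat.subspace \<cc>"
  by (rule cmat.subspaceI)
     (auto simp: c_iff mat_distribs cmat.subspace_0[OF subspace_h] cmat.subspace_add[OF subspace_h]
       cmat.subspace_scale[OF subspace_h])

text \<open>\<open>Z\<close> commutes with all of \<open>\<hh>\<close>, so every product
  \<open>L Z ** L Y\<close> is nilpotent and has trace zero.\<close>

lemma c_nilpotent:
  assumes Z: "Z \<in> \<cc>" and "nilpotent_mat Z"
  shows "Z = 0"
proof (rule B_nondegenerate_h)
  show "Z \<in> \<hh>" using Z by (simp add: c_iff)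
  show "B Z Y = 0" if "Y \<in> \<hh>" for Y
    unfolding B_def by (rule trace_nilpotent_commute) (use assms that in \<open>auto simp: c_iff h_iff\<close>)
qed

text \<open>Keeps Jordan parts and replicas of central elements central.\<close>

lemma c_bicommutant:
  assumes Z: "Z \<in> \<cc>" and Y: "Y \<in> \<gg>" and comm: "\<And>M. Z ** M = M ** Z \<Longrightarrow> Y ** M = M ** Y"
  shows "Y \<in> \<cc>"
proof -
  have "Y ** s = s ** Y" by (rule comm) (use Z in \<open>simp add: c_iff h_iff\<close>)
  then have "Y \<in> \<hh>" using Y by (simp add: h_iff)
  moreover have "Y ** W = W ** Y" if "W \<in> \<hh>" for W
    by (rule comm) (use Z that in \<open>simp add: c_iff\<close>)
  ultimately show ?thesis by (simp add: c_iff)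
qed

lemma c_semisimple:
  assumes Z: "Z \<in> \<cc>"
  shows "semisimple_mat Z"
proof -
  have "Z \<in> \<gg>" using Z by (simp add: c_iff h_iff)
  then obtain P d N where jdZ: "add_jordan_decomposition Z (fc P d (\<lambda>z. z)) N" and N: "N \<in> \<gg>"
    and comm: "\<forall>M. Z ** M = M ** Z \<longrightarrow> (\<forall>g. fc P d g ** M = M ** fc P d g) \<and> N ** M = M ** N"
    by (rule jordan_parts_lie_algebra)
  have "N \<in> \<cc>" by (rule c_bicommutant[OF Z N]) (use comm in blast)
  moreover have "nilpotent_mat N" using jdZ by (simp add: add_jordan_decomposition_def)
  ultimately have "N = 0" by (rule c_nilpotent)
  then show ?thesis using jdZ by (simp add: add_jordan_decomposition_def)
qed

text \<open>The bicommutant of \<open>Z\<close> within \<open>\<gg>\<close> is central, so the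
  criterion makes \<open>Z\<close> nilpotent and hence zero.\<close>

lemma B_nondegenerate_c:
  assumes Z: "Z \<in> \<cc>" and orth: "\<And>Y. Y \<in> \<cc> \<Longrightarrow> B Z Y = 0"
  shows "Z = 0"
proof (rule c_nilpotent[OF Z])
  show "nilpotent_mat Z"
  proof (rule nilpotent_if_trace_zero)
    show "Z \<in> \<gg>" using Z by (simp add: c_iff h_iff)
    fix Y assume "Y \<in> \<gg>" "\<And>M. Z ** M = M ** Z \<Longrightarrow> Y ** M = M ** Y"
    then have "Y \<in> \<cc>" by (rule c_bicommutant[OF Z])
    then show "trace (L Z ** L Y) = 0" using orth by (simp add: B_def)
  qed
qed

section \<open>Center and derived algebra of the centralizer\<close>

lemma subspace_s: "cmat.subspace \<ss>"
  unfolding derived_algebra_def by (rule cmat.subspace_span)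

lemma s_subset_h: "\<ss> \<subseteq> \<hh>"
  unfolding derived_algebra_def
  by (rule cmat.span_minimal[OF _ subspace_h]) (use bracket_h in blast)

lemma bracket_mem_s: "X \<in> \<hh> \<Longrightarrow> Y \<in> \<hh> \<Longrightarrow> bracket X Y \<in> \<ss>"
  unfolding derived_algebra_def by (rule cmat.span_base) blast

lemma B_bracket_h:
  "X \<in> \<hh> \<Longrightarrow> Y \<in> \<hh> \<Longrightarrow> Z \<in> \<hh> \<Longrightarrow> B (bracket X Y) Z = B X (bracket Y Z)"
  by (rule B_bracket) (simp_all add: h_iff)

lemma c_orthogonal_s:
  assumes Z: "Z \<in> \<cc>" and W: "W \<in> \<ss>"
  shows "B Z W = 0"
proof -
  have "{bracket X Y | X Y. X \<in> \<hh> \<and> Y \<in> \<hh>} \<subseteq> {W. B Z W = 0}"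
  proof clarify
    fix X Y assume XY: "X \<in> \<hh>" "Y \<in> \<hh>"
    then have "bracket Z X = 0" using Z by (simp add: c_iff bracket_eq_0_iff)
    then show "B Z (bracket X Y) = 0"
      using B_bracket_h[of Z X Y] XY Z by (simp add: c_iff B_linear)
  qed
  moreover have "cmat.subspace {W. B Z W = 0}"
    by (rule cmat.subspaceI) (simp_all add: B_linear)
  ultimately have "\<ss> \<subseteq> {W. B Z W = 0}"
    unfolding derived_algebra_def by (rule cmat.span_minimal)
  with W show ?thesis by blast
qed

text \<open>By invariance and nondegeneracy an element of \<open>\<hh>\<close> orthogonal to all
  brackets is central; taking orthogonals again gives the claim.\<close>

lemma orthogonal_c_imp_s:
  assumes W: "W \<in> \<hh>" and orth: "\<And>Z. Z \<in> \<cc> \<Longrightarrow> B Z W = 0"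
  shows "W \<in> \<ss>"
proof (rule B_double_orthogonal[OF subspace_h B_nondegenerate_h subspace_s s_subset_h W])
  fix Z assume Z: "Z \<in> \<hh>" and Zs: "\<And>Y. Y \<in> \<ss> \<Longrightarrow> B Z Y = 0"
  have "bracket Z X = 0" if X: "X \<in> \<hh>" for X
  proof (rule B_nondegenerate_h[OF bracket_h[OF Z X]])
    show "B (bracket Z X) Y = 0" if "Y \<in> \<hh>" for Y
      unfolding B_bracket_h[OF Z X that] by (rule Zs[OF bracket_mem_s[OF X that]])
  qed
  then have "Z \<in> \<cc>" using Z by (simp add: lie_center_def)
  then show "B Z W = 0" by (rule orth)
qed

text \<open>\<open>Z\<close> is known to commute with Lie algebra elements only, so \<open>u\<close>
  is replaced by the velocity \<open>N\<close> of its one-parameter group, which lies in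
  \<open>\<hh>\<close> because \<open>u\<close> commutes with \<open>s\<close>.\<close>

lemma c_commute_u:
  assumes Z: "Z \<in> \<cc>"
  shows "u ** Z = Z ** u"
proof -
  obtain U where U: "poly_group U" "U 1 = u" "\<And>M t. M ** u = u ** M \<Longrightarrow> M ** U t = U t ** M" "\<And>t. U t \<in> G"
    using jordan_parts_mem by metis
  obtain N where N0: "\<And>t. mderiv U (U t ** N) t" using poly_group_mderiv[OF U(1)] by metis
  have N: "mderiv U N 0" using N0[of 0] by (simp add: poly_groupD(1)[OF U(1)])
  have "N \<in> \<gg>" by (rule lie_algebraI[OF U(4) N poly_groupD(1)[OF U(1)]])
  moreover have "s ** N = N ** s"
  proof (rule mderiv_unique)
    show "mderiv (\<lambda>t. s ** U t) (s ** N) 0" by (rule mderiv_mult_left[OF N])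
    show "mderiv (\<lambda>t. s ** U t) (N ** s) 0"
      unfolding U(3)[OF su] by (rule mderiv_mult_right[OF N])
  qed
  ultimately have "N \<in> \<hh>" by (simp add: h_iff)
  then have "Z ** N = N ** Z" using Z by (simp add: c_iff)
  then show ?thesis using poly_group_commute_derivative[OF U(1) N, of Z 1] U(2) by simp
qed

text \<open>The difference of the two matrices is \<open>(\<pi> u - 1) \<pi> s (L Y)\<close>, a
  nilpotent matrix times one that commutes with it.\<close>

lemma trace_difference:
  assumes Y: "Y \<in> \<gg>" and "s ** Y = Y ** s" "u ** Y = Y ** u"
  shows "trace (\<pi> a ** L Y) = trace (\<pi> s ** L Y)"
proof -
  obtain U where U: "poly_group U" "U 1 = u" "\<And>t. U t \<in> G"
    using jordan_parts_mem by metis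
  have nil: "nilpotent_mat (\<pi> u - mat 1)"
    using poly_group_unipotent[OF pi_poly_group[OF U(1,3)], of 1] U(2) by (simp add: unipotent_mat_def)
  have u: "\<pi> u ** \<pi> s = \<pi> s ** \<pi> u"
    using su by (simp add: s_mem u_mem flip: pi_mult)
  have uY: "\<pi> u ** L Y = L Y ** \<pi> u" by (rule L_commute_pi[OF u_mem Y assms(3)])
  have "(\<pi> u - mat 1) ** (\<pi> s ** L Y) = (\<pi> s ** L Y) ** (\<pi> u - mat 1)"
  proof -
    have "\<pi> u ** (\<pi> s ** L Y) = \<pi> s ** L Y ** \<pi> u"
      using u uY by (metis matrix_mul_assoc)
    then show ?thesis by (simp add: mat_distribs)
  qed
  then have "trace ((\<pi> u - mat 1) ** (\<pi> s ** L Y)) = 0"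
    by (intro trace_nilpotent nilpotent_mult_commute(1)[OF nil])
  moreover have "\<pi> a = \<pi> u ** \<pi> s"
    unfolding a_eq su by (rule pi_mult[OF u_mem s_mem])
  ultimately show ?thesis by (simp add: mat_distribs trace_sub matrix_mul_assoc)
qed

text \<open>\<open>B (bracket (\<Phi> s) Y) W\<close> is the trace of \<open>\<pi> s\<close> times a
  commutator with \<open>L Y\<close>, and \<open>\<pi> s\<close> commutes with
  \<open>L Y\<close>.\<close>

lemma cayley_semisimple_mem_c: "\<Phi> s \<in> \<cc>"
proof -
  have h: "\<Phi> s \<in> \<hh>"
    using cayley_map(1) cayley_map_commute[OF s_mem s_mem refl] by (simp add: h_iff)
  moreover have "bracket (\<Phi> s) Y = 0" if Y: "Y \<in> \<hh>" for Y
  proof (rule B_nondegenerate)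
    have Yg: "Y \<in> \<gg>" "s ** Y = Y ** s" using Y by (auto simp: h_iff)
    show "bracket (\<Phi> s) Y \<in> \<gg>" by (rule bracket_lie_algebra[OF G cayley_map(1) Yg(1)])
    fix W assume W: "W \<in> \<gg>"
    have "B (bracket (\<Phi> s) Y) W = trace (\<pi> s ** L (bracket Y W))"
      using B_bracket[OF cayley_map(1) Yg(1) W] cayley_map(2)[OF bracket_lie_algebra[OF G Yg(1) W]] by simp
    also have "\<dots> = trace (\<pi> s ** L Y ** L W) - trace (\<pi> s ** L W ** L Y)"
      unfolding L_bracket[OF Yg(1) W] by (simp add: bracket_def mat_distribs trace_sub matrix_mul_assoc)
    also have "trace (\<pi> s ** L W ** L Y) = trace (L Y ** (\<pi> s ** L W))" by (rule trace_mul_sym)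
    also have "\<dots> = trace (\<pi> s ** L Y ** L W)"
      by (simp add: matrix_mul_assoc L_commute_pi[OF s_mem Yg])
    finally show "B (bracket (\<Phi> s) Y) W = 0" by simp
  qed
  ultimately show ?thesis by (simp add: lie_center_def)
qed

section \<open>Direct sum and Jordan decomposition\<close>

lemma fixed_by_a_iff: "X \<in> fixed_by \<gg> a \<longleftrightarrow> X \<in> \<hh> \<and> u ** X = X ** u"
proof -
  have "a ** X = X ** a \<longleftrightarrow> s ** X = X ** s \<and> u ** X = X ** u"
  proof
    assume "a ** X = X ** a"
    then show "s ** X = X ** s \<and> u ** X = X ** u"
      using mult_jordan_commute[OF jd inv_mem[OF a]] by blast
  next
    assume "s ** X = X ** s \<and> u ** X = X ** u"
    then show "a ** X = X ** a" unfolding a_eq by (metis matrix_mul_assoc)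
  qed
  then show ?thesis by (auto simp: fixed_by_def Ad_eq_iff inv_mem[OF a] inv_mem[OF s_mem])
qed

lemma fixed_by_u_iff: "X \<in> fixed_by \<ss> u \<longleftrightarrow> X \<in> \<ss> \<and> u ** X = X ** u"
  by (simp add: fixed_by_def Ad_eq_iff inv_mem[OF u_mem])

lemma centralizer_direct_sum: "is_direct_sum (fixed_by \<gg> a) \<cc> (fixed_by \<ss> u)"
  unfolding is_direct_sum_def
proof (intro conjI)
  show "cmat.subspace \<cc>" by (rule subspace_c)
  show "cmat.subspace (fixed_by \<ss> u)"
    by (rule cmat.subspaceI)
       (auto simp: fixed_by_u_iff mat_distribs cmat.subspace_0[OF subspace_s]
         cmat.subspace_add[OF subspace_s] cmat.subspace_scale[OF subspace_s])
  show "\<cc> \<inter> fixed_by \<ss> u = {0}"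
  proof -
    have "Z = 0" if "Z \<in> \<cc>" "Z \<in> \<ss>" for Z
      by (rule B_nondegenerate_c[OF that(1)])
         (use c_orthogonal_s[OF _ that(2)] B_sym[of Z] in simp)
    moreover have "0 \<in> \<cc>" "0 \<in> fixed_by \<ss> u"
      using cmat.subspace_0[OF subspace_c] cmat.subspace_0[OF subspace_s] by (simp_all add: fixed_by_u_iff)
    ultimately show ?thesis by (auto simp: fixed_by_u_iff)
  qed
  show "fixed_by \<gg> a = {X + Y | X Y. X \<in> \<cc> \<and> Y \<in> fixed_by \<ss> u}"
  proof (intro equalityI subsetI)
    fix X assume "X \<in> fixed_by \<gg> a"
    then have X: "X \<in> \<hh>" "u ** X = X ** u" by (simp_all add: fixed_by_a_iff)
    \<comment> \<open>The \<open>B\<close>-orthogonal projection of \<open>X\<close> to the center,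
      which exists as \<open>B\<close> is nondegenerate there.\<close>
    obtain Z where Z: "Z \<in> \<cc>" "\<And>Y. Y \<in> \<cc> \<Longrightarrow> B Z Y = trace (L X ** L Y)"
      using B_represents[OF subspace_c B_nondegenerate_c, of "L X"] by blast
    have Zh: "Z \<in> \<hh>" using Z(1) by (simp add: c_iff)
    have "X - Z \<in> \<ss>"
    proof (rule orthogonal_c_imp_s)
      show "X - Z \<in> \<hh>" by (rule cmat.subspace_diff[OF subspace_h X(1) Zh])
      show "B Y (X - Z) = 0" if "Y \<in> \<cc>" for Y
        using Z(2)[OF that] by (simp add: B_sym[of Y] B_linear) (simp add: B_def)
    qed
    moreover have "u ** (X - Z) = (X - Z) ** u"
      using X(2) c_commute_u[OF Z(1)] by (simp add: mat_distribs)
    ultimately have "X - Z \<in> fixed_by \<ss> u" by (simp add: fixed_by_u_iff)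
    moreover have "X = Z + (X - Z)" by simp
    ultimately show "X \<in> {X + Y | X Y. X \<in> \<cc> \<and> Y \<in> fixed_by \<ss> u}" using Z(1) by blast
  next
    fix X assume "X \<in> {X + Y | X Y. X \<in> \<cc> \<and> Y \<in> fixed_by \<ss> u}"
    then obtain Z Y where X: "X = Z + Y" "Z \<in> \<cc>" "Y \<in> \<ss>" "u ** Y = Y ** u"
      by (auto simp: fixed_by_u_iff)
    moreover have "Z \<in> \<hh>" "Y \<in> \<hh>" using X(2,3) s_subset_h by (auto simp: c_iff)
    ultimately show "X \<in> fixed_by \<gg> a"
      using c_commute_u[OF X(2)] cmat.subspace_add[OF subspace_h]
      by (simp add: fixed_by_a_iff mat_distribs)
  qed
qed

lemma cayley_jordan_decomposition:
  "add_jordan_decomposition (\<Phi> a) (\<Phi> s) (\<Phi> a - \<Phi> s)"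
  "\<Phi> a \<in> fixed_by \<gg> a" "\<Phi> a - \<Phi> s \<in> fixed_by \<ss> u"
proof -
  define M where "M = \<Phi> a - \<Phi> s"
  have sa: "s ** a = a ** s" and ua: "u ** a = a ** u"
    unfolding a_eq using su by (metis matrix_mul_assoc)+
  have sM: "s ** M = M ** s" and uM: "u ** M = M ** u"
    unfolding M_def
    using cayley_map_commute[OF s_mem a sa] cayley_map_commute[OF u_mem a ua]
      cayley_map_commute[OF s_mem s_mem refl] cayley_map_commute[OF u_mem s_mem su[symmetric]]
    by (simp_all add: mat_distribs)
  have Mg: "M \<in> \<gg>" unfolding M_def by (rule lie_algebra_diff[OF cayley_map(1) cayley_map(1)])
  then have Mh: "M \<in> \<hh>" using sM by (simp add: h_iff)
  have orth: "B M Y = 0" if "Y \<in> \<gg>" "s ** Y = Y ** s" "u ** Y = Y ** u" for Y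
    using trace_difference[OF that] by (simp add: M_def B_linear cayley_map(2)[OF that(1)])
  have "M \<in> \<ss>"
  proof (rule orthogonal_c_imp_s[OF Mh])
    show "B Z M = 0" if "Z \<in> \<cc>" for Z
      using orth[of Z] that c_commute_u[OF that] by (simp add: B_sym[of Z] c_iff h_iff)
  qed
  then show "\<Phi> a - \<Phi> s \<in> fixed_by \<ss> u"
    using uM unfolding M_def[symmetric] by (simp add: fixed_by_u_iff)
  \<comment> \<open>\<open>s\<close> and \<open>u\<close> commute with \<open>M\<close>, so every
    \<open>Y\<close> in the bicommutant of \<open>M\<close> commutes with them and
    \<open>orth\<close> applies.\<close>
  have "nilpotent_mat M"
  proof (rule nilpotent_if_trace_zero[OF Mg])
    fix Y assume Y: "Y \<in> \<gg>" and comm: "\<And>M'. M ** M' = M' ** M \<Longrightarrow> Y ** M' = M' ** Y"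
    have "B M Y = 0"
      by (rule orth[OF Y]) (use comm[OF sM[symmetric]] comm[OF uM[symmetric]] in simp_all)
    then show "trace (L M ** L Y) = 0" by (simp add: B_def)
  qed
  moreover have "\<Phi> s ** M = M ** \<Phi> s"
    using cayley_semisimple_mem_c Mh by (simp add: c_iff)
  ultimately show "add_jordan_decomposition (\<Phi> a) (\<Phi> s) (\<Phi> a - \<Phi> s)"
    using c_semisimple[OF cayley_semisimple_mem_c]
    by (simp add: add_jordan_decomposition_def M_def)
  show "\<Phi> a \<in> fixed_by \<gg> a"
    using cayley_map(1) cayley_map_commute[OF a a refl]
    by (simp add: fixed_by_def Ad_eq_iff inv_mem[OF a])
qed

end

theorem theorem4p11:
  fixes G :: "(complex^'n^'n) set"
    and \<pi> :: "complex^'n^'n \<Rightarrow> complex^'m^'m"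
    and a a\<^sub>s a\<^sub>u :: "complex^'n^'n"
    and \<gg> \<cc> \<ss> :: "(complex^'n^'n) set"
    and \<Phi> :: "complex^'n^'n \<Rightarrow> complex^'n^'n"
  assumes "connected_reductive_group G"
    and "rational_rep G \<pi>"
    and "infinitesimally_faithful G \<pi>"
    and "a \<in> G"
    and "mult_jordan_decomposition a a\<^sub>s a\<^sub>u"
  defines "\<gg> \<equiv> lie_algebra G"
    and "\<Phi> \<equiv> cayley_map G \<pi>"
    and "\<cc> \<equiv> lie_center (fixed_by \<gg> a\<^sub>s)"
    and "\<ss> \<equiv> derived_algebra (fixed_by \<gg> a\<^sub>s)"
  shows "is_direct_sum (fixed_by \<gg> a) \<cc> (fixed_by \<ss> a\<^sub>u)
    \<and> \<Phi> a\<^sub>s = semisimple_part (\<Phi> a)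
    \<and> add_jordan_decomposition (\<Phi> a) (\<Phi> a\<^sub>s) (nilpotent_part (\<Phi> a))
    \<and> \<Phi> a = \<Phi> a\<^sub>s + nilpotent_part (\<Phi> a)
    \<and> \<Phi> a \<in> fixed_by \<gg> a
    \<and> \<Phi> a\<^sub>s \<in> \<cc>
    \<and> nilpotent_part (\<Phi> a) \<in> fixed_by \<ss> a\<^sub>u"
proof -
  interpret cayley_jordan G \<pi> a a\<^sub>s a\<^sub>u
    by unfold_locales (use assms(1-5) in \<open>simp_all add: connected_reductive_group_def\<close>)
  have "semisimple_part (cayley_map G \<pi> a) = cayley_map G \<pi> a\<^sub>s"
    and "nilpotent_part (cayley_map G \<pi> a) = cayley_map G \<pi> a - cayley_map G \<pi> a\<^sub>s"
    by (rule semisimple_part_eq nilpotent_part_eq, rule cayley_jordan_decomposition(1))+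
  then show ?thesis
    unfolding assms(6-9)
    using centralizer_direct_sum cayley_jordan_decomposition cayley_semisimple_mem_c by simp
qed

end
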